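(* Let $d\geq 2$. For $E\subset(0,\infty)$ and a locally integrable $f$ on $\mathbb{R}^d$ let $A_tf(x)=\int_{\mathbb{S}^{d-1}}f(x-ty)\,d\sigma(y)$ and $M_Ef(x)=\sup_{t\in E}|A_tf(x)|$. Then the radial type set of $M_{[1,2]}$ satisfies $$\mathcal{T}^{rad}_{[1,2]}=\Delta(1)\setminus[Q_1(1),Q_2(1)].$$
   Context: $\sigma$ is the normalized surface measure on the unit sphere $\mathbb{S}^{d-1}$. The radial type set is $\mathcal{T}^{rad}_E=\{(1/p,1/q)\in[0,1]^2: M_E \text{ is bounded from } L^p_{rad}(\mathbb{R}^d)\text{ to } L^q(\mathbb{R}^d)\}$, where $L^p_{rad}$ denotes the radial functions in $L^p$ and boundedness means $\|M_Ef\|_{L^q(\mathbb{R}^d)}\le C\|f\|_{L^p(\mathbb{R}^d)}$ for all radial $f$ (with $1/\infty=0$). For $0\le\beta\le1$, $\Delta(\beta)$ is the closed triangle with vertices $O=(0,0)$, $Q_1(\beta)=(\frac{d-1}{d-1+\beta},\frac{d-1}{d-1+\beta})$, $Q_2(\beta)=(\frac{d(d-1)}{d^2-1+\beta},\frac{d-1}{d^2-1+\beta})$. $[P,Q]$ denotes the closed line segment with endpoints $P,Q$. *)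

theory Defs
  imports "HOL-Analysis.Analysis"
begin

text \<open>Normalized surface measure on the unit sphere, realised as the cone measure:
  the push-forward of normalized Lebesgue measure on the unit ball under y |-> y / |y|.
  For the Euclidean sphere this coincides with the normalized surface measure.\<close>
definition sphere_measure :: "'a::euclidean_space measure" where
  "sphere_measure = distr (uniform_measure lborel (ball 0 1)) borel (\<lambda>y. y /\<^sub>R norm y)"

definition sph_avg :: "real \<Rightarrow> ('a::euclidean_space \<Rightarrow> real) \<Rightarrow> 'a \<Rightarrow> real" where
  "sph_avg t f x = (\<integral>y. f (x - t *\<^sub>R y) \<partial>sphere_measure)"

definition max_sph :: "real set \<Rightarrow> ('a::euclidean_space \<Rightarrow> real) \<Rightarrow> 'a \<Rightarrow> ennreal" where
  "max_sph E f x = (SUP t\<in>E. ennreal \<bar>sph_avg t f x\<bar>)"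

definition enn_rpow :: "ennreal \<Rightarrow> real \<Rightarrow> ennreal" where
  "enn_rpow v r = (if v = \<infinity> then \<infinity> else ennreal (enn2real v powr r))"

text \<open>L^p norm on R^d (Lebesgue measure), parametrised by a = 1/p in [0,1];
  a = 0 means p = infinity (essential supremum).\<close>
definition lp_norm :: "real \<Rightarrow> ('a::euclidean_space \<Rightarrow> ennreal) \<Rightarrow> ennreal" where
  "lp_norm a g = (if a = 0 then Inf {c. AE x in lebesgue. g x \<le> c}
                  else enn_rpow (\<integral>\<^sup>+ x. enn_rpow (g x) (1 / a) \<partial>lebesgue) a)"

definition radial :: "('a::real_normed_vector \<Rightarrow> real) \<Rightarrow> bool" where
  "radial f \<longleftrightarrow> (\<forall>x y. norm x = norm y \<longrightarrow> f x = f y)"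

definition rad_bounded :: "'a::euclidean_space itself \<Rightarrow> real set \<Rightarrow> real \<Rightarrow> real \<Rightarrow> bool" where
  "rad_bounded _ E a b \<longleftrightarrow> (\<exists>C::real. C \<ge> 0 \<and>
     (\<forall>f::'a \<Rightarrow> real. f \<in> borel_measurable borel \<longrightarrow> radial f \<longrightarrow>
        lp_norm a (\<lambda>x. ennreal \<bar>f x\<bar>) < \<infinity> \<longrightarrow>
        lp_norm b (max_sph E f) \<le> ennreal C * lp_norm a (\<lambda>x. ennreal \<bar>f x\<bar>)))"

definition rad_type_set :: "'a::euclidean_space itself \<Rightarrow> real set \<Rightarrow> (real \<times> real) set" where
  "rad_type_set T E = {(a, b). 0 \<le> a \<and> a \<le> 1 \<and> 0 \<le> b \<and> b \<le> 1 \<and> rad_bounded T E a b}"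

definition Q1 :: "nat \<Rightarrow> real \<Rightarrow> real \<times> real" where
  "Q1 d \<beta> = ((real d - 1) / (real d - 1 + \<beta>), (real d - 1) / (real d - 1 + \<beta>))"

definition Q2 :: "nat \<Rightarrow> real \<Rightarrow> real \<times> real" where
  "Q2 d \<beta> = (real d * (real d - 1) / ((real d)\<^sup>2 - 1 + \<beta>), (real d - 1) / ((real d)\<^sup>2 - 1 + \<beta>))"

definition Delta :: "nat \<Rightarrow> real \<Rightarrow> (real \<times> real) set" where
  "Delta d \<beta> = convex hull {(0, 0), Q1 d \<beta>, Q2 d \<beta>}"

end

theory Submission
  imports Defs
begin

text \<open>The points \<open>Q1\<close> and \<open>Q2\<close> both have first coordinate \<open>(d - 1) / d\<close>, so the region is cut out by
  \<open>0 \<le> a < (d - 1) / d\<close> and \<open>a / d \<le> b \<le> a\<close>, where \<open>a = 1 / p\<close> and \<open>b = 1 / q\<close>.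

  Under the sphere measure the inner product \<open>u\<close> with a unit vector is distributed like \<open>v / sqrt (1 + v\<^sup>2)\<close> with
  \<open>v\<close> of density proportional to \<open>(1 + v\<^sup>2) powr (- d / 2)\<close>.  Substituting the distance
  \<open>s = sqrt (r\<^sup>2 + t\<^sup>2 + 2 r t u)\<close> for \<open>v\<close> and using Hoelder's inequality bounds the p-th power of an
  average over the sphere of radius \<open>t\<close> about a point of norm \<open>r\<close> by the integral of
  \<open>\<bar>f\<bar> powr p\<close> over the radii \<open>s\<close> between \<open>\<bar>r - t\<bar>\<close> and \<open>r + t\<close>, divided by \<open>r t (max r t) ^ (d - 2)\<close>; the
  Hoelder factor is finite precisely for \<open>p > d / (d - 1)\<close>.  With \<open>t\<close> in \<open>[1, 2]\<close> this settles \<open>r \<ge> 1 / 2\<close>.  For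
  small \<open>r\<close> it also gives \<open>M f \<le> C r powr (- 1 / p) \<parallel>f\<parallel>\<close>, which reduces every \<open>q\<close> between \<open>p\<close> and \<open>d p\<close> to a
  one-dimensional maximal inequality on \<open>L^p\<close>, proved by a layer-cake argument.

  The conditions are necessary: large balls force \<open>b \<le> a\<close>, thin shells about the unit sphere force \<open>a / d \<le> b\<close>, and
  dyadic truncations of \<open>norm x powr (1 - d)\<close> force \<open>a < (d - 1) / d\<close>.\<close>

section \<open>Rotation invariance of the sphere measure\<close>

text \<open>Two boundary lines of the region are delicate. At \<open>q = d p\<close> the pointwise
  bound by \<open>r powr (- 1 / p)\<close> no longer suffices: its q-th power against the volume
  weight \<open>r ^ (d - 1)\<close> diverges logarithmically at 0. The remedy is a majorant of the
  p-th power that is integrable against \<open>max 1 r ^ (d - 1)\<close>, hence near 0 without help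
  from the volume weight; the spare \<open>r ^ (d - 1)\<close> then pays for every \<open>q\<close>
  up to \<open>d p\<close>. In the maximal inequality behind it the radius \<open>r\<close> is the
  variable and the centre \<open>t\<close> is optimised, the reverse of the Hardy-Littlewood
  situation, so that it resembles Hardy's inequality for a decreasing rearrangement. At
  \<open>p = d / (d - 1)\<close> the failure is again logarithmic, and the counterexample has to
  collect equal contributions from many dyadic scales.

  The variable \<open>v\<close> is the cotangent of the polar angle. The density of \<open>u\<close>
  itself is a multiple of \<open>(1 - u\<^sup>2) powr ((d - 3) / 2)\<close>, singular at the ends
  when \<open>d = 2\<close>; that of \<open>v\<close> is smooth on the whole line in every
  dimension.\<close>

lemma unit_ball_vol_neq_0 [simp]: "0 \<le> n \<Longrightarrow> unit_ball_vol n \<noteq> 0"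
  by (metis less_irrefl unit_ball_vol_pos)

text \<open>Both signs of \<open>c\<close> are wanted: the Haar argument below substitutes in
  \<open>T x + y\<close> and in \<open>y - T x\<close>.\<close>

lemma nn_integral_lborel_shift:
  fixes f :: "'a::euclidean_space \<Rightarrow> ennreal"
  assumes [measurable]: "f \<in> borel_measurable borel" and c: "\<bar>c\<bar> = 1"
  shows "(\<integral>\<^sup>+x. f (t + c *\<^sub>R x) \<partial>lborel) = (\<integral>\<^sup>+x. f x \<partial>lborel)"
proof -
  have "c \<noteq> 0" using c by auto
  then have "(\<integral>\<^sup>+x. f x \<partial>lborel) = (\<integral>\<^sup>+x. f x \<partial>density (distr lborel borel (\<lambda>x. t + c *\<^sub>R x)) (\<lambda>_. \<bar>c\<bar>^DIM('a)))"
    using lborel_affine[of c t] by simp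
  also have "\<dots> = (\<integral>\<^sup>+x. f (t + c *\<^sub>R x) \<partial>lborel)"
    by (simp add: c density_1 nn_integral_distr)
  finally show ?thesis by simp
qed

text \<open>Uniqueness of Haar measure: evaluate \<open>\<integral>\<integral> 1_A (T x + y) 1_B y dx dy\<close> in both orders, with
  \<open>B\<close> the unit ball.\<close>
lemma distr_lborel_linear_isometry:
  fixes T :: "'a::euclidean_space \<Rightarrow> 'a"
  assumes "linear T" and nT: "\<And>x. norm (T x) = norm x"
  shows "distr lborel borel T = lborel"
proof (rule measure_eqI)
  interpret linear T by fact
  have [measurable]: "T \<in> borel_measurable borel"
    using \<open>linear T\<close> by (simp add: borel_measurable_continuous_onI linear_continuous_on linear_linear)
  have "inj T"
    by (metis injI nT norm_eq_zero diff right_minus_eq)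
  then have "surj T"
    using \<open>linear T\<close> linear_injective_imp_surjective by blast
  fix A assume "A \<in> sets (distr lborel borel T)"
  then have [measurable]: "A \<in> sets borel" by simp
  define B :: "'a set" where "B = ball 0 1"
  have [measurable]: "B \<in> sets borel" by (simp add: B_def)
  have B: "indicator B (T x) = (indicator B x :: ennreal)" for x
    by (simp add: B_def indicator_def nT)
  have shift: "(\<integral>\<^sup>+x. f (T x + y) \<partial>lborel) = (\<integral>\<^sup>+x. f (T x) \<partial>lborel)"
    "(\<integral>\<^sup>+x. f (y - T x) \<partial>lborel) = (\<integral>\<^sup>+x. f (T x) \<partial>lborel)"
    if [measurable]: "f \<in> borel_measurable borel" for f :: "'a \<Rightarrow> ennreal" and y
  proof -
    obtain z where z: "y = T z" using \<open>surj T\<close> by blast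
    show "(\<integral>\<^sup>+x. f (T x + y) \<partial>lborel) = (\<integral>\<^sup>+x. f (T x) \<partial>lborel)"
      using nn_integral_lborel_shift[of "\<lambda>x. f (T x)" 1 z] by (simp add: z add ac_simps)
    show "(\<integral>\<^sup>+x. f (y - T x) \<partial>lborel) = (\<integral>\<^sup>+x. f (T x) \<partial>lborel)"
      using nn_integral_lborel_shift[of "\<lambda>x. f (T x)" "-1" z] by (simp add: z diff)
  qed
  have A: "(\<integral>\<^sup>+x. indicator A (T x) \<partial>lborel) = emeasure (distr lborel borel T) A"
  proof -
    have "(\<integral>\<^sup>+x. indicator A (T x) \<partial>lborel) = (\<integral>\<^sup>+x. indicator A x \<partial>distr lborel borel T)"
      by (subst nn_integral_distr) auto
    then show ?thesis by (simp add: nn_integral_indicator)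
  qed
  have eB: "(\<integral>\<^sup>+x. indicator B (T x) \<partial>lborel) = emeasure lborel B"
    by (simp add: B)
  have "emeasure (distr lborel borel T) A * emeasure lborel B
      = (\<integral>\<^sup>+y. indicator B y * (\<integral>\<^sup>+x. indicator A (T x + y) \<partial>lborel) \<partial>lborel)"
    by (simp add: shift A nn_integral_multc mult.commute)
  also have "\<dots> = (\<integral>\<^sup>+y. \<integral>\<^sup>+x. indicator B y * indicator A (T x + y) \<partial>lborel \<partial>lborel)"
    by (simp add: nn_integral_cmult)
  also have "\<dots> = (\<integral>\<^sup>+x. \<integral>\<^sup>+y. indicator B y * indicator A (T x + y) \<partial>lborel \<partial>lborel)"
    by (rule lborel_pair.Fubini') simp
  also have "\<dots> = (\<integral>\<^sup>+x. \<integral>\<^sup>+y. indicator B (y - T x) * indicator A y \<partial>lborel \<partial>lborel)"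
    using nn_integral_lborel_shift[of "\<lambda>y. indicator B (y - T x) * indicator A y" 1 "T x" for x]
    by simp
  also have "\<dots> = (\<integral>\<^sup>+y. \<integral>\<^sup>+x. indicator B (y - T x) * indicator A y \<partial>lborel \<partial>lborel)"
    by (rule lborel_pair.Fubini') simp
  also have "\<dots> = (\<integral>\<^sup>+y. (\<integral>\<^sup>+x. indicator B (y - T x) \<partial>lborel) * indicator A y \<partial>lborel)"
    by (simp add: nn_integral_multc)
  also have "\<dots> = emeasure lborel B * emeasure lborel A"
    by (simp add: shift eB nn_integral_cmult)
  finally have *: "emeasure lborel B * emeasure (distr lborel borel T) A = emeasure lborel B * emeasure lborel A"
    by (simp add: mult.commute)
  have "emeasure lborel B \<noteq> 0" "emeasure lborel B \<noteq> top"
    using emeasure_lborel_ball_finite[of "0::'a" 1] by (auto simp: B_def emeasure_ball)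
  with * show "emeasure (distr lborel borel T) A = emeasure lborel A"
    by (simp add: ennreal_mult_cancel_left)
qed simp

text \<open>The Householder reflection along \<open>e - b\<close> is self-adjoint and swaps
  \<open>e\<close> and \<open>b\<close>, so
  \<open>T x \<bullet> b = x \<bullet> T b = x \<bullet> e\<close>. For \<open>e = b\<close> there
  is no mirror and the identity is taken.\<close>

lemma unit_vectors_reflection:
  fixes e b :: "'a::euclidean_space"
  assumes "norm e = 1" "norm b = 1"
  obtains T where "linear T" "\<And>x. norm (T x) = norm x" "\<And>x. T x \<bullet> b = x \<bullet> e"
proof (cases "e = b")
  case True
  then show ?thesis using that[of "\<lambda>x. x"] by (simp add: linear_ident)
next
  case False
  define n where "n = e - b"
  have nn: "n \<bullet> n \<noteq> 0" using False by (simp add: n_def)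
  have nn2: "n \<bullet> n = 2 - 2 * (e \<bullet> b)"
    using assms by (simp add: n_def inner_diff_left inner_diff_right norm_eq_1 inner_commute)
  define T where "T x = x - (2 * (x \<bullet> n) / (n \<bullet> n)) *\<^sub>R n" for x
  have "linear T"
  proof (rule linearI)
    fix x y
    have "2 * ((x + y) \<bullet> n) / (n \<bullet> n) = 2 * (x \<bullet> n) / (n \<bullet> n) + 2 * (y \<bullet> n) / (n \<bullet> n)"
      by (simp add: inner_add_left add_divide_distrib)
    then show "T (x + y) = T x + T y"
      by (simp add: T_def scaleR_add_left)
  next
    fix c x
    have "2 * ((c *\<^sub>R x) \<bullet> n) / (n \<bullet> n) = c * (2 * (x \<bullet> n) / (n \<bullet> n))"
      by simp
    then show "T (c *\<^sub>R x) = c *\<^sub>R T x"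
      by (simp only: T_def scaleR_diff_right scaleR_scaleR)
  qed
  moreover have "norm (T x) = norm x" for x
  proof -
    define k where "k = 2 * (x \<bullet> n) / (n \<bullet> n)"
    have k: "k * (n \<bullet> n) = 2 * (x \<bullet> n)" using nn by (simp add: k_def)
    have "T x \<bullet> T x = x \<bullet> x - 2 * k * (x \<bullet> n) + k * (k * (n \<bullet> n))"
      unfolding T_def k_def[symmetric]
      by (simp add: inner_diff_left inner_diff_right inner_commute[of n x] right_diff_distrib)
    also have "\<dots> = x \<bullet> x" by (simp add: k)
    finally show ?thesis by (simp add: norm_eq_sqrt_inner)
  qed
  moreover have "T x \<bullet> b = x \<bullet> e" for x
  proof -
    define k where "k = 2 * (x \<bullet> n) / (n \<bullet> n)"
    have k: "k * (n \<bullet> n) = 2 * (x \<bullet> n)" using nn by (simp add: k_def)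
    have "b \<bullet> b = 1" using assms by (simp add: norm_eq_1)
    then have "n \<bullet> b = e \<bullet> b - 1" by (simp add: n_def inner_diff_left)
    then have "n \<bullet> b = - (n \<bullet> n) / 2" using nn2 by linarith
    then have "k * (n \<bullet> b) = - (x \<bullet> n)" using k by simp
    then have "T x \<bullet> b = x \<bullet> b + x \<bullet> n"
      unfolding T_def k_def[symmetric] by (simp add: inner_diff_left)
    then show ?thesis by (simp add: n_def inner_diff_right)
  qed
  ultimately show ?thesis using that by blast
qed

lemma sets_sphere_measure [simp, measurable_cong]: "sets sphere_measure = sets borel"
  and space_sphere_measure [simp]: "space sphere_measure = UNIV"
  by (simp_all add: sphere_measure_def)

lemma nn_integral_sphere_measure:
  fixes g :: "'a::euclidean_space \<Rightarrow> ennreal"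
  assumes [measurable]: "g \<in> borel_measurable borel"
  shows "(\<integral>\<^sup>+y. g y \<partial>sphere_measure)
    = (\<integral>\<^sup>+z. g (z /\<^sub>R norm z) * indicator (ball 0 1) z \<partial>lborel) / ennreal (unit_ball_vol DIM('a))"
  by (simp add: sphere_measure_def nn_integral_distr nn_integral_uniform_measure emeasure_ball)

lemma emeasure_sphere_measure_UNIV [simp]:
  "emeasure (sphere_measure :: 'a::euclidean_space measure) UNIV = 1"
proof -
  have "emeasure (sphere_measure :: 'a measure) UNIV = emeasure (uniform_measure lborel (ball (0::'a) 1)) UNIV"
    by (simp add: sphere_measure_def emeasure_distr)
  also have "\<dots> = 1"
    by (simp add: emeasure_ball divide_ennreal)
  finally show ?thesis .
qed

lemma finite_measure_sphere_measure: "finite_measure (sphere_measure :: 'a::euclidean_space measure)"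
  by (rule finite_measureI) simp

text \<open>The one exceptional point is the centre of the ball, which radial projection sends to 0
  because \<open>inverse 0 = 0\<close>.\<close>

lemma AE_sphere_measure: "AE y in (sphere_measure :: 'a::euclidean_space measure). norm y = 1"
proof -
  have "AE y::'a in lborel. y \<noteq> 0" by (rule AE_lborel_singleton)
  then have "AE y::'a in lborel. norm (y /\<^sub>R norm y) = 1"
    by eventually_elim simp
  then have "AE y in uniform_measure lborel (ball (0::'a) 1). norm (y /\<^sub>R norm y) = 1"
    by (intro AE_uniform_measureI) auto
  then show ?thesis
    unfolding sphere_measure_def by (subst AE_distr_iff) auto
qed

text \<open>The reflection \<open>T\<close> preserves Lebesgue measure and the unit ball and
  commutes with the normalization \<open>z /\<^sub>R norm z\<close>. Invariance is used only for
  functions of one inner product, to replace the direction of a point \<open>x\<close> by a basis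
  vector.\<close>

lemma nn_integral_sphere_inner_rotate:
  fixes e b :: "'a::euclidean_space"
  assumes "norm e = 1" "norm b = 1" and [measurable]: "g \<in> borel_measurable borel"
  shows "(\<integral>\<^sup>+y. g (y \<bullet> e) \<partial>sphere_measure) = (\<integral>\<^sup>+y. g (y \<bullet> b) \<partial>(sphere_measure::'a measure))"
proof -
  obtain T where T: "linear T" "\<And>x. norm (T x) = norm x" "\<And>x::'a. T x \<bullet> b = x \<bullet> e"
    using unit_vectors_reflection[OF assms(1,2)] by blast
  have [measurable]: "T \<in> borel_measurable borel"
    using \<open>linear T\<close> by (simp add: borel_measurable_continuous_onI linear_continuous_on linear_linear)
  define h where "h z = g ((z /\<^sub>R norm z) \<bullet> b) * indicator (ball 0 1) z" for z :: 'a
  have [measurable]: "ball (0::'a) 1 \<in> sets borel" by simp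
  have [measurable]: "h \<in> borel_measurable borel" unfolding h_def by measurable
  have "(\<integral>\<^sup>+z. h z \<partial>lborel) = (\<integral>\<^sup>+z. h z \<partial>distr lborel borel T)"
    by (simp add: distr_lborel_linear_isometry T)
  also have "\<dots> = (\<integral>\<^sup>+z. h (T z) \<partial>lborel)" by (simp add: nn_integral_distr)
  also have "\<dots> = (\<integral>\<^sup>+z. g ((z /\<^sub>R norm z) \<bullet> e) * indicator (ball 0 1) z \<partial>lborel)"
    by (simp add: h_def T indicator_def)
  finally show ?thesis
    by (simp add: nn_integral_sphere_measure h_def)
qed

section \<open>The distribution of a coordinate on the sphere\<close>

lemma nn_integral_power_cutoff:
  assumes "0 \<le> a"
  shows "(\<integral>\<^sup>+ r. ennreal (r ^ n) * indicator {0<..} r * indicator {..a} r \<partial>lborel) = ennreal (a ^ Suc n / real (Suc n))"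
proof -
  have "(\<integral>\<^sup>+ r. ennreal (r ^ n) * indicator {0<..} r * indicator {..a} r \<partial>lborel)
      = (\<integral>\<^sup>+ r. ennreal (r ^ n) * indicator {0..a} r \<partial>lborel)"
    by (intro nn_integral_cong_AE, rule AE_mp[OF AE_lborel_singleton[of 0]])
       (auto simp: indicator_def)
  also have "\<dots> = ennreal (a ^ Suc n / real (Suc n) - 0 ^ Suc n / real (Suc n))"
  proof (rule nn_integral_FTC_Icc)
    fix x :: real
    show "DERIV (\<lambda>x. x ^ Suc n / real (Suc n)) x :> x ^ n"
      using DERIV_cdivide[OF DERIV_pow[of "Suc n" x], of "real (Suc n)"] by (simp del: of_nat_Suc power_Suc)
  qed (use assms in auto)
  finally show ?thesis by simp
qed

text \<open>Polar coordinates from ball volumes alone: the law of \<open>X\<close> and the density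
  \<open>k * real (Suc n) * r ^ n\<close> on the positive axis agree on all half lines
  \<open>{..a}\<close>, which form an intersection-stable generator exhausted by sets of finite
  measure. It is applied to \<open>norm\<close> on the whole space and to the length of
  \<open>d - 1\<close> of the coordinates.\<close>

lemma nn_integral_radial_law:
  fixes X :: "'b \<Rightarrow> real"
  assumes [measurable]: "X \<in> borel_measurable M"
    and "\<And>x. x \<in> space M \<Longrightarrow> 0 \<le> X x"
    and "0 \<le> k" and em: "\<And>r. 0 < r \<Longrightarrow> emeasure M {x \<in> space M. X x \<le> r} = ennreal (k * r ^ Suc n)"
    and [measurable]: "H \<in> borel_measurable borel"
  shows "(\<integral>\<^sup>+x. H (X x) \<partial>M)
    = ennreal (k * real (Suc n)) * (\<integral>\<^sup>+r. H r * (ennreal (r ^ n) * indicator {0<..} r) \<partial>lborel)"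
proof -
  let ?D = "density lborel (\<lambda>r. ennreal (k * real (Suc n)) * (ennreal (r ^ n) * indicator {0<..} r))"
  \<comment> \<open>The volume hypothesis covers only \<open>r > 0\<close>; letting \<open>r\<close>
    tend to 0 excludes an atom at 0.\<close>
  have le0: "emeasure M {x \<in> space M. X x \<le> a} = 0" if "a \<le> 0" for a
  proof -
    have "emeasure M {x \<in> space M. X x \<le> a} \<le> ennreal (k * r ^ Suc n)" if "0 < r" for r
    proof -
      have "emeasure M {x \<in> space M. X x \<le> a} \<le> emeasure M {x \<in> space M. X x \<le> r}"
        using \<open>a \<le> 0\<close> that by (intro emeasure_mono) auto
      then show ?thesis unfolding em[OF that] .
    qed
    then have "\<forall>\<^sub>F r in at_right 0. emeasure M {x \<in> space M. X x \<le> a} \<le> ennreal (k * r ^ Suc n)"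
      by (auto simp: eventually_at_right_field intro: exI[of _ 1])
    moreover have "((\<lambda>r. ennreal (k * r ^ Suc n)) \<longlongrightarrow> ennreal (k * 0 ^ Suc n)) (at_right 0)"
      by (intro tendsto_intros)
    ultimately have "emeasure M {x \<in> space M. X x \<le> a} \<le> ennreal (k * 0 ^ Suc n)"
      by (intro tendsto_lowerbound) auto
    then show ?thesis by simp
  qed
  have eqD: "emeasure (distr M borel X) {..a} = emeasure ?D {..a}" for a
  proof -
    have 1: "emeasure (distr M borel X) {..a} = emeasure M {x \<in> space M. X x \<le> a}"
      by (subst emeasure_distr) (auto intro!: arg_cong[where f="emeasure M"])
    have 2: "emeasure ?D {..a} = ennreal (k * real (Suc n)) * (\<integral>\<^sup>+ r. ennreal (r ^ n) * indicator {0<..} r * indicator {..a} r \<partial>lborel)"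
      by (subst emeasure_density) (auto simp: nn_integral_cmult[symmetric] mult.assoc)
    show ?thesis
    proof (cases "a \<le> 0")
      case True
      then have "(\<integral>\<^sup>+ r. ennreal (r ^ n) * indicator {0<..} r * indicator {..a} r \<partial>lborel) = (\<integral>\<^sup>+ r. 0 \<partial>(lborel::real measure))"
        by (intro nn_integral_cong) (auto simp: indicator_def)
      then show ?thesis using 1 2 le0[OF True] by simp
    next
      case False
      then have "emeasure ?D {..a} = ennreal (k * real (Suc n)) * ennreal (a ^ Suc n / real (Suc n))"
        by (subst 2, subst nn_integral_power_cutoff) auto
      also have "\<dots> = ennreal (k * a ^ Suc n)"
        using False \<open>0 \<le> k\<close> by (subst ennreal_mult[symmetric]) (auto simp del: of_nat_Suc)
      finally show ?thesis using 1 em[of a] False by simp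
    qed
  qed
  have "distr M borel X = ?D"
  proof (rule measure_eqI_generator_eq[where E="range atMost" and \<Omega>=UNIV and A="\<lambda>i. {..real i}"])
    show "Int_stable (range (atMost :: real \<Rightarrow> real set))"
      by (auto simp: Int_stable_def)
    show "sets (distr M borel X) = sigma_sets UNIV (range atMost)"
      "sets ?D = sigma_sets UNIV (range atMost)"
      by (simp_all add: borel_eq_atMost)
    show "(\<Union>i. {..real i}) = UNIV"
      by (auto intro: real_arch_simple)
    fix i
    have "emeasure M {x \<in> space M. X x \<le> real i} \<le> emeasure M {x \<in> space M. X x \<le> real i + 1}"
      by (intro emeasure_mono) auto
    also have "\<dots> < \<infinity>"
      by (subst em) auto
    finally show "emeasure (distr M borel X) {..real i} \<noteq> \<infinity>"
      by (subst emeasure_distr) (auto simp: vimage_def Int_def conj_commute)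
  qed (use eqD in auto)
  moreover have "(\<integral>\<^sup>+x. H (X x) \<partial>M) = (\<integral>\<^sup>+r. H r \<partial>distr M borel X)"
    by (simp add: nn_integral_distr)
  ultimately have "(\<integral>\<^sup>+x. H (X x) \<partial>M) = (\<integral>\<^sup>+r. H r \<partial>?D)"
    by simp
  also have "\<dots> = (\<integral>\<^sup>+r. ennreal (k * real (Suc n)) * (H r * (ennreal (r ^ n) * indicator {0<..} r)) \<partial>lborel)"
    by (subst nn_integral_density) (auto simp: mult_ac intro!: nn_integral_cong)
  finally show ?thesis
    by (simp add: nn_integral_cmult)
qed

lemma nn_integral_lborel_norm:
  fixes H :: "real \<Rightarrow> ennreal"
  assumes [measurable]: "H \<in> borel_measurable borel"
  shows "(\<integral>\<^sup>+x. H (norm x) \<partial>(lborel :: 'a::euclidean_space measure))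
    = ennreal (unit_ball_vol DIM('a) * DIM('a)) *
      (\<integral>\<^sup>+r. H r * (ennreal (r ^ (DIM('a) - 1)) * indicator {0<..} r) \<partial>lborel)"
proof -
  have *: "Suc (DIM('a) - 1) = DIM('a)" by simp
  have **: "{x \<in> space lborel. norm x \<le> r} = cball (0::'a) r" for r by (auto simp: cball_def)
  have "(\<integral>\<^sup>+x. H (norm x) \<partial>(lborel :: 'a::euclidean_space measure))
    = ennreal (unit_ball_vol DIM('a) * real (Suc (DIM('a) - 1))) *
      (\<integral>\<^sup>+r. H r * (ennreal (r ^ (DIM('a) - 1)) * indicator {0<..} r) \<partial>lborel)"
    by (rule nn_integral_radial_law) (simp_all add: emeasure_cball **  del: space_lborel space_borel)
  then show ?thesis unfolding * .
qed

text \<open>Cylindrical coordinates: \<open>y\<close> is the coordinate along \<open>b\<close> and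
  \<open>r\<close> the length of the remaining \<open>d - 1\<close> coordinates, which accounts for
  the exponent \<open>d - 2\<close>. The joint law of \<open>z \<bullet> b\<close> and
  \<open>norm z\<close> is what matters because the sphere measure is projected from the solid
  ball.\<close>

lemma nn_integral_lborel_coordinate_norm:
  fixes b :: "'a::euclidean_space" and G :: "real \<times> real \<Rightarrow> ennreal"
  assumes "DIM('a) \<ge> 2" "b \<in> Basis" and [measurable]: "G \<in> borel_measurable (borel \<Otimes>\<^sub>M borel)"
  shows "(\<integral>\<^sup>+z. G (z \<bullet> b, norm z) \<partial>lborel)
    = ennreal (unit_ball_vol (real (DIM('a) - 1)) * real (DIM('a) - 1)) * (\<integral>\<^sup>+r. (\<integral>\<^sup>+y. G (y, sqrt (y\<^sup>2 + r\<^sup>2)) \<partial>lborel) * (ennreal (r ^ (DIM('a) - 2)) * indicator {0<..} r) \<partial>lborel)"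
proof -
  interpret product_sigma_finite "\<lambda>_. lborel :: real measure" by standard
  define I where "I = (Basis :: 'a set) - {b}"
  have I: "finite I" "b \<notin> I" "insert b I = Basis" "card I = DIM('a) - 1"
    using assms by (auto simp: I_def)
  have sc: "Suc (DIM('a) - 2) = card I" using assms I by simp
  let ?P = "Pi\<^sub>M I (\<lambda>_. lborel :: real measure)"
  let ?z = "\<lambda>f. (\<Sum>c\<in>Basis. f c *\<^sub>R c) :: 'a"
  have zb: "?z f \<bullet> b = f b" for f using assms by simp
  have zn: "norm (?z f) = sqrt (\<Sum>c\<in>Basis. (f c)\<^sup>2)" for f
    using euclidean_dist_l2[of "?z f" 0] by (simp add: L2_set_def)
  have "(\<integral>\<^sup>+z. G (z \<bullet> b, norm z) \<partial>lborel) = (\<integral>\<^sup>+f. G (?z f \<bullet> b, norm (?z f)) \<partial>Pi\<^sub>M Basis (\<lambda>_. lborel))"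
    by (subst lborel_eq, subst nn_integral_distr) auto
  also have "\<dots> = (\<integral>\<^sup>+f. G (f b, sqrt (\<Sum>c\<in>insert b I. (f c)\<^sup>2)) \<partial>Pi\<^sub>M (insert b I) (\<lambda>_. lborel))"
    by (simp only: zb zn I)
  also have "\<dots> = (\<integral>\<^sup>+w. \<integral>\<^sup>+y. G ((w(b := y)) b, sqrt (\<Sum>c\<in>insert b I. ((w(b := y)) c)\<^sup>2)) \<partial>lborel \<partial>?P)"
  proof (rule product_nn_integral_insert)
    have [measurable]: "(\<lambda>f. f c) \<in> borel_measurable (Pi\<^sub>M (insert b I) (\<lambda>_. lborel :: real measure))"
      if "c \<in> insert b I" for c
      using measurable_component_singleton[OF that, of "\<lambda>_. lborel :: real measure"] by simp
    have [measurable]: "(\<lambda>f. \<Sum>c\<in>insert b I. (f c)\<^sup>2) \<in> borel_measurable (Pi\<^sub>M (insert b I) (\<lambda>_. lborel :: real measure))"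
      by (intro borel_measurable_sum) measurable
    have [measurable]: "b \<in> insert b I" by simp
    show "(\<lambda>f. G (f b, sqrt (\<Sum>c\<in>insert b I. (f c)\<^sup>2))) \<in> borel_measurable (Pi\<^sub>M (insert b I) (\<lambda>_. lborel))"
      by measurable
  qed (use I in auto)
  also have "\<dots> = (\<integral>\<^sup>+w. \<integral>\<^sup>+y. G (y, sqrt (y\<^sup>2 + (sqrt (\<Sum>c\<in>I. (w c)\<^sup>2))\<^sup>2)) \<partial>lborel \<partial>?P)"
  proof -
    have "(\<Sum>c\<in>I. (if c = b then y else w c)\<^sup>2) = (\<Sum>c\<in>I. (w c)\<^sup>2)" for y :: real and w
      using I by (intro sum.cong) auto
    then show ?thesis by (simp add: sum.insert[OF I(1,2)] sum_nonneg)
  qed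
  also have "\<dots> = ennreal (unit_ball_vol (card I) * real (Suc (DIM('a) - 2))) *
     (\<integral>\<^sup>+r. (\<integral>\<^sup>+y. G (y, sqrt (y\<^sup>2 + r\<^sup>2)) \<partial>lborel) * (ennreal (r ^ (DIM('a) - 2)) * indicator {0<..} r) \<partial>lborel)"
  proof (rule nn_integral_radial_law)
    fix r :: real assume "0 < r"
    show "emeasure ?P {w \<in> space ?P. sqrt (\<Sum>c\<in>I. (w c)\<^sup>2) \<le> r} = ennreal (unit_ball_vol (card I) * r ^ Suc (DIM('a) - 2))"
      unfolding sc using emeasure_cball_aux[OF I(1) \<open>0 < r\<close>] by (simp add: Int_def conj_commute)
  qed (auto intro: sum_nonneg)
  finally show ?thesis
    unfolding sc I(4) .
qed

text \<open>The area of the (d-2)-sphere divided by that of the (d-1)-sphere, which is the constant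
  that normalizes the density \<open>(1 + v\<^sup>2) powr (- d / 2)\<close>.\<close>

definition sphere_inner_const :: "nat \<Rightarrow> real" where
  "sphere_inner_const d = unit_ball_vol (real (d - 1)) * real (d - 1) * (1 / real d) * inverse (unit_ball_vol d)"

lemma sphere_inner_const_pos: "d \<ge> 2 \<Longrightarrow> 0 < sphere_inner_const d"
  by (simp add: sphere_inner_const_def)

text \<open>In cylindrical coordinates put \<open>y = r * v\<close>. Then
  \<open>z \<bullet> b / norm z\<close> becomes \<open>v / sqrt (1 + v\<^sup>2)\<close>, free of
  \<open>r\<close>, and the unit ball becomes \<open>r < 1 / sqrt (1 + v\<^sup>2)\<close>. The
  Jacobian raises \<open>r ^ (d - 2)\<close> to \<open>r ^ (d - 1)\<close>, whose integral over that
  range is \<open>(1 + v\<^sup>2) powr (- d / 2) / d\<close>.\<close>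

lemma nn_integral_sphere_inner_Basis:
  fixes b :: "'a::euclidean_space" and g :: "real \<Rightarrow> ennreal"
  assumes d: "DIM('a) \<ge> 2" and "b \<in> Basis" and [measurable]: "g \<in> borel_measurable borel"
  shows "(\<integral>\<^sup>+y. g (y \<bullet> b) \<partial>sphere_measure)
    = ennreal (sphere_inner_const DIM('a)) * (\<integral>\<^sup>+v. g (v / sqrt (1 + v\<^sup>2)) * ennreal ((1 + v\<^sup>2) powr (- real DIM('a) / 2)) \<partial>lborel)"
proof -
  define n where "n = DIM('a) - 2"
  have dn: "DIM('a) = Suc (Suc n)" using d by (simp add: n_def)
  let ?V = "unit_ball_vol DIM('a)"
  have [measurable]: "ball (0::'a) 1 \<in> sets borel" by simp
  define G where "G = (\<lambda>(y, s). g (y / s) * indicator {..<1::real} s)"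
  have [measurable]: "G \<in> borel_measurable (borel \<Otimes>\<^sub>M borel)"
    unfolding G_def by measurable
  have "(\<integral>\<^sup>+y. g (y \<bullet> b) \<partial>sphere_measure) = (\<integral>\<^sup>+z. G (z \<bullet> b, norm z) \<partial>lborel) / ennreal ?V"
    by (subst nn_integral_sphere_measure)
       (auto simp: G_def indicator_def divide_inverse mult.commute)
  moreover define K where "K = unit_ball_vol (real (DIM('a) - 1)) * real (DIM('a) - 1)"
  have "K \<ge> 0" by (simp add: K_def)
  have K: "(\<integral>\<^sup>+z. G (z \<bullet> b, norm z) \<partial>lborel)
    = ennreal K * (\<integral>\<^sup>+r. (\<integral>\<^sup>+y. G (y, sqrt (y\<^sup>2 + r\<^sup>2)) \<partial>lborel) * (ennreal (r ^ n) * indicator {0<..} r) \<partial>lborel)"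
    using nn_integral_lborel_coordinate_norm[OF assms(1,2), of G] by (auto simp: n_def K_def)
  moreover note K
  moreover have "(\<integral>\<^sup>+r. (\<integral>\<^sup>+y. G (y, sqrt (y\<^sup>2 + r\<^sup>2)) \<partial>lborel) * (ennreal (r ^ n) * indicator {0<..} r) \<partial>lborel)
     = (\<integral>\<^sup>+r. \<integral>\<^sup>+v. g (v / sqrt (1 + v\<^sup>2)) * (ennreal (r ^ Suc n) * indicator {0<..} r * indicator {..<1 / sqrt (1 + v\<^sup>2)} r) \<partial>lborel \<partial>lborel)"
  proof (rule nn_integral_cong)
    fix r :: real
    show "(\<integral>\<^sup>+y. G (y, sqrt (y\<^sup>2 + r\<^sup>2)) \<partial>lborel) * (ennreal (r ^ n) * indicator {0<..} r)
       = (\<integral>\<^sup>+v. g (v / sqrt (1 + v\<^sup>2)) * (ennreal (r ^ Suc n) * indicator {0<..} r * indicator {..<1 / sqrt (1 + v\<^sup>2)} r) \<partial>lborel)"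
    proof (cases "r > 0")
      case True
      have s: "sqrt ((r * v)\<^sup>2 + r\<^sup>2) = r * sqrt (1 + v\<^sup>2)" for v
      proof -
        have "(r * v)\<^sup>2 + r\<^sup>2 = r\<^sup>2 * (1 + v\<^sup>2)" by (simp add: power_mult_distrib algebra_simps)
        then show ?thesis using True by (simp add: real_sqrt_mult)
      qed
      have [measurable]: "(\<lambda>v. indicator {..<1 / sqrt (1 + v\<^sup>2)} r :: ennreal) \<in> borel_measurable borel"
        by (simp add: indicator_def)
      have pos: "0 < sqrt (1 + v\<^sup>2)" for v :: real by (simp add: add_pos_nonneg)
      have "(\<integral>\<^sup>+y. G (y, sqrt (y\<^sup>2 + r\<^sup>2)) \<partial>lborel) = ennreal r * (\<integral>\<^sup>+v. G (r * v, sqrt ((r * v)\<^sup>2 + r\<^sup>2)) \<partial>lborel)"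
        using nn_integral_real_affine[of "\<lambda>y. G (y, sqrt (y\<^sup>2 + r\<^sup>2))" r 0] True by simp
      also have "\<dots> = ennreal r * (\<integral>\<^sup>+v. g (v / sqrt (1 + v\<^sup>2)) * indicator {..<1 / sqrt (1 + v\<^sup>2)} r \<partial>lborel)"
      proof (intro arg_cong[where f="\<lambda>x. ennreal r * x"] nn_integral_cong)
        fix v :: real
        have "r * v / (r * sqrt (1 + v\<^sup>2)) = v / sqrt (1 + v\<^sup>2)" using True by simp
        moreover have "r * sqrt (1 + v\<^sup>2) < 1 \<longleftrightarrow> r < 1 / sqrt (1 + v\<^sup>2)"
          using pos[of v] by (simp add: pos_less_divide_eq)
        ultimately show "G (r * v, sqrt ((r * v)\<^sup>2 + r\<^sup>2)) = g (v / sqrt (1 + v\<^sup>2)) * indicator {..<1 / sqrt (1 + v\<^sup>2)} r"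
          unfolding s by (simp add: G_def indicator_def)
      qed
      finally have "(\<integral>\<^sup>+y. G (y, sqrt (y\<^sup>2 + r\<^sup>2)) \<partial>lborel) * (ennreal (r ^ n) * indicator {0<..} r)
         = (ennreal (r ^ n) * indicator {0<..} r * ennreal r) * (\<integral>\<^sup>+v. g (v / sqrt (1 + v\<^sup>2)) * indicator {..<1 / sqrt (1 + v\<^sup>2)} r \<partial>lborel)"
        by (simp add: mult_ac)
      also have "\<dots> = (\<integral>\<^sup>+v. ennreal (r ^ n) * indicator {0<..} r * ennreal r * (g (v / sqrt (1 + v\<^sup>2)) * indicator {..<1 / sqrt (1 + v\<^sup>2)} r) \<partial>lborel)"
        by (subst nn_integral_cmult) auto
      also have "\<dots> = (\<integral>\<^sup>+v. g (v / sqrt (1 + v\<^sup>2)) * (ennreal (r ^ Suc n) * indicator {0<..} r * indicator {..<1 / sqrt (1 + v\<^sup>2)} r) \<partial>lborel)"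
        using True by (intro nn_integral_cong) (simp add: ennreal_mult mult_ac)
      finally show ?thesis .
    qed simp
  qed
  moreover have "\<dots> = (\<integral>\<^sup>+v. \<integral>\<^sup>+r. g (v / sqrt (1 + v\<^sup>2)) * (ennreal (r ^ Suc n) * indicator {0<..} r * indicator {..<1 / sqrt (1 + v\<^sup>2)} r) \<partial>lborel \<partial>lborel)"
  proof -
    have [measurable]: "(\<lambda>x. indicator {..<1 / sqrt (1 + (fst x)\<^sup>2)} (snd x) :: ennreal) \<in> borel_measurable (lborel \<Otimes>\<^sub>M lborel)"
      by (simp add: indicator_def)
    show ?thesis by (rule lborel_pair.Fubini') simp
  qed
  moreover have "\<dots> = (\<integral>\<^sup>+v. ennreal (1 / real (Suc (Suc n))) * (g (v / sqrt (1 + v\<^sup>2)) * ennreal ((1 + v\<^sup>2) powr (- real DIM('a) / 2))) \<partial>lborel)"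
  proof (rule nn_integral_cong)
    fix v :: real
    define a where "a = 1 / sqrt (1 + v\<^sup>2)"
    have p: "1 + v\<^sup>2 > 0" by (simp add: add_pos_nonneg)
    have apos: "0 < a" using p by (simp add: a_def)
    have aeq: "a = (1 + v\<^sup>2) powr (- (1 / 2))"
      unfolding a_def powr_minus_divide using p by (simp add: powr_half_sqrt)
    have "a ^ Suc (Suc n) = a powr (real (Suc (Suc n)))"
      by (rule powr_realpow[OF apos, symmetric])
    also have "\<dots> = ((1 + v\<^sup>2) powr (- (1 / 2))) powr (real (Suc (Suc n)))"
      by (simp only: aeq)
    also have "\<dots> = (1 + v\<^sup>2) powr (- real DIM('a) / 2)"
      unfolding powr_powr by (rule arg_cong[where f="\<lambda>x. (1 + v\<^sup>2) powr x"]) (simp add: dn field_simps)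
    finally have a: "a ^ Suc (Suc n) = (1 + v\<^sup>2) powr (- real DIM('a) / 2)" .
    have "(\<integral>\<^sup>+r. g (v / sqrt (1 + v\<^sup>2)) * (ennreal (r ^ Suc n) * indicator {0<..} r * indicator {..<a} r) \<partial>lborel)
       = g (v / sqrt (1 + v\<^sup>2)) * (\<integral>\<^sup>+r. ennreal (r ^ Suc n) * indicator {0<..} r * indicator {..<a} r \<partial>lborel)"
      by (subst nn_integral_cmult) auto
    also have "(\<integral>\<^sup>+r. ennreal (r ^ Suc n) * indicator {0<..} r * indicator {..<a} r \<partial>lborel)
      = (\<integral>\<^sup>+r. ennreal (r ^ Suc n) * indicator {0<..} r * indicator {..a} r \<partial>lborel)"
      by (intro nn_integral_cong_AE, rule AE_mp[OF AE_lborel_singleton[of a]])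
         (auto simp: indicator_def)
    also have "\<dots> = ennreal (a ^ Suc (Suc n) / real (Suc (Suc n)))"
      using p by (intro nn_integral_power_cutoff) (simp add: a_def)
    also have "\<dots> = ennreal (1 / real (Suc (Suc n))) * ennreal ((1 + v\<^sup>2) powr (- real DIM('a) / 2))"
      unfolding a by (subst ennreal_mult[symmetric]) auto
    finally show "(\<integral>\<^sup>+r. g (v / sqrt (1 + v\<^sup>2)) * (ennreal (r ^ Suc n) * indicator {0<..} r * indicator {..<1 / sqrt (1 + v\<^sup>2)} r) \<partial>lborel)
       = ennreal (1 / real (Suc (Suc n))) * (g (v / sqrt (1 + v\<^sup>2)) * ennreal ((1 + v\<^sup>2) powr (- real DIM('a) / 2)))"
      unfolding a_def by (simp add: mult_ac)
  qed
  moreover have "\<dots> = ennreal (1 / real (Suc (Suc n))) * (\<integral>\<^sup>+v. g (v / sqrt (1 + v\<^sup>2)) * ennreal ((1 + v\<^sup>2) powr (- real DIM('a) / 2)) \<partial>lborel)"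
    by (subst nn_integral_cmult) auto
  ultimately have "(\<integral>\<^sup>+y. g (y \<bullet> b) \<partial>sphere_measure)
    = ennreal K * (ennreal (1 / real (Suc (Suc n))) * (\<integral>\<^sup>+v. g (v / sqrt (1 + v\<^sup>2)) * ennreal ((1 + v\<^sup>2) powr (- real DIM('a) / 2)) \<partial>lborel)) / ennreal ?V"
    by simp
  also have "\<dots> = (ennreal K * ennreal (1 / real (Suc (Suc n))) * inverse (ennreal ?V)) * (\<integral>\<^sup>+v. g (v / sqrt (1 + v\<^sup>2)) * ennreal ((1 + v\<^sup>2) powr (- real DIM('a) / 2)) \<partial>lborel)"
    by (simp add: divide_ennreal_def mult_ac)
  also have "ennreal K * ennreal (1 / real (Suc (Suc n))) * inverse (ennreal ?V) = ennreal (K * (1 / real (Suc (Suc n))) * inverse ?V)"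
  proof -
    have "inverse (ennreal ?V) = ennreal (inverse ?V)" by (simp add: inverse_ennreal)
    then show ?thesis
      using \<open>K \<ge> 0\<close> by (simp only: ennreal_mult mult_nonneg_nonneg zero_le_divide_1_iff of_nat_0_le_iff
        inverse_nonnegative_iff_nonnegative unit_ball_vol_nonneg)
  qed
  also have "K * (1 / real (Suc (Suc n))) * inverse ?V = sphere_inner_const DIM('a)"
    unfolding sphere_inner_const_def K_def dn by simp
  finally show ?thesis .
qed

lemma nn_integral_sphere_inner:
  fixes e :: "'a::euclidean_space" and g :: "real \<Rightarrow> ennreal"
  assumes "DIM('a) \<ge> 2" "norm e = 1" "g \<in> borel_measurable borel"
  shows "(\<integral>\<^sup>+y. g (y \<bullet> e) \<partial>sphere_measure)
    = ennreal (sphere_inner_const DIM('a)) *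
      (\<integral>\<^sup>+v. g (v / sqrt (1 + v\<^sup>2)) * ennreal ((1 + v\<^sup>2) powr (- real DIM('a) / 2)) \<partial>lborel)"
proof -
  obtain b :: 'a where "b \<in> Basis" using nonempty_Basis by blast
  then show ?thesis
    using nn_integral_sphere_inner_rotate[of e b g] nn_integral_sphere_inner_Basis[of b g] assms
    by simp
qed

section \<open>Spherical averages of radial functions\<close>

text \<open>Change of variables on growing compact intervals, then monotone convergence. The image
  of \<open>s\<close> is not computed: any \<open>A\<close> containing every
  \<open>{s a..s b}\<close> gives an upper bound.\<close>

lemma nn_integral_substitution_real_line:
  fixes F :: "real \<Rightarrow> ennreal" and s s' :: "real \<Rightarrow> real"
  assumes [measurable]: "F \<in> borel_measurable borel" "A \<in> sets borel"
    and deriv: "\<And>v. (s has_real_derivative s' v) (at v)"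
    and cont: "continuous_on UNIV s'"
    and nonneg: "\<And>v. 0 \<le> s' v"
    and A: "\<And>a b. {s a..s b} \<subseteq> A"
  shows "(\<integral>\<^sup>+v. F (s v) * ennreal (s' v) \<partial>lborel) \<le> (\<integral>\<^sup>+x. F x * indicator A x \<partial>lborel)"
proof -
  have "continuous_on UNIV s"
    using deriv DERIV_isCont by (blast intro: continuous_at_imp_continuous_on)
  then have [measurable]: "s \<in> borel_measurable borel" by (rule borel_measurable_continuous_onI)
  have [measurable]: "s' \<in> borel_measurable borel" using cont by (rule borel_measurable_continuous_onI)
  \<comment> \<open>\<open>Suc n\<close> keeps the interval nondegenerate at
    \<open>n = 0\<close>.\<close>
  let ?h = "\<lambda>n v. F (s v) * ennreal (s' v) * indicator {- real (Suc n)..real (Suc n)} v"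
  have le: "(\<integral>\<^sup>+v. ?h n v \<partial>lborel) \<le> (\<integral>\<^sup>+x. F x * indicator A x \<partial>lborel)" for n
  proof -
    have "(\<integral>\<^sup>+v. ?h n v \<partial>lborel) = (\<integral>\<^sup>+x. F x * indicator {s (- real (Suc n))..s (real (Suc n))} x \<partial>lborel)"
      by (rule nn_integral_substitution_aux[symmetric])
         (use assms continuous_on_subset[OF cont] in auto)
    also have "\<dots> \<le> (\<integral>\<^sup>+x. F x * indicator A x \<partial>lborel)"
    proof (rule nn_integral_mono)
      fix x
      show "F x * indicator {s (- real (Suc n))..s (real (Suc n))} x \<le> F x * indicator A x"
        using A[of "- real (Suc n)" "real (Suc n)"] by (intro mult_left_mono) (auto simp: indicator_def)
    qed
    finally show ?thesis .
  qed
  have "(\<integral>\<^sup>+v. F (s v) * ennreal (s' v) \<partial>lborel) = (\<integral>\<^sup>+v. (SUP n. ?h n v) \<partial>lborel)"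
  proof (rule nn_integral_cong)
    fix v :: real
    obtain N where "\<bar>v\<bar> \<le> real N" using real_arch_simple by blast
    then have "?h N v = F (s v) * ennreal (s' v)" by (auto simp: indicator_def)
    then have "F (s v) * ennreal (s' v) \<le> (SUP n. ?h n v)" by (intro SUP_upper2[of N]) auto
    moreover have "(SUP n. ?h n v) \<le> F (s v) * ennreal (s' v)"
      by (rule SUP_least) (auto simp: indicator_def)
    ultimately show "F (s v) * ennreal (s' v) = (SUP n. ?h n v)" by (rule antisym)
  qed
  also have "\<dots> = (SUP n. \<integral>\<^sup>+v. ?h n v \<partial>lborel)"
    by (rule nn_integral_monotone_convergence_SUP)
       (auto simp: incseq_def le_fun_def indicator_def)
  also have "\<dots> \<le> (\<integral>\<^sup>+x. F x * indicator A x \<partial>lborel)"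
    by (rule SUP_least) (rule le)
  finally show ?thesis .
qed

text \<open>Comparison with 1 on \<open>[-1, 1]\<close> and with
  \<open>\<bar>v\<bar> powr - \<gamma>\<close> outside. In the application to Hoelder's inequality
  \<open>\<gamma> > 1\<close> is equivalent to \<open>p > d / (d - 1)\<close>.\<close>

lemma nn_integral_powr_tail_finite:
  assumes "\<gamma> > 1"
  shows "(\<integral>\<^sup>+v. ennreal (sqrt (1 + v\<^sup>2) powr - \<gamma>) \<partial>lborel) < \<infinity>"
proof -
  let ?f = "\<lambda>v::real. v powr - \<gamma>"
  have tail: "(\<integral>\<^sup>+v. ennreal (?f v) * indicator {1..} v \<partial>lborel) = ennreal (0 - 1 powr (1 - \<gamma>) / (1 - \<gamma>))"
  proof (rule nn_integral_FTC_atLeast[where F="\<lambda>v. v powr (1 - \<gamma>) / (1 - \<gamma>)"])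
    show "((\<lambda>v. v powr (1 - \<gamma>) / (1 - \<gamma>)) \<longlongrightarrow> 0) at_top"
      using tendsto_neg_powr[of "1 - \<gamma>" "\<lambda>v. v" at_top] assms
      by (auto intro!: tendsto_divide_zero filterlim_ident)
    fix v :: real assume "1 \<le> v"
    then show "DERIV (\<lambda>v. v powr (1 - \<gamma>) / (1 - \<gamma>)) v :> ?f v"
      using assms by (auto intro!: derivative_eq_intros)
  qed auto
  have refl: "(\<integral>\<^sup>+v. ennreal (?f (- v)) * indicator {..-1} v \<partial>lborel) = (\<integral>\<^sup>+v. ennreal (?f v) * indicator {1..} v \<partial>lborel)"
    by (subst nn_integral_real_affine[of _ "-1" 0]) (auto simp: indicator_def intro!: nn_integral_cong)
  have "(\<integral>\<^sup>+v. ennreal (sqrt (1 + v\<^sup>2) powr - \<gamma>) \<partial>lborel)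
    \<le> (\<integral>\<^sup>+v. indicator {-1..1} v + (ennreal (?f v) * indicator {1..} v + ennreal (?f (- v)) * indicator {..-1} v) \<partial>lborel)"
  proof (rule nn_integral_mono)
    fix v :: real
    have 1: "sqrt (1 + v\<^sup>2) powr - \<gamma> \<le> 1"
      using assms powr_mono[of "- \<gamma>" 0 "sqrt (1 + v\<^sup>2)"] by (simp split: if_split_asm)
    have 2: "sqrt (1 + v\<^sup>2) powr - \<gamma> \<le> \<bar>v\<bar> powr - \<gamma>" if "\<bar>v\<bar> \<ge> 1"
      using assms that by (intro powr_mono2') (auto intro: real_le_rsqrt)
    show "ennreal (sqrt (1 + v\<^sup>2) powr - \<gamma>) \<le> indicator {-1..1} v + (ennreal (?f v) * indicator {1..} v + ennreal (?f (- v)) * indicator {..-1} v)"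
    proof -
      consider "\<bar>v\<bar> \<le> 1" | "v > 1" | "v < -1" by linarith
      then show ?thesis
      proof cases
        case 1
        have "ennreal (sqrt (1 + v\<^sup>2) powr - \<gamma>) \<le> indicator {-1..1} v + 0"
          using 1 \<open>sqrt (1 + v\<^sup>2) powr - \<gamma> \<le> 1\<close> by (auto simp: indicator_def abs_le_iff)
        also have "\<dots> \<le> indicator {-1..1} v + (ennreal (?f v) * indicator {1..} v + ennreal (?f (- v)) * indicator {..-1} v)"
          by (intro add_left_mono) simp
        finally show ?thesis .
      qed (use 2 in \<open>auto simp: indicator_def\<close>)
    qed
  qed
  also have "\<dots> = (\<integral>\<^sup>+v. indicator {-1..1::real} v \<partial>lborel) + ((\<integral>\<^sup>+v. ennreal (?f v) * indicator {1..} v \<partial>lborel) + (\<integral>\<^sup>+v. ennreal (?f (- v)) * indicator {..-1} v \<partial>lborel))"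
    by (simp add: nn_integral_add)
  also have "\<dots> < \<infinity>"
    unfolding refl tail by (simp add: nn_integral_indicator flip: ennreal_plus)
  finally show ?thesis .
qed

section \<open>Hoelder's inequality by scaling Young's inequality\<close>

lemma Young_weak:
  fixes a b p :: real
  assumes "0 \<le> a" "0 \<le> b" "p > 1"
  shows "a * b \<le> a powr p + b powr (p / (p - 1))"
\<comment> \<open>On either side of the curve \<open>b = a powr (p - 1)\<close> the product is at
  most one of the two summands. The usual factors \<open>1 / p\<close> and
  \<open>(p - 1) / p\<close> are given up, since constants are not tracked sharply.\<close>
proof (cases "b \<le> a powr (p - 1)")
  case True
  have "a * b \<le> a * a powr (p - 1)" using True assms by (intro mult_left_mono)
  also have "\<dots> = a powr p" using assms by (cases "a = 0") (auto simp: powr_mult_base)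
  finally show ?thesis by (simp add: add_increasing2)
next
  case False
  then have "(a powr (p - 1)) powr (1 / (p - 1)) \<le> b powr (1 / (p - 1))"
    using assms by (intro powr_mono2) auto
  then have "a \<le> b powr (1 / (p - 1))" using assms by (simp add: powr_powr)
  then have "a * b \<le> b powr (1 / (p - 1)) * b" using assms by (intro mult_right_mono)
  also have "\<dots> = b powr (1 / (p - 1) + 1)" using assms by (cases "b = 0") (auto simp: powr_add)
  also have "1 / (p - 1) + 1 = p / (p - 1)" using assms by (simp add: field_simps)
  finally show ?thesis by (simp add: add_increasing)
qed

lemma enn_rpow_ennreal: "0 \<le> c \<Longrightarrow> enn_rpow (ennreal c) r = ennreal (c powr r)"
  by (simp add: enn_rpow_def)

lemma enn_rpow_top [simp]: "enn_rpow \<infinity> r = \<infinity>" "enn_rpow top r = \<infinity>"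
  by (simp_all add: enn_rpow_def)

lemma enn_rpow_0 [simp]: "enn_rpow 0 r = 0"
  by (simp add: enn_rpow_def)

text \<open>Homogeneity turns Young into Hoelder: \<open>\<kappa> = J powr (- 1 / p)\<close>
  normalizes the first term to 1 and leaves \<open>\<kappa> * A \<le> 1 + L\<close>. Quantifying
  over all \<open>\<kappa>\<close> also covers the values 0 and infinity of \<open>J\<close>, where
  no function could be normalized.\<close>

lemma enn_rpow_le_of_scaled_bound:
  fixes A J :: ennreal
  assumes "p > 1" "0 \<le> L"
    and bound: "\<And>\<kappa>. \<kappa> > 0 \<Longrightarrow> ennreal \<kappa> * A \<le> ennreal (\<kappa> powr p) * J + ennreal L"
  shows "enn_rpow A p \<le> ennreal ((1 + L) powr p) * J"
proof (cases J rule: ennreal_cases)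
  case (real j)
  have "A \<noteq> \<infinity>"
  proof
    assume "A = \<infinity>"
    then have "\<infinity> \<le> ennreal j + ennreal L" using bound[of 1] real by simp
    then show False using real assms by (simp add: top_unique flip: ennreal_plus)
  qed
  then obtain a where a: "A = ennreal a" "0 \<le> a" by (cases A rule: ennreal_cases) auto
  have bound': "\<kappa> * a \<le> \<kappa> powr p * j + L" if "\<kappa> > 0" for \<kappa>
    using bound[OF that] that a real \<open>0 \<le> L\<close>
    by (simp flip: ennreal_plus ennreal_mult' ennreal_mult'')
  have "a powr p \<le> (1 + L) powr p * j"
  proof (cases "j = 0")
    case True
    have "a = 0"
    proof (rule ccontr)
      assume "a \<noteq> 0"
      \<comment> \<open>For \<open>J = 0\<close> arbitrarily large \<open>\<kappa>\<close> are
        allowed; this one makes \<open>\<kappa> * a\<close> exceed \<open>L\<close>.\<close>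
      then have "(L + 1) / a * a \<le> L" using bound'[of "(L + 1) / a"] a True \<open>0 \<le> L\<close> by auto
      then show False using \<open>a \<noteq> 0\<close> by simp
    qed
    then show ?thesis using True by simp
  next
    case False
    then have j: "j > 0" using real by simp
    have "j powr (- (1 / p)) * a \<le> 1 + L"
    proof -
      have "(j powr (- (1 / p))) powr p = j powr - 1" unfolding powr_powr using \<open>p > 1\<close> by simp
      then have "(j powr (- (1 / p))) powr p * j = 1" using j by (simp add: powr_minus)
      then show ?thesis using bound'[of "j powr (- (1 / p))"] j by simp
    qed
    then have "j powr (1 / p) * (j powr (- (1 / p)) * a) \<le> j powr (1 / p) * (1 + L)"
      by (intro mult_left_mono) auto
    then have "a \<le> j powr (1 / p) * (1 + L)"
    proof -
      have "j powr (1 / p) * j powr (- (1 / p)) = 1" using j by (simp flip: powr_add)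
      then show ?thesis using \<open>j powr (1 / p) * (j powr (- (1 / p)) * a) \<le> j powr (1 / p) * (1 + L)\<close>
        by (simp flip: mult.assoc)
    qed
    then have "a powr p \<le> (j powr (1 / p) * (1 + L)) powr p"
      using a \<open>p > 1\<close> by (intro powr_mono2) auto
    also have "\<dots> = (1 + L) powr p * j"
      using j \<open>p > 1\<close> \<open>0 \<le> L\<close> by (simp add: powr_mult powr_powr)
    finally show ?thesis .
  qed
  then show ?thesis
    using a real by (simp add: enn_rpow_ennreal flip: ennreal_mult')
next
  case top
  then show ?thesis using assms by (simp add: ennreal_mult_top)
qed

section \<open>The distance to the origin as integration variable on a sphere\<close>

lemma DERIV_over_sqrt:
  "((\<lambda>v. v / sqrt (1 + v\<^sup>2)) has_real_derivative 1 / sqrt (1 + v\<^sup>2) ^ 3) (at v)"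
proof -
  let ?q = "sqrt (1 + v\<^sup>2)"
  have q: "?q > 0" "?q\<^sup>2 = 1 + v\<^sup>2" "1 + v\<^sup>2 > 0"
    by (simp_all add: add_pos_nonneg)
  have "((\<lambda>v. v / sqrt (1 + v\<^sup>2)) has_real_derivative (1 * ?q - v * (v / ?q)) / (?q * ?q)) (at v)"
    using q by (auto intro!: derivative_eq_intros simp: field_simps)
  also have "1 * ?q - v * (v / ?q) = 1 / ?q"
    using q by (simp add: field_simps power2_eq_square)
  also have "1 / ?q / (?q * ?q) = 1 / ?q ^ 3"
    by (simp add: power3_eq_cube)
  finally show ?thesis .
qed

lemma over_sqrt_power2: "(v / sqrt (1 + v\<^sup>2))\<^sup>2 = 1 - 1 / (1 + v\<^sup>2)" for v :: real
proof -
  have "1 + v\<^sup>2 > 0" by (simp add: add_pos_nonneg)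
  then show ?thesis by (simp add: power_divide field_simps)
qed

text \<open>By the law of cosines \<open>s\<close> is the third side of a triangle with sides
  \<open>r\<close> and \<open>t\<close>. The last bound completes the square in two ways,
  \<open>s\<^sup>2 = r\<^sup>2 * (1 - u\<^sup>2) + (t + r * u)\<^sup>2\<close> and the same with
  \<open>r\<close> and \<open>t\<close> exchanged, and drops the second square.\<close>

lemma spherical_distance_bounds:
  fixes r t u :: real
  assumes "0 < r" "0 < t" "\<bar>u\<bar> \<le> 1"
  defines "s \<equiv> sqrt (r\<^sup>2 + t\<^sup>2 + 2 * r * t * u)"
  shows "\<bar>r - t\<bar> \<le> s" "s \<le> r + t" "max r t * sqrt (1 - u\<^sup>2) \<le> s"
proof -
  have rt: "r * t > 0" using assms by simp
  have 1: "- (r * t) \<le> r * t * u" "r * t * u \<le> r * t"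
    using mult_left_mono[of "-1" u "r * t"] mult_left_mono[of u 1 "r * t"] rt assms by auto
  show "\<bar>r - t\<bar> \<le> s"
    unfolding s_def by (rule real_le_rsqrt) (use 1 in \<open>simp add: power2_diff\<close>)
  show "s \<le> r + t"
    unfolding s_def by (rule real_le_lsqrt) (use 1 assms in \<open>simp_all add: power2_sum\<close>)
  have u2: "u\<^sup>2 \<le> 1" using assms by (simp add: abs_square_le_1)
  have "r * sqrt (1 - u\<^sup>2) \<le> s"
  proof -
    have "(r * sqrt (1 - u\<^sup>2))\<^sup>2 = r\<^sup>2 * (1 - u\<^sup>2)" using u2 by (simp add: power_mult_distrib)
    also have "\<dots> \<le> r\<^sup>2 * (1 - u\<^sup>2) + (t + r * u)\<^sup>2" by simp
    also have "\<dots> = r\<^sup>2 + t\<^sup>2 + 2 * r * t * u" by (simp add: power2_eq_square algebra_simps)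
    finally show ?thesis unfolding s_def by (rule real_le_rsqrt)
  qed
  moreover have "t * sqrt (1 - u\<^sup>2) \<le> s"
  proof -
    have "(t * sqrt (1 - u\<^sup>2))\<^sup>2 = t\<^sup>2 * (1 - u\<^sup>2)" using u2 by (simp add: power_mult_distrib)
    also have "\<dots> \<le> t\<^sup>2 * (1 - u\<^sup>2) + (r + t * u)\<^sup>2" by simp
    also have "\<dots> = r\<^sup>2 + t\<^sup>2 + 2 * r * t * u" by (simp add: power2_eq_square algebra_simps)
    finally show ?thesis unfolding s_def by (rule real_le_rsqrt)
  qed
  ultimately show "max r t * sqrt (1 - u\<^sup>2) \<le> s" by (simp add: max_def)
qed

text \<open>The factor \<open>(max r t) ^ n\<close> comes from \<open>s \<ge> max r t * sqrt (1 - u\<^sup>2)\<close>: the side \<open>s\<close> of a triangle with other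
  sides \<open>r\<close>, \<open>t\<close> is at least as long as the heights on these.  This is sharp near \<open>s = 0\<close>, where the critical
  exponent is decided.\<close>
lemma nn_integral_distance_density:
  fixes F :: "real \<Rightarrow> ennreal"
  assumes [measurable]: "F \<in> borel_measurable borel" and r: "0 < r" and t: "0 < t"
  defines "s \<equiv> \<lambda>v. sqrt (r\<^sup>2 + t\<^sup>2 + 2 * r * t * (v / sqrt (1 + v\<^sup>2)))"
  shows "(\<integral>\<^sup>+v. F (s v) * ennreal (1 / sqrt (1 + v\<^sup>2) ^ (n + 3)) \<partial>lborel)
    \<le> ennreal (1 / (r * t * max r t ^ n)) * (\<integral>\<^sup>+x. F x * ennreal (x ^ Suc n) * indicator {\<bar>r - t\<bar>..r + t} x \<partial>lborel)"
proof -
  let ?q = "\<lambda>v. sqrt (1 + v\<^sup>2)" and ?m = "max r t"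
  define s' where "s' v = r * t / (s v * ?q v ^ 3)" for v
  have m: "?m > 0" using r by auto
  have q: "?q v > 0" "?q v \<ge> 1" for v by (simp_all add: add_pos_nonneg)
  have u1: "\<bar>v / ?q v\<bar> < 1" for v
  proof -
    have "1 + v\<^sup>2 > 0" by (simp add: add_pos_nonneg)
    then have "(v / ?q v)\<^sup>2 < 1" unfolding over_sqrt_power2 by simp
    then show ?thesis by (simp add: abs_square_less_1)
  qed
  have sb: "\<bar>r - t\<bar> \<le> s v" "s v \<le> r + t" "?m / ?q v \<le> s v" for v
  proof -
    note b = spherical_distance_bounds[OF r t less_imp_le[OF u1[of v]]]
    show "\<bar>r - t\<bar> \<le> s v" "s v \<le> r + t" using b by (simp_all add: s_def)
    have "sqrt (1 - (v / ?q v)\<^sup>2) = 1 / ?q v"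
      unfolding over_sqrt_power2 by (simp add: real_sqrt_divide)
    then show "?m / ?q v \<le> s v" using b(3) by (simp add: s_def)
  qed
  \<comment> \<open>Strict even for \<open>r = t\<close>, where \<open>s v\<close> tends to 0 as
    \<open>v\<close> tends to minus infinity; this makes the square root differentiable on the whole
    line.\<close>
  have spos: "s v > 0" for v using sb(3)[of v] m q(1)[of v] by (meson divide_pos_pos less_le_trans)
  have deriv: "(s has_real_derivative s' v) (at v)" for v
  proof -
    have in_pos: "0 < r\<^sup>2 + t\<^sup>2 + 2 * r * t * (v / ?q v)"
      using spos[of v] by (simp add: s_def)
    have h: "((\<lambda>v. r\<^sup>2 + t\<^sup>2 + 2 * r * t * (v / ?q v)) has_real_derivative 0 + 2 * r * t * (1 / ?q v ^ 3)) (at v)"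
      by (intro DERIV_add DERIV_const DERIV_cmult DERIV_over_sqrt)
    have "(s has_real_derivative (inverse (sqrt (r\<^sup>2 + t\<^sup>2 + 2 * r * t * (v / ?q v))) / 2) * (0 + 2 * r * t * (1 / ?q v ^ 3))) (at v)"
      unfolding s_def by (rule DERIV_chain2[OF DERIV_real_sqrt[OF in_pos] h])
    then show ?thesis
    proof (rule DERIV_cong)
      have mult_div_aux: "(inverse a / 2) * (0 + 2 * r * t * (1 / Q ^ 3)) = r * t / (a * Q ^ 3)"
        if "a \<noteq> 0" "Q \<noteq> 0" for a Q :: real
        using that by (simp add: field_simps)
      have sv: "sqrt (r\<^sup>2 + t\<^sup>2 + 2 * r * t * (v / ?q v)) = s v" by (simp add: s_def)
      show "(inverse (sqrt (r\<^sup>2 + t\<^sup>2 + 2 * r * t * (v / ?q v))) / 2) * (0 + 2 * r * t * (1 / ?q v ^ 3)) = s' v"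
        unfolding sv s'_def
        by (rule mult_div_aux[OF less_imp_neq[OF spos, THEN not_sym] less_imp_neq[OF q(1), THEN not_sym]])
    qed
  qed
  have contq: "continuous_on UNIV ?q" by (intro continuous_intros)
  have conts: "continuous_on UNIV s"
    using deriv DERIV_isCont by (blast intro: continuous_at_imp_continuous_on)
  have [measurable]: "s \<in> borel_measurable borel" using conts by (rule borel_measurable_continuous_onI)
  have conts': "continuous_on UNIV s'"
    unfolding s'_def
  proof (intro continuous_on_divide continuous_on_const continuous_on_mult continuous_on_power conts contq ballI)
    fix v
    show "s v * ?q v ^ 3 \<noteq> 0" using spos[of v] q(1)[of v] by (simp only: mult_eq_0_iff power_eq_0_iff) auto
  qed
  have [measurable]: "s' \<in> borel_measurable borel" using conts' by (rule borel_measurable_continuous_onI)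
  let ?c = "1 / (r * t * ?m ^ n)"
  have c: "?c \<ge> 0" using r t m by simp
  \<comment> \<open>As \<open>s v * s' v = r * t / ?q v ^ 3\<close>, three of the factors
    \<open>1 / ?q v\<close> are the Jacobian, which also brings one factor \<open>s v\<close>. The
    other \<open>n\<close> are each bounded by \<open>s v / ?m\<close>, which completes the weight
    to \<open>s v ^ Suc n\<close>.\<close>
  have pw: "1 / ?q v ^ (n + 3) \<le> ?c * (s v ^ Suc n * s' v)" for v
  proof -
    have "(1 / ?q v) ^ n = (1 / ?m ^ n) * (?m / ?q v) ^ n"
      using m by (simp add: power_divide)
    also have "\<dots> \<le> (1 / ?m ^ n) * s v ^ n"
      using sb(3)[of v] m q(1)[of v] by (intro mult_left_mono power_mono) auto
    finally have "(1 / ?q v) ^ n * (1 / ?q v ^ 3) \<le> (1 / ?m ^ n) * s v ^ n * (1 / ?q v ^ 3)"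
      using q(1)[of v] by (intro mult_right_mono) auto
    also have "\<dots> = ?c * (s v ^ Suc n * s' v)"
      using r t spos[of v] by (simp add: s'_def)
    finally show ?thesis by (simp add: power_add power_one_over)
  qed
  have "(\<integral>\<^sup>+v. F (s v) * ennreal (1 / ?q v ^ (n + 3)) \<partial>lborel)
      \<le> (\<integral>\<^sup>+v. ennreal ?c * (F (s v) * ennreal (s v ^ Suc n) * ennreal (s' v)) \<partial>lborel)"
  proof (rule nn_integral_mono)
    fix v
    have "s' v \<ge> 0" unfolding s'_def using r t spos[of v] q(1)[of v] by (intro divide_nonneg_nonneg mult_nonneg_nonneg) auto
    have "ennreal (1 / ?q v ^ (n + 3)) \<le> ennreal (?c * (s v ^ Suc n * s' v))" by (intro ennreal_leI pw)
    also have "\<dots> = ennreal ?c * (ennreal (s v ^ Suc n) * ennreal (s' v))"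
      using c spos[of v] \<open>s' v \<ge> 0\<close> by (simp only: ennreal_mult mult_nonneg_nonneg zero_le_power less_imp_le)
    finally have "F (s v) * ennreal (1 / ?q v ^ (n + 3)) \<le> F (s v) * (ennreal ?c * (ennreal (s v ^ Suc n) * ennreal (s' v)))"
      by (rule mult_left_mono) simp
    also have "\<dots> = ennreal ?c * (F (s v) * ennreal (s v ^ Suc n) * ennreal (s' v))" by (simp add: mult_ac)
    finally show "F (s v) * ennreal (1 / ?q v ^ (n + 3)) \<le> ennreal ?c * (F (s v) * ennreal (s v ^ Suc n) * ennreal (s' v))" .
  qed
  also have "\<dots> = ennreal ?c * (\<integral>\<^sup>+v. F (s v) * ennreal (s v ^ Suc n) * ennreal (s' v) \<partial>lborel)"
    by (rule nn_integral_cmult) measurable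
  also have "\<dots> \<le> ennreal ?c * (\<integral>\<^sup>+x. F x * ennreal (x ^ Suc n) * indicator {\<bar>r - t\<bar>..r + t} x \<partial>lborel)"
  proof (rule mult_left_mono)
    show "(\<integral>\<^sup>+v. F (s v) * ennreal (s v ^ Suc n) * ennreal (s' v) \<partial>lborel) \<le> (\<integral>\<^sup>+x. F x * ennreal (x ^ Suc n) * indicator {\<bar>r - t\<bar>..r + t} x \<partial>lborel)"
    proof (rule nn_integral_substitution_real_line[where F="\<lambda>x. F x * ennreal (x ^ Suc n)"])
      show "0 \<le> s' v" for v
        unfolding s'_def using r t spos[of v] q(1)[of v] by (intro divide_nonneg_nonneg mult_nonneg_nonneg) auto
      show "{s a..s b} \<subseteq> {\<bar>r - t\<bar>..r + t}" for a b
        using sb(1)[of a] sb(2)[of b] by auto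
    qed (use deriv conts' in auto)
  qed simp
  finally show ?thesis .
qed

text \<open>Law of cosines. Pointing the axis along \<open>- x\<close> gives the cross term the plus
  sign that \<open>spherical_distance_bounds\<close> assumes.\<close>

lemma norm_diff_scaled_sphere:
  fixes x y :: "'a::euclidean_space"
  assumes "x \<noteq> 0" "norm y = 1"
  shows "norm (x - t *\<^sub>R y) = sqrt ((norm x)\<^sup>2 + t\<^sup>2 + 2 * norm x * t * (y \<bullet> (- x /\<^sub>R norm x)))"
proof -
  have "(norm (x - t *\<^sub>R y))\<^sup>2 = (norm x)\<^sup>2 + t\<^sup>2 - 2 * t * (x \<bullet> y)"
  proof -
    have "(norm (x - t *\<^sub>R y))\<^sup>2 = (norm x)\<^sup>2 - 2 * t * (x \<bullet> y) + t\<^sup>2 * (norm y)\<^sup>2"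
      unfolding power2_norm_eq_inner
      by (simp add: inner_diff_left inner_diff_right inner_commute[of y x] power2_eq_square right_diff_distrib)
    then show ?thesis using assms(2) by simp
  qed
  also have "\<dots> = (norm x)\<^sup>2 + t\<^sup>2 + 2 * norm x * t * (y \<bullet> (- x /\<^sub>R norm x))"
    using assms(1) by (simp add: inner_commute[of y x])
  finally show ?thesis
    by (metis norm_ge_zero real_sqrt_abs2 abs_of_nonneg power2_eq_square)
qed

lemma nn_integral_sphere_radial:
  fixes x :: "'a::euclidean_space" and F :: "real \<Rightarrow> ennreal"
  assumes d: "DIM('a) \<ge> 2" and [measurable]: "F \<in> borel_measurable borel" and x: "x \<noteq> 0"
  shows "(\<integral>\<^sup>+y. F (norm (x - t *\<^sub>R y)) \<partial>sphere_measure)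
    = ennreal (sphere_inner_const DIM('a)) *
      (\<integral>\<^sup>+v. F (sqrt ((norm x)\<^sup>2 + t\<^sup>2 + 2 * norm x * t * (v / sqrt (1 + v\<^sup>2)))) * ennreal (1 / sqrt (1 + v\<^sup>2) ^ DIM('a)) \<partial>lborel)"
proof -
  define e where "e = - x /\<^sub>R norm x"
  have "norm e = 1" using x by (simp add: e_def)
  have "(\<integral>\<^sup>+y. F (norm (x - t *\<^sub>R y)) \<partial>sphere_measure)
      = (\<integral>\<^sup>+y. F (sqrt ((norm x)\<^sup>2 + t\<^sup>2 + 2 * norm x * t * (y \<bullet> e))) \<partial>sphere_measure)"
    by (intro nn_integral_cong_AE, rule AE_mp[OF AE_sphere_measure])
       (auto simp: norm_diff_scaled_sphere[OF x] e_def)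
  also have "\<dots> = ennreal (sphere_inner_const DIM('a)) *
      (\<integral>\<^sup>+v. F (sqrt ((norm x)\<^sup>2 + t\<^sup>2 + 2 * norm x * t * (v / sqrt (1 + v\<^sup>2)))) * ennreal ((1 + v\<^sup>2) powr (- real DIM('a) / 2)) \<partial>lborel)"
    by (subst nn_integral_sphere_inner[where g="\<lambda>u. F (sqrt ((norm x)\<^sup>2 + t\<^sup>2 + 2 * norm x * t * u))"])
       (use d \<open>norm e = 1\<close> in auto)
  also have "(\<lambda>v. (1 + v\<^sup>2) powr (- real DIM('a) / 2)) = (\<lambda>v::real. 1 / sqrt (1 + v\<^sup>2) ^ DIM('a))"
  proof
    fix v :: real
    have p: "1 + v\<^sup>2 > 0" by (simp add: add_pos_nonneg)
    then have "sqrt (1 + v\<^sup>2) ^ DIM('a) = ((1 + v\<^sup>2) powr (1/2)) powr real DIM('a)"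
      by (subst powr_realpow) (auto simp: powr_half_sqrt)
    then show "(1 + v\<^sup>2) powr (- real DIM('a) / 2) = 1 / sqrt (1 + v\<^sup>2) ^ DIM('a)"
      unfolding powr_powr by (simp add: powr_minus_divide[symmetric])
  qed
  finally show ?thesis .
qed

text \<open>Write \<open>Q\<close> for \<open>sqrt (1 + v\<^sup>2)\<close>. The weight
  \<open>1 / Q ^ d\<close> is split into \<open>Q powr (- (d + 1) / p)\<close> and
  \<open>Q powr (- d + (d + 1) / p)\<close>. The p-th power of the first is
  \<open>1 / Q ^ (d + 1)\<close>, and \<open>d + 1 = (d - 2) + 3\<close> is the exponent for which
  \<open>nn_integral_distance_density\<close> yields the volume weight \<open>s ^ (d - 1)\<close>.
  The dual power of the second is \<open>Q powr - \<gamma>\<close>.\<close>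

lemma sphere_radial_Holder:
  fixes p :: real
  assumes d: "DIM('a::euclidean_space) \<ge> 2" and p: "p > real DIM('a) / (real DIM('a) - 1)"
  shows "\<exists>C>0. \<forall>F::real \<Rightarrow> real. F \<in> borel_measurable borel \<longrightarrow> (\<forall>s. 0 \<le> F s) \<longrightarrow> (\<forall>x::'a. \<forall>t>0. x \<noteq> 0 \<longrightarrow>
    enn_rpow (\<integral>\<^sup>+y. ennreal (F (norm (x - t *\<^sub>R y))) \<partial>sphere_measure) p
      \<le> ennreal C * (ennreal (1 / (norm x * t * max (norm x) t ^ (DIM('a) - 2))) *
         (\<integral>\<^sup>+s. ennreal (F s powr p) * ennreal (s ^ (DIM('a) - 1)) * indicator {\<bar>norm x - t\<bar>..norm x + t} s \<partial>lborel)))"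
proof -
  let ?d = "real DIM('a)" and ?q = "\<lambda>v::real. sqrt (1 + v\<^sup>2)"
  have p1: "p > 1" and pd: "(?d - 1) * p > ?d"
  proof -
    show "(?d - 1) * p > ?d" using p d by (simp add: field_simps)
    have "?d / (?d - 1) > 1" using d by simp
    then show "p > 1" using p by linarith
  qed
  \<comment> \<open>The exponent left to the dual factor; \<open>\<gamma> > 1\<close> unfolds to
    \<open>(d - 1) * p > d\<close>.\<close>
  define \<gamma> where "\<gamma> = (?d * p - ?d - 1) / (p - 1)"
  have \<gamma>: "\<gamma> > 1" using p1 pd by (simp add: \<gamma>_def field_simps)
  obtain L where L: "(\<integral>\<^sup>+v. ennreal (?q v powr - \<gamma>) \<partial>lborel) = ennreal L" "L \<ge> 0"
    using nn_integral_powr_tail_finite[OF \<gamma>] by (cases "\<integral>\<^sup>+v. ennreal (?q v powr - \<gamma>) \<partial>lborel" rule: ennreal_cases) auto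
  let ?K = "sphere_inner_const DIM('a)"
  have K: "?K > 0" using d by (rule sphere_inner_const_pos)
  define C where "C = (1 + ?K * L) powr p * ?K"
  have "C > 0" unfolding C_def using K L(2) by (simp add: add_pos_nonneg less_imp_neq[THEN not_sym])
  moreover have "enn_rpow (\<integral>\<^sup>+y. ennreal (F (norm (x - t *\<^sub>R y))) \<partial>sphere_measure) p
      \<le> ennreal C * (ennreal (1 / (norm x * t * max (norm x) t ^ (DIM('a) - 2))) *
         (\<integral>\<^sup>+s. ennreal (F s powr p) * ennreal (s ^ (DIM('a) - 1)) * indicator {\<bar>norm x - t\<bar>..norm x + t} s \<partial>lborel))"
    if [measurable]: "F \<in> borel_measurable borel" and F: "\<And>s. 0 \<le> F s" and t: "t > 0" and x: "x \<noteq> 0"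
    for F :: "real \<Rightarrow> real" and x :: 'a and t :: real
  proof -
    let ?r = "norm x"
    define s where "s v = sqrt (?r\<^sup>2 + t\<^sup>2 + 2 * ?r * t * (v / ?q v))" for v
    have [measurable]: "s \<in> borel_measurable borel" unfolding s_def by measurable
    define A where "A = (\<integral>\<^sup>+y. ennreal (F (norm (x - t *\<^sub>R y))) \<partial>sphere_measure)"
    define J where "J = (\<integral>\<^sup>+v. ennreal (F (s v) powr p) * ennreal (1 / ?q v ^ (DIM('a) + 1)) \<partial>lborel)"
    have A: "A = ennreal ?K * (\<integral>\<^sup>+v. ennreal (F (s v)) * ennreal (1 / ?q v ^ DIM('a)) \<partial>lborel)"
      unfolding A_def s_def by (rule nn_integral_sphere_radial) (use d x in auto)
    have "ennreal \<kappa> * A \<le> ennreal (\<kappa> powr p) * (ennreal ?K * J) + ennreal (?K * L)" if \<kappa>: "\<kappa> > 0" for \<kappa>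
    proof -
      have "ennreal \<kappa> * (\<integral>\<^sup>+v. ennreal (F (s v)) * ennreal (1 / ?q v ^ DIM('a)) \<partial>lborel)
          = (\<integral>\<^sup>+v. ennreal \<kappa> * (ennreal (F (s v)) * ennreal (1 / ?q v ^ DIM('a))) \<partial>lborel)"
        by (rule nn_integral_cmult[symmetric]) measurable
      also have "\<dots> \<le> (\<integral>\<^sup>+v. ennreal (\<kappa> powr p) * (ennreal (F (s v) powr p) * ennreal (1 / ?q v ^ (DIM('a) + 1))) + ennreal (?q v powr - \<gamma>) \<partial>lborel)"
      proof (rule nn_integral_mono)
        fix v
        let ?Q = "?q v"
        have Q: "?Q > 0" by (simp add: add_pos_nonneg)
        define a b where "a = \<kappa> * F (s v) * ?Q powr (- (?d + 1) / p)" and "b = ?Q powr (- ?d + (?d + 1) / p)"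
        have ab: "a \<ge> 0" "b \<ge> 0" using \<kappa> F by (auto simp: a_def b_def)
        have pw: "?Q powr - real k = 1 / ?Q ^ k" for k
          using Q by (simp add: powr_minus_divide powr_realpow)
        have "a * b = \<kappa> * F (s v) * (?Q powr (- (?d + 1) / p) * ?Q powr (- ?d + (?d + 1) / p))"
          by (simp add: a_def b_def)
        also have "?Q powr (- (?d + 1) / p) * ?Q powr (- ?d + (?d + 1) / p) = ?Q powr - ?d"
          unfolding powr_add[symmetric] by (rule arg_cong[where f="\<lambda>z. ?Q powr z"]) (use p1 in \<open>simp add: field_simps\<close>)
        finally have 1: "a * b = \<kappa> * F (s v) * (1 / ?Q ^ DIM('a))" unfolding pw .
        have "a powr p = \<kappa> powr p * F (s v) powr p * ?Q powr (- (?d + 1))"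
          unfolding a_def using \<kappa> F p1 by (simp add: powr_mult powr_powr)
        also have "?Q powr (- (?d + 1)) = 1 / ?Q ^ (DIM('a) + 1)" using pw[of "DIM('a) + 1"] by (simp add: algebra_simps)
        finally have 2: "a powr p = \<kappa> powr p * F (s v) powr p * (1 / ?Q ^ (DIM('a) + 1))" .
        have "(- ?d + (?d + 1) / p) * (p / (p - 1)) = - \<gamma>"
          using p1 by (simp add: \<gamma>_def field_simps)
        then have 3: "b powr (p / (p - 1)) = ?Q powr - \<gamma>" by (simp add: b_def powr_powr)
        have "\<kappa> * F (s v) * (1 / ?Q ^ DIM('a)) \<le> \<kappa> powr p * F (s v) powr p * (1 / ?Q ^ (DIM('a) + 1)) + ?Q powr - \<gamma>"
          using Young_weak[OF ab p1] unfolding 1 2 3 .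
        then have "ennreal (\<kappa> * F (s v) * (1 / ?Q ^ DIM('a))) \<le> ennreal (\<kappa> powr p * F (s v) powr p * (1 / ?Q ^ (DIM('a) + 1)) + ?Q powr - \<gamma>)"
          by (rule ennreal_leI)
        also have "\<dots> = ennreal (\<kappa> powr p * F (s v) powr p * (1 / ?Q ^ (DIM('a) + 1))) + ennreal (?Q powr - \<gamma>)"
          using Q by (intro ennreal_plus) auto
        finally show "ennreal \<kappa> * (ennreal (F (s v)) * ennreal (1 / ?Q ^ DIM('a)))
          \<le> ennreal (\<kappa> powr p) * (ennreal (F (s v) powr p) * ennreal (1 / ?Q ^ (DIM('a) + 1))) + ennreal (?Q powr - \<gamma>)"
          using \<kappa> F Q by (simp only: ennreal_mult mult_nonneg_nonneg less_imp_le powr_ge_zero mult.assoc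
            zero_le_divide_1_iff zero_le_power)
      qed
      also have "\<dots> = ennreal (\<kappa> powr p) * J + ennreal L"
        unfolding J_def L(1)[symmetric] by (simp add: nn_integral_add nn_integral_cmult)
      finally have "ennreal ?K * (ennreal \<kappa> * (\<integral>\<^sup>+v. ennreal (F (s v)) * ennreal (1 / ?q v ^ DIM('a)) \<partial>lborel))
          \<le> ennreal ?K * (ennreal (\<kappa> powr p) * J + ennreal L)"
        by (rule mult_left_mono) simp
      then show ?thesis
        using K L(2) by (simp add: A ennreal_mult distrib_left mult_ac)
    qed
    then have "enn_rpow A p \<le> ennreal ((1 + ?K * L) powr p) * (ennreal ?K * J)"
      using p1 K L(2) by (intro enn_rpow_le_of_scaled_bound) auto
    also have "\<dots> = ennreal C * J"
      using K by (simp add: C_def ennreal_mult mult.assoc)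
    also have "J \<le> ennreal (1 / (?r * t * max ?r t ^ (DIM('a) - 2))) *
         (\<integral>\<^sup>+s. ennreal (F s powr p) * ennreal (s ^ (DIM('a) - 1)) * indicator {\<bar>?r - t\<bar>..?r + t} s \<partial>lborel)"
    proof -
      have e: "DIM('a) + 1 = (DIM('a) - 2) + 3" "DIM('a) - 1 = Suc (DIM('a) - 2)" using d by simp_all
      show ?thesis
        unfolding J_def s_def e
        by (rule nn_integral_distance_density[where F="\<lambda>s. ennreal (F s powr p)"]) (use x t in auto)
    qed
    finally show ?thesis unfolding A_def by (simp add: mult_left_mono)
  qed
  ultimately show ?thesis by blast
qed

section \<open>A one-dimensional maximal inequality\<close>

lemma nn_integral_powr_0:
  fixes a k :: real
  assumes "k > -1" "0 \<le> a"
  shows "(\<integral>\<^sup>+l. ennreal (l powr k) * indicator {0..a} l \<partial>lborel) = ennreal (a powr (k + 1) / (k + 1))"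
  by (rule nn_integral_has_integral_lebesgue'[OF _ has_integral_powr_from_0[OF assms]]) simp

text \<open>A layer-cake bound for \<open>(sup_t (\<integral>_{t-r}^{t+r} h) / r)^P\<close>: the superlevel set at height \<open>l\<close> only
  sees the part of \<open>h\<close> above \<open>l / 4\<close>.\<close>
lemma maximal_function_majorant:
  fixes h :: "real \<Rightarrow> real" and P :: real
  assumes [measurable]: "h \<in> borel_measurable borel" and h0: "\<And>s. 0 \<le> h s" and P: "P > 1"
  shows "\<exists>W \<in> borel_measurable borel.
    (\<integral>\<^sup>+r. W r * indicator {0<..} r \<partial>lborel) \<le> ennreal (2 * P * 4 powr (P - 1) / (P - 1)) * (\<integral>\<^sup>+s. ennreal (h s powr P) \<partial>lborel)
    \<and> (\<forall>r>0. \<forall>t. \<forall>y\<ge>0. ennreal (r * y) \<le> (\<integral>\<^sup>+s. ennreal (h s) * indicator {t - r..t + r} s \<partial>lborel) \<longrightarrow> ennreal (y powr P) \<le> W r)"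
proof -
  \<comment> \<open>If the integral over a window of length \<open>2 * r\<close> is at least
    \<open>r * l\<close>, then the part of \<open>h\<close> below \<open>l / 4\<close> supplies at
    most half of \<open>r * l\<close>. The part above supplies the rest, hence
    \<open>r * l \<le> S l\<close> with the factor 2.\<close>
  define S where "S l = 2 * (\<integral>\<^sup>+s. ennreal (h s) * indicator {l / 4<..} (h s) \<partial>lborel)" for l
  have [measurable]: "S \<in> borel_measurable borel"
    unfolding S_def by (simp add: indicator_def)
  \<comment> \<open>The layer-cake integral with the superlevel condition relaxed to
    \<open>r * l \<le> S l\<close>, which does not mention \<open>t\<close>: a single
    \<open>W\<close> dominates all centres at once.\<close>
  define W where "W r = (\<integral>\<^sup>+l. ennreal (P * l powr (P - 1)) * (indicator {0<..} l * (if ennreal (r * l) \<le> S l then 1 else 0)) \<partial>lborel)" for r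
  have [measurable]: "W \<in> borel_measurable borel"
    unfolding W_def by measurable
  have "ennreal (y powr P) \<le> W r"
    if r: "r > 0" and y: "y \<ge> 0" and le: "ennreal (r * y) \<le> (\<integral>\<^sup>+s. ennreal (h s) * indicator {t - r..t + r} s \<partial>lborel)" for r t y
  proof -
    have *: "ennreal (r * l) \<le> S l" if l: "0 < l" "l \<le> y" for l
    proof -
      have "ennreal (r * l) \<le> ennreal (r * y)" using that r by (intro ennreal_leI mult_left_mono) auto
      also note le
      also have "(\<integral>\<^sup>+s. ennreal (h s) * indicator {t - r..t + r} s \<partial>lborel)
        \<le> (\<integral>\<^sup>+s. ennreal (l / 4) * indicator {t - r..t + r} s + ennreal (h s) * indicator {l / 4<..} (h s) \<partial>lborel)"
      proof (rule nn_integral_mono)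
        fix s
        show "ennreal (h s) * indicator {t - r..t + r} s \<le> ennreal (l / 4) * indicator {t - r..t + r} s + ennreal (h s) * indicator {l / 4<..} (h s)"
        proof (cases "h s \<le> l / 4")
          case True
          then have "ennreal (h s) * indicator {t - r..t + r} s \<le> ennreal (l / 4) * indicator {t - r..t + r} s"
            by (intro mult_right_mono ennreal_leI) auto
          then show ?thesis by (rule order_trans) simp
        next
          case False
          then have "ennreal (h s) * indicator {t - r..t + r} s \<le> ennreal (h s) * indicator {l / 4<..} (h s)"
            by (intro mult_left_mono) (auto simp: indicator_def)
          then show ?thesis by (rule order_trans) simp
        qed
      qed
      also have "\<dots> = ennreal (l / 4) * ennreal (2 * r) + (\<integral>\<^sup>+s. ennreal (h s) * indicator {l / 4<..} (h s) \<partial>lborel)"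
        using r by (subst nn_integral_add) (auto simp: nn_integral_cmult indicator_def[of "{_<..}"])
      also have "ennreal (l / 4) * ennreal (2 * r) = ennreal (r * l / 2)"
        using r l by (subst ennreal_mult[symmetric]) (auto simp: field_simps)
      finally have "ennreal (r * l) \<le> ennreal (r * l / 2) + (\<integral>\<^sup>+s. ennreal (h s) * indicator {l / 4<..} (h s) \<partial>lborel)" .
      moreover have half: "ennreal (r * l) = ennreal (r * l / 2) + ennreal (r * l / 2)"
        using r l by (subst ennreal_plus[symmetric]) auto
      ultimately have "ennreal (r * l / 2) + ennreal (r * l / 2) \<le> ennreal (r * l / 2) + (\<integral>\<^sup>+s. ennreal (h s) * indicator {l / 4<..} (h s) \<partial>lborel)"
        by (simp only:)
      then have "ennreal (r * l / 2) \<le> (\<integral>\<^sup>+s. ennreal (h s) * indicator {l / 4<..} (h s) \<partial>lborel)"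
        by (subst (asm) ennreal_add_left_cancel_le) simp
      then have "2 * ennreal (r * l / 2) \<le> S l"
        unfolding S_def by (rule mult_left_mono) simp
      moreover have "ennreal (r * l) = 2 * ennreal (r * l / 2)"
        unfolding mult_2 by (rule half)
      ultimately show ?thesis by (simp only:)
    qed
    have "ennreal (y powr P) = ennreal P * ennreal (y powr P / P)"
      using P by (simp flip: ennreal_mult')
    also have "\<dots> = ennreal P * (\<integral>\<^sup>+l. ennreal (l powr (P - 1)) * indicator {0..y} l \<partial>lborel)"
      using P y by (subst nn_integral_powr_0) auto
    also have "\<dots> = (\<integral>\<^sup>+l. ennreal P * (ennreal (l powr (P - 1)) * indicator {0..y} l) \<partial>lborel)"
      by (subst nn_integral_cmult) auto
    also have "\<dots> \<le> W r"
      unfolding W_def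
    proof (rule nn_integral_mono)
      fix l
      show "ennreal P * (ennreal (l powr (P - 1)) * indicator {0..y} l)
        \<le> ennreal (P * l powr (P - 1)) * (indicator {0<..} l * (if ennreal (r * l) \<le> S l then 1 else 0))"
        using *[of l] P by (cases "0 < l \<and> l \<le> y") (auto simp: ennreal_mult indicator_def)
    qed
    finally show ?thesis .
  qed
  moreover have "(\<integral>\<^sup>+r. W r * indicator {0<..} r \<partial>lborel) \<le> ennreal (2 * P * 4 powr (P - 1) / (P - 1)) * (\<integral>\<^sup>+s. ennreal (h s powr P) \<partial>lborel)"
  proof -
    let ?g = "\<lambda>l. ennreal (P * l powr (P - 1)) * indicator {0<..} l"
    have "(\<integral>\<^sup>+r. W r * indicator {0<..} r \<partial>lborel)
       = (\<integral>\<^sup>+r. \<integral>\<^sup>+l. ?g l * ((if ennreal (r * l) \<le> S l then 1 else 0) * indicator {0<..} r) \<partial>lborel \<partial>lborel)"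
      unfolding W_def by (subst nn_integral_multc[symmetric]) (auto simp: mult_ac)
    also have "\<dots> = (\<integral>\<^sup>+l. \<integral>\<^sup>+r. ?g l * ((if ennreal (r * l) \<le> S l then 1 else 0) * indicator {0<..} r) \<partial>lborel \<partial>lborel)"
      by (rule lborel_pair.Fubini') measurable
    also have "\<dots> \<le> (\<integral>\<^sup>+l. \<integral>\<^sup>+s. ennreal (2 * P) * (ennreal (h s) * (ennreal (l powr (P - 2)) * indicator {0..4 * h s} l)) \<partial>lborel \<partial>lborel)"
    proof (rule nn_integral_mono)
      fix l :: real
      show "(\<integral>\<^sup>+r. ?g l * ((if ennreal (r * l) \<le> S l then 1 else 0) * indicator {0<..} r) \<partial>lborel)
        \<le> (\<integral>\<^sup>+s. ennreal (2 * P) * (ennreal (h s) * (ennreal (l powr (P - 2)) * indicator {0..4 * h s} l)) \<partial>lborel)"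
      proof (cases "l > 0")
        case l: True
        \<comment> \<open>For fixed \<open>l\<close> the admissible radii form an interval that
          starts at 0 and has length \<open>S l / l\<close>. This is the weak-type estimate.\<close>
        have len: "(\<integral>\<^sup>+r. (if ennreal (r * l) \<le> S l then 1 else 0) * indicator {0<..} r \<partial>lborel) \<le> S l / ennreal l"
        proof (cases "S l" rule: ennreal_cases)
          case (real c)
          have "(\<integral>\<^sup>+r. (if ennreal (r * l) \<le> S l then 1 else 0) * indicator {0<..} r \<partial>lborel)
            \<le> (\<integral>\<^sup>+r. indicator {0..c / l} r \<partial>lborel)"
            using l real by (intro nn_integral_mono) (auto simp: indicator_def pos_le_divide_eq)
          also have "\<dots> = ennreal (c / l)" using l real by simp
          finally show ?thesis using l real by (simp add: divide_ennreal)
        next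
          case top
          then show ?thesis using l by (simp add: ennreal_top_divide)
        qed
        have "(\<integral>\<^sup>+r. ?g l * ((if ennreal (r * l) \<le> S l then 1 else 0) * indicator {0<..} r) \<partial>lborel)
          = ?g l * (\<integral>\<^sup>+r. (if ennreal (r * l) \<le> S l then 1 else 0) * indicator {0<..} r \<partial>lborel)"
          by (rule nn_integral_cmult) measurable
        also have "\<dots> \<le> ?g l * (S l / ennreal l)"
          using len by (rule mult_left_mono) simp
        also have "\<dots> = ennreal (2 * P) * (ennreal (l powr (P - 2)) * (\<integral>\<^sup>+s. ennreal (h s) * indicator {l / 4<..} (h s) \<partial>lborel))"
        proof -
          have "l powr (P - 1) = l powr (P - 2) * l"
            using l powr_add[of l "P - 2" 1] by simp
          then have "?g l * inverse (ennreal l) = ennreal P * ennreal (l powr (P - 2))"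
            using l P by (simp add: inverse_ennreal flip: ennreal_mult' ennreal_mult'')
          then have "?g l * (S l / ennreal l) = ennreal P * ennreal (l powr (P - 2)) * S l"
            by (simp add: divide_ennreal_def mult_ac)
          then show ?thesis using P by (simp add: S_def ennreal_mult mult_ac)
        qed
        also have "\<dots> = (\<integral>\<^sup>+s. ennreal (2 * P) * (ennreal (l powr (P - 2)) * (ennreal (h s) * indicator {l / 4<..} (h s))) \<partial>lborel)"
          by (subst nn_integral_cmult[symmetric], simp add: indicator_def)+ (rule refl)
        also have "\<dots> \<le> (\<integral>\<^sup>+s. ennreal (2 * P) * (ennreal (h s) * (ennreal (l powr (P - 2)) * indicator {0..4 * h s} l)) \<partial>lborel)"
          using l by (intro nn_integral_mono mult_left_mono) (auto simp: indicator_def mult_ac)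
        finally show ?thesis .
      qed simp
    qed
    also have "\<dots> = (\<integral>\<^sup>+s. \<integral>\<^sup>+l. ennreal (2 * P) * (ennreal (h s) * (ennreal (l powr (P - 2)) * indicator {0..4 * h s} l)) \<partial>lborel \<partial>lborel)"
      by (rule lborel_pair.Fubini') (simp add: indicator_def)
    \<comment> \<open>After Fubini the truncation \<open>h s > l / 4\<close> has become a range for
      \<open>l\<close> that ends at \<open>4 * h s\<close>. Since \<open>P > 1\<close>, the power
      \<open>l powr (P - 2)\<close> is integrable at 0, and its integral supplies
      \<open>4 powr (P - 1) / (P - 1)\<close>.\<close>
    also have "\<dots> = (\<integral>\<^sup>+s. ennreal (2 * P * 4 powr (P - 1) / (P - 1)) * ennreal (h s powr P) \<partial>lborel)"
    proof (rule nn_integral_cong)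
      fix s
      have "(\<integral>\<^sup>+l. ennreal (2 * P) * (ennreal (h s) * (ennreal (l powr (P - 2)) * indicator {0..4 * h s} l)) \<partial>lborel)
        = ennreal (2 * P) * (ennreal (h s) * (\<integral>\<^sup>+l. ennreal (l powr (P - 2)) * indicator {0..4 * h s} l \<partial>lborel))"
        by (simp add: nn_integral_cmult)
      also have "(\<integral>\<^sup>+l. ennreal (l powr (P - 2)) * indicator {0..4 * h s} l \<partial>lborel) = ennreal ((4 * h s) powr (P - 1) / (P - 1))"
        using P h0[of s] by (subst nn_integral_powr_0) auto
      also have "ennreal (2 * P) * (ennreal (h s) * ennreal ((4 * h s) powr (P - 1) / (P - 1)))
         = ennreal (2 * P * (h s * ((4 * h s) powr (P - 1) / (P - 1))))"
      proof -
        have "ennreal a * (ennreal b * ennreal c) = ennreal (a * (b * c))" if "0 \<le> a" "0 \<le> b" "0 \<le> c" for a b c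
          using that by (simp add: ennreal_mult)
        then show ?thesis using P h0[of s] by auto
      qed
      also have "2 * P * (h s * ((4 * h s) powr (P - 1) / (P - 1))) = 2 * P * 4 powr (P - 1) / (P - 1) * (h s * h s powr (P - 1))"
        using h0[of s] by (simp add: powr_mult)
      also have "h s * h s powr (P - 1) = h s powr P"
        using h0[of s] by (cases "h s = 0") (auto simp: powr_mult_base)
      finally show "(\<integral>\<^sup>+l. ennreal (2 * P) * (ennreal (h s) * (ennreal (l powr (P - 2)) * indicator {0..4 * h s} l)) \<partial>lborel)
         = ennreal (2 * P * 4 powr (P - 1) / (P - 1)) * ennreal (h s powr P)"
        using P by (subst ennreal_mult[symmetric]) auto
    qed
    also have "\<dots> = ennreal (2 * P * 4 powr (P - 1) / (P - 1)) * (\<integral>\<^sup>+s. ennreal (h s powr P) \<partial>lborel)"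
      by (subst nn_integral_cmult) auto
    finally show ?thesis .
  qed
  ultimately show ?thesis by (intro bexI[of _ W]) auto
qed

section \<open>Sufficiency\<close>

lemma enn_rpow_mono:
  assumes "u \<le> v" "0 \<le> r"
  shows "enn_rpow u r \<le> enn_rpow v r"
proof (cases v rule: ennreal_cases)
  case (real b)
  then obtain a where a: "u = ennreal a" "0 \<le> a" using assms(1) by (cases u rule: ennreal_cases) (auto simp: top_unique)
  then have "a \<le> b" using assms(1) real by simp
  then show ?thesis using a real assms(2) by (simp add: enn_rpow_ennreal powr_mono2)
qed (simp add: enn_rpow_def)

lemma enn_rpow_enn_rpow:
  "enn_rpow (enn_rpow u r) r' = enn_rpow u (r * r')"
  by (cases u rule: ennreal_cases) (simp_all add: enn_rpow_ennreal powr_powr)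

lemma enn_rpow_1 [simp]: "enn_rpow u 1 = u"
  by (cases u rule: ennreal_cases) (simp_all add: enn_rpow_ennreal)

text \<open>The power is moved to the other side as \<open>enn_rpow B (1 / q)\<close>, where the
  supremum is a plain least upper bound.\<close>

lemma enn_rpow_SUP_le:
  assumes "q > 0" "\<And>t. t \<in> T \<Longrightarrow> enn_rpow (g t) q \<le> B"
  shows "enn_rpow (SUP t\<in>T. g t) q \<le> B"
proof -
  have "g t \<le> enn_rpow B (1 / q)" if "t \<in> T" for t
    using enn_rpow_mono[OF assms(2)[OF that], of "1 / q"] assms(1) by (simp add: enn_rpow_enn_rpow)
  then have "(SUP t\<in>T. g t) \<le> enn_rpow B (1 / q)" by (rule SUP_least)
  then have "enn_rpow (SUP t\<in>T. g t) q \<le> enn_rpow (enn_rpow B (1 / q)) q"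
    using assms(1) by (intro enn_rpow_mono) auto
  then show ?thesis using assms(1) by (simp add: enn_rpow_enn_rpow)
qed

lemma radial_eq_profile:
  fixes f :: "'a::real_normed_vector \<Rightarrow> real"
  assumes "radial f" "norm b = 1"
  shows "f z = f (norm z *\<^sub>R b)"
proof -
  have "norm z = norm (norm z *\<^sub>R b)" using assms(2) by simp
  then show ?thesis using assms(1) unfolding radial_def by blast
qed

lemma abs_sph_avg_le:
  fixes f :: "'a::euclidean_space \<Rightarrow> real"
  shows "ennreal \<bar>sph_avg t f x\<bar> \<le> (\<integral>\<^sup>+y. ennreal \<bar>f (x - t *\<^sub>R y)\<bar> \<partial>sphere_measure)"
proof (cases "integrable sphere_measure (\<lambda>y. f (x - t *\<^sub>R y))")
  case True
  then show ?thesis using integral_norm_bound_ennreal[OF True] by (simp add: sph_avg_def)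
next
  \<comment> \<open>The Bochner integral of a non-integrable function defaults to 0.\<close>
  case False
  then show ?thesis by (simp add: sph_avg_def not_integrable_integral_eq)
qed

lemma sph_avg_power_bound:
  fixes p :: real
  assumes d: "DIM('a::euclidean_space) \<ge> 2" and p: "p > real DIM('a) / (real DIM('a) - 1)"
  shows "\<exists>C>0. \<forall>(f::'a \<Rightarrow> real) b x t. f \<in> borel_measurable borel \<longrightarrow> radial f \<longrightarrow> norm b = 1 \<longrightarrow> x \<noteq> 0 \<longrightarrow> 0 < t \<longrightarrow>
     ennreal (\<bar>sph_avg t f x\<bar> powr p) \<le> ennreal C * (ennreal (1 / (norm x * t * max (norm x) t ^ (DIM('a) - 2))) *
        (\<integral>\<^sup>+s. ennreal (\<bar>f (s *\<^sub>R b)\<bar> powr p) * ennreal (s ^ (DIM('a) - 1)) * indicator {\<bar>norm x - t\<bar>..norm x + t} s \<partial>lborel))"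
proof -
  obtain C where C: "C > 0" "\<And>(F::real \<Rightarrow> real) (x::'a) t. F \<in> borel_measurable borel \<Longrightarrow> (\<forall>s. 0 \<le> F s) \<Longrightarrow> t > 0 \<Longrightarrow> x \<noteq> 0 \<Longrightarrow>
    enn_rpow (\<integral>\<^sup>+y. ennreal (F (norm (x - t *\<^sub>R y))) \<partial>sphere_measure) p
      \<le> ennreal C * (ennreal (1 / (norm x * t * max (norm x) t ^ (DIM('a) - 2))) *
         (\<integral>\<^sup>+s. ennreal (F s powr p) * ennreal (s ^ (DIM('a) - 1)) * indicator {\<bar>norm x - t\<bar>..norm x + t} s \<partial>lborel))"
    using sphere_radial_Holder[OF d p] by blast
  show ?thesis
  proof (intro exI[of _ C] conjI allI impI C(1))
    fix f :: "'a \<Rightarrow> real" and b x :: 'a and t :: real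
    assume [measurable]: "f \<in> borel_measurable borel" and f: "radial f" and b: "norm b = 1" and x: "x \<noteq> 0" and t: "0 < t"
    have "0 \<le> real DIM('a) / (real DIM('a) - 1)" using d by simp
    then have "p > 0" using p by linarith
    have "ennreal \<bar>sph_avg t f x\<bar> \<le> (\<integral>\<^sup>+y. ennreal \<bar>f (x - t *\<^sub>R y)\<bar> \<partial>sphere_measure)"
      by (rule abs_sph_avg_le)
    also have "\<dots> = (\<integral>\<^sup>+y. ennreal \<bar>f (norm (x - t *\<^sub>R y) *\<^sub>R b)\<bar> \<partial>sphere_measure)"
      by (subst radial_eq_profile[OF f b]) simp
    finally have "enn_rpow (ennreal \<bar>sph_avg t f x\<bar>) p \<le> enn_rpow (\<integral>\<^sup>+y. ennreal \<bar>f (norm (x - t *\<^sub>R y) *\<^sub>R b)\<bar> \<partial>sphere_measure) p"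
      using \<open>p > 0\<close> by (intro enn_rpow_mono) auto
    also have "\<dots> \<le> ennreal C * (ennreal (1 / (norm x * t * max (norm x) t ^ (DIM('a) - 2))) *
        (\<integral>\<^sup>+s. ennreal (\<bar>f (s *\<^sub>R b)\<bar> powr p) * ennreal (s ^ (DIM('a) - 1)) * indicator {\<bar>norm x - t\<bar>..norm x + t} s \<partial>lborel))"
      by (rule C(2)[of "\<lambda>s. \<bar>f (s *\<^sub>R b)\<bar>"]) (use x t in auto)
    finally show "ennreal (\<bar>sph_avg t f x\<bar> powr p) \<le> ennreal C * (ennreal (1 / (norm x * t * max (norm x) t ^ (DIM('a) - 2))) *
        (\<integral>\<^sup>+s. ennreal (\<bar>f (s *\<^sub>R b)\<bar> powr p) * ennreal (s ^ (DIM('a) - 1)) * indicator {\<bar>norm x - t\<bar>..norm x + t} s \<partial>lborel))"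
      by (simp add: enn_rpow_ennreal)
  qed
qed

text \<open>By Fubini, as \<open>s\<close> lies in the window about \<open>r\<close> iff
  \<open>r\<close> lies in the window about \<open>s\<close>. With \<open>c = 2\<close> the window
  contains the radii met by every sphere with \<open>t \<le> 2\<close>, so for
  \<open>norm x \<ge> 1 / 2\<close> the supremum over \<open>t\<close> costs only a
  constant.\<close>

lemma nn_integral_sliding_window:
  fixes G :: "real \<Rightarrow> ennreal"
  assumes [measurable]: "G \<in> borel_measurable borel" and "0 \<le> c"
  shows "(\<integral>\<^sup>+r. \<integral>\<^sup>+s. G s * indicator {r - c..r + c} s \<partial>lborel \<partial>lborel) = ennreal (2 * c) * (\<integral>\<^sup>+s. G s \<partial>lborel)"
proof -
  have "(\<integral>\<^sup>+r. \<integral>\<^sup>+s. G s * indicator {r - c..r + c} s \<partial>lborel \<partial>lborel)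
    = (\<integral>\<^sup>+s. \<integral>\<^sup>+r. G s * indicator {r - c..r + c} s \<partial>lborel \<partial>lborel)"
    by (rule lborel_pair.Fubini') (simp add: indicator_def)
  also have "\<dots> = (\<integral>\<^sup>+s. \<integral>\<^sup>+r. G s * indicator {s - c..s + c} r \<partial>lborel \<partial>lborel)"
    by (intro nn_integral_cong arg_cong2[where f="(*)"] refl) (auto simp: indicator_def)
  also have "\<dots> = (\<integral>\<^sup>+s. G s * ennreal (2 * c) \<partial>lborel)"
    using assms(2) by (simp add: nn_integral_cmult)
  also have "\<dots> = ennreal (2 * c) * (\<integral>\<^sup>+s. G s \<partial>lborel)"
    by (simp add: nn_integral_multc mult.commute)
  finally show ?thesis .
qed

lemma max_power_over_le:
  fixes r :: real
  assumes "1 / 2 \<le> r"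
  shows "max 1 r ^ n / r ^ n \<le> 2 ^ n"
proof -
  have "max 1 r / r \<le> 2" using assms by (simp add: max_def field_simps)
  then have "(max 1 r / r) ^ n \<le> 2 ^ n" using assms by (intro power_mono) auto
  then show ?thesis by (simp add: power_divide)
qed

text \<open>Away from the origin the Hoelder bound at exponent \<open>p\<close> itself suffices.  For \<open>norm x < 1 / 2\<close> it is
  applied at a smaller exponent \<open>p1 > d / (d - 1)\<close>, and the maximal function bound for exponent \<open>p / p1 > 1\<close>
  makes up for the difference.\<close>
lemma sph_avg_majorant:
  fixes p :: real
  assumes d: "DIM('a::euclidean_space) \<ge> 2" and p: "p > real DIM('a) / (real DIM('a) - 1)"
  shows "\<exists>C>0. \<forall>(f::'a \<Rightarrow> real) b. f \<in> borel_measurable borel \<longrightarrow> radial f \<longrightarrow> norm b = 1 \<longrightarrow>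
    (let I = (\<integral>\<^sup>+s. ennreal (\<bar>f (s *\<^sub>R b)\<bar> powr p) * (ennreal (s ^ (DIM('a) - 1)) * indicator {0<..} s) \<partial>lborel) in
     \<exists>U\<in>borel_measurable borel.
       (\<integral>\<^sup>+r. U r * (ennreal (max 1 r ^ (DIM('a) - 1)) * indicator {0<..} r) \<partial>lborel) \<le> ennreal C * I \<and>
       (\<forall>x t. x \<noteq> 0 \<longrightarrow> 1 \<le> t \<longrightarrow> t \<le> 2 \<longrightarrow>
         ennreal (\<bar>sph_avg t f x\<bar> powr p) \<le> ennreal (C / min 1 (norm x)) * I \<and>
         ennreal (\<bar>sph_avg t f x\<bar> powr p) \<le> U (norm x)))"
proof -
  let ?d = "real DIM('a)" and ?n = "DIM('a) - 1"
  have n: "?n = Suc (DIM('a) - 2)" using d by simp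
  obtain p1 where p1: "p1 > ?d / (?d - 1)" "p1 < p" using dense[OF p] by blast
  have "?d / (?d - 1) \<ge> 0" using d by simp
  then have p1pos: "p1 > 0" using p1 by linarith
  define P where "P = p / p1"
  have P: "P > 1" using p1 p1pos by (simp add: P_def)
  obtain C where C: "C > 0" "\<And>(f::'a \<Rightarrow> real) b x t. f \<in> borel_measurable borel \<Longrightarrow> radial f \<Longrightarrow> norm b = 1 \<Longrightarrow> x \<noteq> 0 \<Longrightarrow> 0 < t \<Longrightarrow>
     ennreal (\<bar>sph_avg t f x\<bar> powr p) \<le> ennreal C * (ennreal (1 / (norm x * t * max (norm x) t ^ (DIM('a) - 2))) *
        (\<integral>\<^sup>+s. ennreal (\<bar>f (s *\<^sub>R b)\<bar> powr p) * ennreal (s ^ ?n) * indicator {\<bar>norm x - t\<bar>..norm x + t} s \<partial>lborel))"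
    using sph_avg_power_bound[OF d p] by blast
  obtain C1 where C1: "C1 > 0" "\<And>(f::'a \<Rightarrow> real) b x t. f \<in> borel_measurable borel \<Longrightarrow> radial f \<Longrightarrow> norm b = 1 \<Longrightarrow> x \<noteq> 0 \<Longrightarrow> 0 < t \<Longrightarrow>
     ennreal (\<bar>sph_avg t f x\<bar> powr p1) \<le> ennreal C1 * (ennreal (1 / (norm x * t * max (norm x) t ^ (DIM('a) - 2))) *
        (\<integral>\<^sup>+s. ennreal (\<bar>f (s *\<^sub>R b)\<bar> powr p1) * ennreal (s ^ ?n) * indicator {\<bar>norm x - t\<bar>..norm x + t} s \<partial>lborel))"
    using sph_avg_power_bound[OF d p1(1)] by blast
  define c1 where "c1 = C1 * 3 ^ ?n"
  have c1: "c1 > 0" using C1(1) by (simp add: c1_def)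
  define c2 where "c2 = 2 * P * 4 powr (P - 1) / (P - 1)"
  have c2: "c2 \<ge> 0" using P by (simp add: c2_def)
  define K1 where "K1 = C * 2 ^ ?n * 4"
  define K2 where "K2 = c1 powr P * (c2 * 2 ^ ?n)"
  have K: "K1 \<ge> 0" "K2 \<ge> 0" using C(1) c2 by (auto simp: K1_def K2_def)
  define D where "D = C + (K1 + K2)"
  have D: "D > 0" "C \<le> D" using C(1) K by (auto simp: D_def)
  show ?thesis
    unfolding Let_def
  proof (rule exI[of _ D], intro conjI allI impI D(1))
    fix f :: "'a \<Rightarrow> real" and b :: 'a
    assume [measurable]: "f \<in> borel_measurable borel" and f: "radial f" and b: "norm b = 1"
    define G where "G s = ennreal (\<bar>f (s *\<^sub>R b)\<bar> powr p) * (ennreal (s ^ ?n) * indicator {0<..} s)" for s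
    have [measurable]: "G \<in> borel_measurable borel" unfolding G_def by measurable
    define I where "I = (\<integral>\<^sup>+s. G s \<partial>lborel)"
    define V where "V r = (\<integral>\<^sup>+s. G s * indicator {r - 2..r + 2} s \<partial>lborel)" for r
    have [measurable]: "V \<in> borel_measurable borel"
      unfolding V_def by (simp add: indicator_def)
    \<comment> \<open>For \<open>norm x < 1 / 2\<close> and \<open>t\<close> in
      \<open>[1, 2]\<close> all radii lie in \<open>[1 / 2, 3]\<close>, where the weight
      \<open>s ^ ?n\<close> is bounded above and below; the factors \<open>2 ^ ?n\<close> and
      \<open>3 ^ ?n\<close> come from here.\<close>
    define h where "h s = \<bar>f (s *\<^sub>R b)\<bar> powr p1 * indicator {1 / 2..3} s" for s
    have [measurable]: "h \<in> borel_measurable borel" unfolding h_def by measurable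
    have hP: "(\<integral>\<^sup>+s. ennreal (h s powr P) \<partial>lborel) \<le> ennreal (2 ^ ?n) * I"
    proof -
      have "(\<integral>\<^sup>+s. ennreal (h s powr P) \<partial>lborel) \<le> (\<integral>\<^sup>+s. ennreal (2 ^ ?n) * G s \<partial>lborel)"
      proof (rule nn_integral_mono)
        fix s
        show "ennreal (h s powr P) \<le> ennreal (2 ^ ?n) * G s"
        proof (cases "s \<in> {1 / 2..3}")
          case True
          have "h s powr P = \<bar>f (s *\<^sub>R b)\<bar> powr p"
            using True p1pos by (simp add: h_def P_def powr_powr)
          also have "\<dots> \<le> \<bar>f (s *\<^sub>R b)\<bar> powr p * (2 * s) ^ ?n"
            using True by (intro mult_le_cancel_left1[THEN iffD2] conjI impI one_le_power) auto
          finally have "ennreal (h s powr P) \<le> ennreal (\<bar>f (s *\<^sub>R b)\<bar> powr p * (2 * s) ^ ?n)"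
            by (rule ennreal_leI)
          also have "\<bar>f (s *\<^sub>R b)\<bar> powr p * (2 * s) ^ ?n = 2 ^ ?n * (\<bar>f (s *\<^sub>R b)\<bar> powr p * s ^ ?n)"
            by (simp add: power_mult_distrib)
          also have "ennreal \<dots> = ennreal (2 ^ ?n) * G s"
            using True by (simp add: G_def ennreal_mult)
          finally show ?thesis .
        qed (simp add: h_def)
      qed
      also have "\<dots> = ennreal (2 ^ ?n) * I" unfolding I_def by (rule nn_integral_cmult) simp
      finally show ?thesis .
    qed
    obtain W where [measurable]: "W \<in> borel_measurable borel"
      and W1: "(\<integral>\<^sup>+r. W r * indicator {0<..} r \<partial>lborel) \<le> ennreal c2 * (\<integral>\<^sup>+s. ennreal (h s powr P) \<partial>lborel)"
      and W2: "\<And>r t y. r > 0 \<Longrightarrow> y \<ge> 0 \<Longrightarrow> ennreal (r * y) \<le> (\<integral>\<^sup>+s. ennreal (h s) * indicator {t - r..t + r} s \<partial>lborel) \<Longrightarrow> ennreal (y powr P) \<le> W r"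
      using maximal_function_majorant[of h P] P unfolding c2_def by (auto simp: h_def)
    define U where "U r = (if 1 / 2 \<le> r then ennreal (C / r ^ ?n) * V r else ennreal (c1 powr P) * W r)" for r
    have [measurable]: "U \<in> borel_measurable borel" unfolding U_def by measurable
    have key: "ennreal (\<bar>sph_avg t f x\<bar> powr p) \<le> ennreal (C * k) * V (norm x)"
      if x: "x \<noteq> 0" and t: "1 \<le> t" "t \<le> 2" and k: "1 / (norm x * t * max (norm x) t ^ (DIM('a) - 2)) \<le> k" for x t k
    proof -
      have k0: "0 \<le> k" using x t by (intro order_trans[OF _ k]) auto
      have "ennreal (\<bar>sph_avg t f x\<bar> powr p) \<le> ennreal C * (ennreal (1 / (norm x * t * max (norm x) t ^ (DIM('a) - 2))) *
        (\<integral>\<^sup>+s. ennreal (\<bar>f (s *\<^sub>R b)\<bar> powr p) * ennreal (s ^ ?n) * indicator {\<bar>norm x - t\<bar>..norm x + t} s \<partial>lborel))"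
        using C(2)[of f b x t] f b x t by simp
      also have "\<dots> \<le> ennreal C * (ennreal k * V (norm x))"
        unfolding V_def
      proof (rule mult_left_mono, rule mult_mono[OF ennreal_leI[OF k]], rule nn_integral_mono)
        fix s :: real
        show "ennreal (\<bar>f (s *\<^sub>R b)\<bar> powr p) * ennreal (s ^ ?n) * indicator {\<bar>norm x - t\<bar>..norm x + t} s \<le> G s * indicator {norm x - 2..norm x + 2} s"
          using t n by (cases "s = 0") (auto simp: G_def indicator_def mult.assoc)
      qed auto
      also have "\<dots> = ennreal (C * k) * V (norm x)"
        using C(1) k0 by (simp add: ennreal_mult mult.assoc)
      finally show ?thesis .
    qed
    have VI: "V r \<le> I" for r
      unfolding V_def I_def by (intro nn_integral_mono) (auto simp: indicator_def)
    have pt: "ennreal (\<bar>sph_avg t f x\<bar> powr p) \<le> ennreal (D / min 1 (norm x)) * I"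
      "ennreal (\<bar>sph_avg t f x\<bar> powr p) \<le> U (norm x)" if x: "x \<noteq> 0" and t: "1 \<le> t" "t \<le> 2" for x t
    proof -
      let ?r = "norm x" and ?m = "max (norm x) t"
      have r: "?r > 0" using x by simp
      have m1: "1 \<le> ?m ^ (DIM('a) - 2)" using t by (intro one_le_power) auto
      have m2: "?r ^ (DIM('a) - 2) \<le> ?m ^ (DIM('a) - 2)" by (intro power_mono) auto
      have rt: "?r \<le> ?r * t" using r t by simp
      \<comment> \<open>Both use \<open>t \<ge> 1\<close>. The bound \<open>1 / ?r\<close> is the
        one for small norms, while \<open>1 / ?r ^ ?n\<close> cancels the volume weight on the range
        \<open>?r \<ge> 1 / 2\<close>.\<close>
      have b1: "1 / (?r * t * ?m ^ (DIM('a) - 2)) \<le> 1 / ?r"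
        using r t m1 mult_mono[OF rt m1] by (intro divide_left_mono) (auto intro!: mult_pos_pos)
      have b2: "1 / (?r * t * ?m ^ (DIM('a) - 2)) \<le> 1 / ?r ^ ?n"
        using r t m1 mult_mono[OF rt m2] unfolding n by (intro divide_left_mono) (auto intro!: mult_pos_pos)
      have "ennreal (\<bar>sph_avg t f x\<bar> powr p) \<le> ennreal (C * (1 / min 1 ?r)) * V ?r"
        by (rule key[OF x t]) (rule order_trans[OF b1], use r in \<open>auto simp: field_simps\<close>)
      also have "\<dots> \<le> ennreal (D / min 1 ?r) * I"
        using D r by (intro mult_mono ennreal_leI VI) (auto intro!: divide_right_mono)
      finally show "ennreal (\<bar>sph_avg t f x\<bar> powr p) \<le> ennreal (D / min 1 ?r) * I" .
      show "ennreal (\<bar>sph_avg t f x\<bar> powr p) \<le> U ?r"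
      proof (cases "1 / 2 \<le> ?r")
        case True
        then show ?thesis using key[OF x t b2] by (simp add: U_def)
      next
        case False
        \<comment> \<open>Divided by \<open>c1\<close> so that all prefactors cancel and
          \<open>?r * y\<close> is bounded by the bare window integral that \<open>W2\<close> asks
          for. The window is centred at \<open>t\<close> because
          \<open>?r < 1 / 2 < t\<close>.\<close>
        define y where "y = \<bar>sph_avg t f x\<bar> powr p1 / c1"
        have "ennreal (?r * y) = ennreal (?r / c1) * ennreal (\<bar>sph_avg t f x\<bar> powr p1)"
          using r c1 by (subst ennreal_mult[symmetric]) (auto simp: y_def)
        also have "\<dots> \<le> ennreal (?r / c1) * (ennreal C1 * (ennreal (1 / (?r * t * ?m ^ (DIM('a) - 2))) *
           (\<integral>\<^sup>+s. ennreal (\<bar>f (s *\<^sub>R b)\<bar> powr p1) * ennreal (s ^ ?n) * indicator {\<bar>?r - t\<bar>..?r + t} s \<partial>lborel)))"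
          using C1(2)[of f b x t] f b x t by (intro mult_left_mono) auto
        also have "\<dots> \<le> ennreal (?r / c1) * (ennreal C1 * (ennreal (1 / ?r) * (\<integral>\<^sup>+s. ennreal (3 ^ ?n) * (ennreal (h s) * indicator {t - ?r..t + ?r} s) \<partial>lborel)))"
        proof (rule mult_left_mono, rule mult_left_mono, rule mult_mono[OF ennreal_leI[OF b1]], rule nn_integral_mono)
          fix s :: real
          show "ennreal (\<bar>f (s *\<^sub>R b)\<bar> powr p1) * ennreal (s ^ ?n) * indicator {\<bar>?r - t\<bar>..?r + t} s
            \<le> ennreal (3 ^ ?n) * (ennreal (h s) * indicator {t - ?r..t + ?r} s)"
          proof (cases "s \<in> {\<bar>?r - t\<bar>..?r + t}")
            case s: True
            then have s': "1 / 2 \<le> s" "s \<le> 3" "s \<in> {t - ?r..t + ?r}" using False t by auto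
            have "s ^ ?n \<le> 3 ^ ?n" using s' by (intro power_mono) auto
            then have "ennreal (s ^ ?n) * ennreal (\<bar>f (s *\<^sub>R b)\<bar> powr p1) \<le> ennreal (3 ^ ?n) * ennreal (\<bar>f (s *\<^sub>R b)\<bar> powr p1)"
              by (intro mult_right_mono ennreal_leI) auto
            then show ?thesis using s s' by (simp add: h_def mult.commute)
          qed simp
        qed auto
        also have "\<dots> = (ennreal (?r / c1) * (ennreal C1 * (ennreal (1 / ?r) * ennreal (3 ^ ?n)))) * (\<integral>\<^sup>+s. ennreal (h s) * indicator {t - ?r..t + ?r} s \<partial>lborel)"
          by (subst nn_integral_cmult) (auto simp: mult.assoc)
        also have "ennreal (?r / c1) * (ennreal C1 * (ennreal (1 / ?r) * ennreal (3 ^ ?n))) = ennreal (?r / c1 * (C1 * (1 / ?r * 3 ^ ?n)))"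
          using r c1 C1(1) by (simp only: ennreal_mult mult_nonneg_nonneg divide_nonneg_nonneg less_imp_le zero_le_power zero_le_numeral zero_le_one)
        also have "?r / c1 * (C1 * (1 / ?r * 3 ^ ?n)) = 1"
          using x C1(1) by (simp add: c1_def)
        finally have "ennreal (y powr P) \<le> W ?r"
          using r c1 by (intro W2[of _ _ t]) (auto simp: y_def)
        then have "ennreal (c1 powr P) * ennreal (y powr P) \<le> ennreal (c1 powr P) * W ?r"
          by (rule mult_left_mono) simp
        moreover have "c1 powr P * y powr P = \<bar>sph_avg t f x\<bar> powr p"
          using c1 p1pos by (simp add: y_def powr_divide powr_powr P_def)
        ultimately show ?thesis using False by (simp add: U_def flip: ennreal_mult')
      qed
    qed
    have "(\<integral>\<^sup>+r. U r * (ennreal (max 1 r ^ ?n) * indicator {0<..} r) \<partial>lborel)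
      \<le> (\<integral>\<^sup>+r. ennreal (C * 2 ^ ?n) * V r + ennreal (c1 powr P) * (W r * indicator {0<..} r) \<partial>lborel)"
    proof (rule nn_integral_mono)
      fix r :: real
      show "U r * (ennreal (max 1 r ^ ?n) * indicator {0<..} r) \<le> ennreal (C * 2 ^ ?n) * V r + ennreal (c1 powr P) * (W r * indicator {0<..} r)"
      proof (cases "1 / 2 \<le> r")
        case True
        have "U r * (ennreal (max 1 r ^ ?n) * indicator {0<..} r) = (ennreal (C / r ^ ?n) * ennreal (max 1 r ^ ?n)) * V r"
          using True by (simp add: U_def mult_ac)
        also have "ennreal (C / r ^ ?n) * ennreal (max 1 r ^ ?n) = ennreal (C * (max 1 r ^ ?n / r ^ ?n))"
          using C(1) True by (subst ennreal_mult[symmetric]) auto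
        also have "\<dots> * V r \<le> ennreal (C * 2 ^ ?n) * V r"
          using C(1) max_power_over_le[OF True] by (intro mult_right_mono ennreal_leI mult_left_mono) auto
        finally show ?thesis by (rule order_trans) simp
      next
        case False
        then have "U r * (ennreal (max 1 r ^ ?n) * indicator {0<..} r) = ennreal (c1 powr P) * (W r * indicator {0<..} r)"
          by (simp add: U_def max_def mult.assoc)
        then show ?thesis by simp
      qed
    qed
    also have "\<dots> = ennreal (C * 2 ^ ?n) * (\<integral>\<^sup>+r. V r \<partial>lborel) + ennreal (c1 powr P) * (\<integral>\<^sup>+r. W r * indicator {0<..} r \<partial>lborel)"
      by (simp add: nn_integral_add nn_integral_cmult)
    also have "\<dots> \<le> ennreal (C * 2 ^ ?n) * (ennreal 4 * I) + ennreal (c1 powr P) * (ennreal c2 * (ennreal (2 ^ ?n) * I))"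
    proof (intro add_mono mult_left_mono)
      show "(\<integral>\<^sup>+r. V r \<partial>lborel) \<le> ennreal 4 * I"
        unfolding V_def I_def by (subst nn_integral_sliding_window) auto
      show "(\<integral>\<^sup>+r. W r * indicator {0<..} r \<partial>lborel) \<le> ennreal c2 * (ennreal (2 ^ ?n) * I)"
        by (rule order_trans[OF W1]) (intro mult_left_mono hP zero_le)
    qed auto
    also have "\<dots> = ennreal (K1 + K2) * I"
    proof -
      have "ennreal (C * 2 ^ ?n) * (ennreal 4 * I) = ennreal K1 * I"
        using C(1) unfolding K1_def by (subst ennreal_mult[of "C * 2 ^ ?n" 4]) (auto simp: mult.assoc)
      moreover have "ennreal (c1 powr P) * (ennreal c2 * (ennreal (2 ^ ?n) * I)) = ennreal K2 * I"
        using c2 unfolding K2_def by (simp only: ennreal_mult mult_nonneg_nonneg powr_ge_zero zero_le_power zero_le_numeral mult.assoc)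
      ultimately show ?thesis using K by (simp add: distrib_right)
    qed
    also have "\<dots> \<le> ennreal D * I"
      using C(1) by (intro mult_right_mono ennreal_leI) (auto simp: D_def)
    finally have int: "(\<integral>\<^sup>+r. U r * (ennreal (max 1 r ^ ?n) * indicator {0<..} r) \<partial>lborel) \<le> ennreal D * I" .
    have I_eq: "I = (\<integral>\<^sup>+s. ennreal (\<bar>f (s *\<^sub>R b)\<bar> powr p) * (ennreal (s ^ ?n) * indicator {0<..} s) \<partial>lborel)"
      unfolding I_def G_def ..
    show "\<exists>U\<in>borel_measurable borel.
       (\<integral>\<^sup>+r. U r * (ennreal (max 1 r ^ ?n) * indicator {0<..} r) \<partial>lborel)
         \<le> ennreal D * (\<integral>\<^sup>+s. ennreal (\<bar>f (s *\<^sub>R b)\<bar> powr p) * (ennreal (s ^ ?n) * indicator {0<..} s) \<partial>lborel) \<and>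
       (\<forall>x t. x \<noteq> 0 \<longrightarrow> 1 \<le> t \<longrightarrow> t \<le> 2 \<longrightarrow>
         ennreal (\<bar>sph_avg t f x\<bar> powr p) \<le> ennreal (D / min 1 (norm x)) * (\<integral>\<^sup>+s. ennreal (\<bar>f (s *\<^sub>R b)\<bar> powr p) * (ennreal (s ^ ?n) * indicator {0<..} s) \<partial>lborel) \<and>
         ennreal (\<bar>sph_avg t f x\<bar> powr p) \<le> U (norm x))"
      unfolding I_eq[symmetric] using int pt by (intro bexI[of _ U]) auto
  qed
qed

text \<open>With \<open>A\<close> a spherical average, \<open>\<bar>A\<bar> powr q\<close> is
  \<open>\<bar>A\<bar> powr p\<close> times its \<open>\<theta>\<close>-th power. The first factor
  is bounded by the majorant \<open>U\<close>, the second by the pointwise bound, at the price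
  \<open>min 1 r powr - \<theta>\<close>. As \<open>q \<le> d * p\<close> says
  \<open>\<theta> \<le> d - 1\<close>, the price is at most \<open>(1 / min 1 r) ^ (d - 1)\<close>;
  multiplied by the volume weight \<open>r ^ (d - 1)\<close> this is exactly
  \<open>max 1 r ^ (d - 1)\<close>, the weight against which \<open>U\<close> is integrable.\<close>

lemma nn_integral_max_sph_bound:
  fixes p q :: real
  assumes d: "DIM('a::euclidean_space) \<ge> 2" and p: "p > real DIM('a) / (real DIM('a) - 1)"
    and q: "p \<le> q" "q \<le> real DIM('a) * p"
  shows "\<exists>C\<ge>0. \<forall>f::'a \<Rightarrow> real. \<forall>i\<ge>0. f \<in> borel_measurable borel \<longrightarrow> radial f \<longrightarrow>
    (\<integral>\<^sup>+x. ennreal (\<bar>f x\<bar> powr p) \<partial>lborel) = ennreal i \<longrightarrow>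
    (\<integral>\<^sup>+x. enn_rpow (max_sph {1..2} f x) q \<partial>lborel) \<le> ennreal (C * i powr (q / p))"
proof -
  let ?n = "DIM('a) - 1"
  have "real DIM('a) / (real DIM('a) - 1) \<ge> 0" using d by simp
  then have p0: "p > 0" using p by linarith
  define \<theta> where "\<theta> = (q - p) / p"
  have \<theta>: "0 \<le> \<theta>" "\<theta> \<le> real ?n" "1 + \<theta> = q / p" "p * \<theta> = q - p"
    using q p0 d by (auto simp: \<theta>_def field_simps of_nat_diff)
  define K where "K = unit_ball_vol DIM('a) * DIM('a)"
  have K: "K > 0" by (simp add: K_def)
  obtain D where D: "D > 0" and maj: "\<forall>(f::'a \<Rightarrow> real) b. f \<in> borel_measurable borel \<longrightarrow> radial f \<longrightarrow> norm b = 1 \<longrightarrow>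
    (let I = (\<integral>\<^sup>+s. ennreal (\<bar>f (s *\<^sub>R b)\<bar> powr p) * (ennreal (s ^ ?n) * indicator {0<..} s) \<partial>lborel) in
     \<exists>U\<in>borel_measurable borel.
       (\<integral>\<^sup>+r. U r * (ennreal (max 1 r ^ ?n) * indicator {0<..} r) \<partial>lborel) \<le> ennreal D * I \<and>
       (\<forall>x t. x \<noteq> 0 \<longrightarrow> 1 \<le> t \<longrightarrow> t \<le> 2 \<longrightarrow>
         ennreal (\<bar>sph_avg t f x\<bar> powr p) \<le> ennreal (D / min 1 (norm x)) * I \<and>
         ennreal (\<bar>sph_avg t f x\<bar> powr p) \<le> U (norm x)))"
    using sph_avg_majorant[OF d p] by blast
  show ?thesis
  proof (intro exI[of _ "K * (D / K) powr (q / p)"] conjI allI impI)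
    show "0 \<le> K * (D / K) powr (q / p)" using K by simp
    fix f :: "'a \<Rightarrow> real" and i :: real
    assume i: "0 \<le> i" and [measurable]: "f \<in> borel_measurable borel" and f: "radial f"
      and norm_f: "(\<integral>\<^sup>+x. ennreal (\<bar>f x\<bar> powr p) \<partial>lborel) = ennreal i"
    obtain b :: 'a where b: "b \<in> Basis" using nonempty_Basis by blast
    then have nb: "norm b = 1" by simp
    define I where "I = (\<integral>\<^sup>+s. ennreal (\<bar>f (s *\<^sub>R b)\<bar> powr p) * (ennreal (s ^ ?n) * indicator {0<..} s) \<partial>lborel)"
    define j where "j = i / K"
    have j: "0 \<le> j" using i K by (simp add: j_def)
    have "ennreal i = (\<integral>\<^sup>+x. ennreal (\<bar>f (norm x *\<^sub>R b)\<bar> powr p) \<partial>(lborel :: 'a measure))"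
      unfolding norm_f[symmetric] by (subst radial_eq_profile[OF f nb]) simp
    also have "\<dots> = ennreal K * I"
      unfolding K_def I_def by (rule nn_integral_lborel_norm) measurable
    finally have "ennreal (1 / K) * (ennreal K * I) = ennreal (1 / K) * ennreal i" by simp
    then have "I = ennreal (1 / K) * ennreal i"
      using K by (simp flip: mult.assoc ennreal_mult')
    then have Ij: "I = ennreal j"
      using K i by (simp add: j_def flip: ennreal_mult')
    obtain U where [measurable]: "U \<in> borel_measurable borel"
      and U1: "(\<integral>\<^sup>+r. U r * (ennreal (max 1 r ^ ?n) * indicator {0<..} r) \<partial>lborel) \<le> ennreal D * ennreal j"
      and U2: "\<And>x t. x \<noteq> 0 \<Longrightarrow> 1 \<le> t \<Longrightarrow> t \<le> 2 \<Longrightarrow> ennreal (\<bar>sph_avg t f x\<bar> powr p) \<le> ennreal (D / min 1 (norm x)) * ennreal j"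
      and U3: "\<And>x t. x \<noteq> 0 \<Longrightarrow> 1 \<le> t \<Longrightarrow> t \<le> 2 \<Longrightarrow> ennreal (\<bar>sph_avg t f x\<bar> powr p) \<le> U (norm x)"
      using maj[rule_format, OF _ f nb, folded I_def] unfolding Let_def Ij by (auto simp: Ij)
    define B where "B r = ennreal ((D * j) powr \<theta>) * (ennreal ((1 / min 1 r) ^ ?n) * U r)" for r
    have [measurable]: "B \<in> borel_measurable borel" unfolding B_def by measurable
    have pt: "enn_rpow (max_sph {1..2} f x) q \<le> B (norm x)" if x: "x \<noteq> 0" for x
      unfolding max_sph_def
    proof (rule enn_rpow_SUP_le)
      show "q > 0" using p0 q by linarith
      fix t :: real assume "t \<in> {1..2}"
      then have t: "1 \<le> t" "t \<le> 2" by auto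
      let ?\<alpha> = "\<bar>sph_avg t f x\<bar>" and ?m = "min 1 (norm x)"
      have m: "0 < ?m" "?m \<le> 1" using x by auto
      have "ennreal (?\<alpha> powr p) \<le> ennreal (D / ?m * j)"
        using U2[OF x t] D j m by (simp flip: ennreal_mult')
      then have a1: "?\<alpha> powr p \<le> D * j / ?m" using D j m by (subst (asm) ennreal_le_iff) auto
      have "(?\<alpha> powr p) powr \<theta> \<le> (D * j / ?m) powr \<theta>"
        using \<theta> a1 by (intro powr_mono2) auto
      also have "\<dots> = (D * j) powr \<theta> * (1 / ?m) powr \<theta>"
        using D j m by (subst powr_mult[symmetric]) auto
      also have "\<dots> \<le> (D * j) powr \<theta> * (1 / ?m) powr (real ?n)"
        using \<theta> m by (intro mult_left_mono powr_mono) (auto simp: field_simps)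
      also have "(1 / ?m) powr (real ?n) = (1 / ?m) ^ ?n" using m by (intro powr_realpow) auto
      finally have a2: "(?\<alpha> powr p) powr \<theta> \<le> (D * j) powr \<theta> * (1 / ?m) ^ ?n" .
      have "?\<alpha> powr q = ?\<alpha> powr p * (?\<alpha> powr p) powr \<theta>"
        unfolding powr_powr \<theta>(4) powr_add[symmetric] by simp
      then have "ennreal (?\<alpha> powr q) = ennreal ((?\<alpha> powr p) powr \<theta>) * ennreal (?\<alpha> powr p)"
        by (simp add: ennreal_mult mult.commute)
      also have "\<dots> \<le> ennreal ((D * j) powr \<theta> * (1 / ?m) ^ ?n) * U (norm x)"
        by (intro mult_mono ennreal_leI a2 U3 x t) auto
      also have "\<dots> = B (norm x)"
        using m by (simp add: B_def ennreal_mult mult.assoc)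
      finally show "enn_rpow (ennreal ?\<alpha>) q \<le> B (norm x)" by (simp add: enn_rpow_ennreal)
    qed
    have "(\<integral>\<^sup>+x. enn_rpow (max_sph {1..2} f x) q \<partial>lborel) \<le> (\<integral>\<^sup>+x. B (norm x) \<partial>(lborel::'a measure))"
      by (rule nn_integral_mono_AE, rule AE_mp[OF AE_lborel_singleton[of 0]]) (auto simp: pt)
    also have "\<dots> = ennreal K * (\<integral>\<^sup>+r. B r * (ennreal (r ^ ?n) * indicator {0<..} r) \<partial>lborel)"
      unfolding K_def by (rule nn_integral_lborel_norm) measurable
    also have "(\<integral>\<^sup>+r. B r * (ennreal (r ^ ?n) * indicator {0<..} r) \<partial>lborel)
      = (\<integral>\<^sup>+r. ennreal ((D * j) powr \<theta>) * (U r * (ennreal (max 1 r ^ ?n) * indicator {0<..} r)) \<partial>lborel)"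
    proof (rule nn_integral_cong)
      fix r :: real
      show "B r * (ennreal (r ^ ?n) * indicator {0<..} r) = ennreal ((D * j) powr \<theta>) * (U r * (ennreal (max 1 r ^ ?n) * indicator {0<..} r))"
      proof (cases "r > 0")
        case True
        have "1 / min 1 r * r = max 1 r" using True by (auto simp: min_def max_def)
        then have "(1 / min 1 r) ^ ?n * r ^ ?n = max 1 r ^ ?n" by (simp only: power_mult_distrib[symmetric])
        then have "ennreal ((1 / min 1 r) ^ ?n) * ennreal (r ^ ?n) = ennreal (max 1 r ^ ?n)"
          using True by (subst ennreal_mult[symmetric]) auto
        then show ?thesis using True by (simp add: B_def mult_ac)
      qed simp
    qed
    also have "\<dots> = ennreal ((D * j) powr \<theta>) * (\<integral>\<^sup>+r. U r * (ennreal (max 1 r ^ ?n) * indicator {0<..} r) \<partial>lborel)"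
      by (rule nn_integral_cmult) measurable
    also have "ennreal K * \<dots> \<le> ennreal K * (ennreal ((D * j) powr \<theta>) * (ennreal D * ennreal j))"
      by (intro mult_left_mono U1) auto
    also have "\<dots> = ennreal (K * ((D * j) * (D * j) powr \<theta>))"
      using K D j by (simp add: ennreal_mult mult_ac)
    also have "(D * j) * (D * j) powr \<theta> = (D * j) powr (q / p)"
      using D j by (simp add: powr_mult_base \<theta>(3))
    also have "D * j = D / K * i" by (simp add: j_def)
    also have "(D / K * i) powr (q / p) = (D / K) powr (q / p) * i powr (q / p)"
      by (intro powr_mult)
    finally show "(\<integral>\<^sup>+x. enn_rpow (max_sph {1..2} f x) q \<partial>lborel) \<le> ennreal (K * (D / K) powr (q / p) * i powr (q / p))"
      by (simp add: mult.assoc)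
  qed
qed

lemma lp_norm_pos_exponent:
  assumes "a \<noteq> 0"
  shows "lp_norm a g = enn_rpow (\<integral>\<^sup>+x. enn_rpow (g x) (1 / a) \<partial>lborel) a"
  using assms by (simp add: lp_norm_def nn_integral_completion)

text \<open>With \<open>p = 1 / a\<close> and \<open>q = 1 / b\<close> the region reads
  \<open>p > d / (d - 1)\<close> and \<open>p \<le> q \<le> d * p\<close>.\<close>

lemma rad_bounded_interior:
  assumes d: "DIM('a::euclidean_space) \<ge> 2" and a: "0 < a" "a < (real DIM('a) - 1) / real DIM('a)"
    and b: "a / real DIM('a) \<le> b" "b \<le> a"
  shows "rad_bounded TYPE('a) {1..2} a b"
proof -
  have b0: "b > 0" using a(1) b(1) d by (smt (verit) divide_pos_pos of_nat_0_less_iff DIM_positive)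
  have p: "1 / a > real DIM('a) / (real DIM('a) - 1)"
    using a d by (simp add: field_simps)
  have q: "1 / a \<le> 1 / b" "1 / b \<le> real DIM('a) * (1 / a)"
    using a(1) b0 b d by (simp_all add: field_simps)
  obtain C where C: "C \<ge> 0" and bnd: "\<And>(f::'a \<Rightarrow> real) i. i \<ge> 0 \<Longrightarrow> f \<in> borel_measurable borel \<Longrightarrow> radial f \<Longrightarrow>
    (\<integral>\<^sup>+x. ennreal (\<bar>f x\<bar> powr (1 / a)) \<partial>lborel) = ennreal i \<Longrightarrow>
    (\<integral>\<^sup>+x. enn_rpow (max_sph {1..2} f x) (1 / b) \<partial>lborel) \<le> ennreal (C * i powr (1 / b / (1 / a)))"
    using nn_integral_max_sph_bound[OF d p q] by blast
  show ?thesis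
    unfolding rad_bounded_def
  proof (intro exI[of _ "C powr b"] conjI allI impI)
    fix f :: "'a \<Rightarrow> real"
    assume f: "f \<in> borel_measurable borel" "radial f" and fin: "lp_norm a (\<lambda>x. ennreal \<bar>f x\<bar>) < \<infinity>"
    have na: "lp_norm a (\<lambda>x. ennreal \<bar>f x\<bar>) = enn_rpow (\<integral>\<^sup>+x. ennreal (\<bar>f x\<bar> powr (1 / a)) \<partial>lborel) a"
      using a(1) by (simp add: lp_norm_pos_exponent enn_rpow_ennreal)
    then have "(\<integral>\<^sup>+x. ennreal (\<bar>f x\<bar> powr (1 / a)) \<partial>lborel) \<noteq> \<infinity>" using fin by auto
    then obtain i where i: "0 \<le> i" "(\<integral>\<^sup>+x. ennreal (\<bar>f x\<bar> powr (1 / a)) \<partial>lborel) = ennreal i"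
      by (cases "\<integral>\<^sup>+x. ennreal (\<bar>f x\<bar> powr (1 / a)) \<partial>lborel" rule: ennreal_cases) auto
    have "lp_norm b (max_sph {1..2} f) \<le> enn_rpow (ennreal (C * i powr (1 / b / (1 / a)))) b"
      using b0 bnd[OF i(1) f i(2)] by (subst lp_norm_pos_exponent) (auto intro!: enn_rpow_mono)
    also have "\<dots> = ennreal (C powr b * i powr a)"
      using C i(1) a(1) b0 by (simp add: enn_rpow_ennreal powr_mult powr_powr)
    also have "\<dots> = ennreal (C powr b) * lp_norm a (\<lambda>x. ennreal \<bar>f x\<bar>)"
      using i(1) by (simp add: na i(2) enn_rpow_ennreal ennreal_mult)
    finally show "lp_norm b (max_sph {1..2} f) \<le> ennreal (C powr b) * lp_norm a (\<lambda>x. ennreal \<bar>f x\<bar>)" .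
  qed simp
qed

text \<open>A bound on \<open>f\<close> outside a null set has to reach every sphere, although
  spheres are themselves null sets. By radiality the exceptional set consists of a null set of
  radii, apart from the radius 0, and the Hoelder bound applied to its indicator \<open>F\<close>
  shows that each sphere centred away from the origin meets it in sphere measure zero.\<close>

lemma rad_bounded_origin:
  assumes d: "DIM('a::euclidean_space) \<ge> 2"
  shows "rad_bounded TYPE('a) {1..2} 0 0"
  unfolding rad_bounded_def
proof (intro exI[of _ 1] conjI allI impI)
  fix f :: "'a \<Rightarrow> real"
  assume [measurable]: "f \<in> borel_measurable borel" and f: "radial f"
  obtain b :: 'a where "b \<in> Basis" using nonempty_Basis by blast
  then have nb: "norm b = 1" by simp
  have "{c. AE x in lebesgue. ennreal \<bar>f x\<bar> \<le> c} \<subseteq> {c. AE x in lebesgue. max_sph {1..2} f x \<le> c}"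
  proof (rule subsetI)
    fix c assume "c \<in> {c. AE x in lebesgue. ennreal \<bar>f x\<bar> \<le> c}"
    then have ae: "AE x in lborel. ennreal \<bar>f x\<bar> \<le> c"
      by (simp add: AE_completion_iff)
    define F where "F s = (if ennreal \<bar>f (s *\<^sub>R b)\<bar> \<le> c then 0 else 1 :: real)" for s
    have [measurable]: "F \<in> borel_measurable borel" unfolding F_def by measurable
    \<comment> \<open>For \<open>d \<ge> 2\<close> the critical exponent is at most 2, so 3 is a
      valid Hoelder exponent in every dimension.\<close>
    have "real DIM('a) / (real DIM('a) - 1) < 3" using d by (simp add: field_simps)
    then obtain C where C: "C > 0" "\<And>(F::real \<Rightarrow> real) (x::'a) t. F \<in> borel_measurable borel \<Longrightarrow> (\<forall>s. 0 \<le> F s) \<Longrightarrow> t > 0 \<Longrightarrow> x \<noteq> 0 \<Longrightarrow>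
      enn_rpow (\<integral>\<^sup>+y. ennreal (F (norm (x - t *\<^sub>R y))) \<partial>sphere_measure) 3
      \<le> ennreal C * (ennreal (1 / (norm x * t * max (norm x) t ^ (DIM('a) - 2))) *
         (\<integral>\<^sup>+s. ennreal (F s powr 3) * ennreal (s ^ (DIM('a) - 1)) * indicator {\<bar>norm x - t\<bar>..norm x + t} s \<partial>lborel))"
      using sphere_radial_Holder[OF d, of 3] by blast
    have "(\<integral>\<^sup>+s. ennreal (F s) * (ennreal (s ^ (DIM('a) - 1)) * indicator {0<..} s) \<partial>lborel) = 0"
    proof -
      have "ennreal (unit_ball_vol DIM('a) * DIM('a)) * (\<integral>\<^sup>+s. ennreal (F s) * (ennreal (s ^ (DIM('a) - 1)) * indicator {0<..} s) \<partial>lborel)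
         = (\<integral>\<^sup>+x. ennreal (F (norm x)) \<partial>(lborel::'a measure))"
        by (rule nn_integral_lborel_norm[symmetric]) measurable
      also have "\<dots> = (\<integral>\<^sup>+x. 0 \<partial>(lborel::'a measure))"
        by (rule nn_integral_cong_AE, rule AE_mp[OF ae])
           (auto simp: F_def radial_eq_profile[OF f nb, symmetric])
      finally show ?thesis by auto
    qed
    then have F0: "AE s in lborel. ennreal (F s) * (ennreal (s ^ (DIM('a) - 1)) * indicator {0<..} s) = 0"
      by (subst (asm) nn_integral_0_iff_AE) auto
    have "max_sph {1..2} f x \<le> c" if x: "x \<noteq> 0" for x
      unfolding max_sph_def
    proof (rule SUP_least)
      fix t :: real assume "t \<in> {1..2}"
      then have t: "t > 0" by auto
      have "(\<integral>\<^sup>+s. ennreal (F s powr 3) * ennreal (s ^ (DIM('a) - 1)) * indicator {\<bar>norm x - t\<bar>..norm x + t} s \<partial>lborel) = (\<integral>\<^sup>+s. 0 \<partial>(lborel :: real measure))"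
        by (rule nn_integral_cong_AE, rule AE_mp[OF F0], rule AE_mp[OF AE_lborel_singleton[of 0]])
           (auto simp: F_def indicator_def split: if_splits)
      then have "enn_rpow (\<integral>\<^sup>+y. ennreal (F (norm (x - t *\<^sub>R y))) \<partial>sphere_measure) 3 \<le> 0"
        using C(2)[of F t x] t x by (simp add: F_def)
      then have "enn_rpow (enn_rpow (\<integral>\<^sup>+y. ennreal (F (norm (x - t *\<^sub>R y))) \<partial>sphere_measure) 3) (1 / 3) = 0"
        by simp
      then have "(\<integral>\<^sup>+y. ennreal (F (norm (x - t *\<^sub>R y))) \<partial>sphere_measure) = 0"
        by (simp add: enn_rpow_enn_rpow)
      then have "AE y in sphere_measure. ennreal (F (norm (x - t *\<^sub>R y))) = 0"
        by (subst (asm) nn_integral_0_iff_AE) auto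
      then have "AE y in sphere_measure. ennreal \<bar>f (x - t *\<^sub>R y)\<bar> \<le> c"
        by eventually_elim (auto simp: F_def radial_eq_profile[OF f nb, symmetric] split: if_splits)
      then have "(\<integral>\<^sup>+y. ennreal \<bar>f (x - t *\<^sub>R y)\<bar> \<partial>sphere_measure) \<le> (\<integral>\<^sup>+y. c \<partial>(sphere_measure :: 'a measure))"
        by (rule nn_integral_mono_AE)
      also have "\<dots> = c" by simp
      finally show "ennreal \<bar>sph_avg t f x\<bar> \<le> c" using abs_sph_avg_le[of t f x] by (rule order_trans[rotated])
    qed
    then have "AE x in lborel. max_sph {1..2} f x \<le> c"
      using AE_lborel_singleton[of "0::'a"] by (auto elim: eventually_mono)
    then show "c \<in> {c. AE x in lebesgue. max_sph {1..2} f x \<le> c}" by (auto intro: AE_completion)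
  qed
  then show "lp_norm 0 (max_sph {1..2} f) \<le> ennreal 1 * lp_norm 0 (\<lambda>x. ennreal \<bar>f x\<bar>)"
    by (simp add: lp_norm_def Inf_superset_mono)
qed simp

section \<open>Necessity\<close>

lemma lp_norm_le_indicator:
  fixes g :: "'a::euclidean_space \<Rightarrow> ennreal"
  assumes [measurable]: "S \<in> sets borel" and S: "emeasure lborel S = ennreal \<mu>" "0 < \<mu>"
    and "0 \<le> k" "0 \<le> a" and g: "\<And>x. g x \<le> ennreal k * indicator S x"
  shows "lp_norm a g \<le> ennreal (k * \<mu> powr a)"
proof (cases "a = 0")
  case True
  have "g x \<le> ennreal k" for x
    using g[of x] by (rule order_trans) (simp add: indicator_def)
  then show ?thesis using True S(2) by (auto simp: lp_norm_def intro!: Inf_lower)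
next
  case False
  have "(\<integral>\<^sup>+x. enn_rpow (g x) (1 / a) \<partial>lborel) \<le> (\<integral>\<^sup>+x. ennreal (k powr (1 / a)) * indicator S x \<partial>lborel)"
  proof (rule nn_integral_mono)
    fix x
    have "enn_rpow (g x) (1 / a) \<le> enn_rpow (ennreal k * indicator S x) (1 / a)"
      using \<open>0 \<le> a\<close> g by (intro enn_rpow_mono) auto
    also have "\<dots> = ennreal (k powr (1 / a)) * indicator S x"
      using \<open>0 \<le> k\<close> by (simp add: indicator_def enn_rpow_ennreal)
    finally show "enn_rpow (g x) (1 / a) \<le> ennreal (k powr (1 / a)) * indicator S x" .
  qed
  also have "\<dots> = ennreal (k powr (1 / a) * \<mu>)"
    using S by (simp add: nn_integral_cmult_indicator ennreal_mult)
  finally have "lp_norm a g \<le> enn_rpow (ennreal (k powr (1 / a) * \<mu>)) a"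
    using False \<open>0 \<le> a\<close> by (simp add: lp_norm_pos_exponent enn_rpow_mono)
  also have "\<dots> = ennreal (k * \<mu> powr a)"
    using False S \<open>0 \<le> k\<close> \<open>0 \<le> a\<close> by (simp add: enn_rpow_ennreal powr_mult powr_powr)
  finally show ?thesis .
qed

text \<open>For \<open>a = 0\<close> every essential bound is at least \<open>k\<close> because
  \<open>S\<close> has positive measure. Since \<open>\<mu> powr 0 = 1\<close>, one formula serves
  all exponents, here and in the upper bound.\<close>

lemma lp_norm_ge_indicator:
  fixes g :: "'a::euclidean_space \<Rightarrow> ennreal"
  assumes [measurable]: "S \<in> sets borel" and S: "emeasure lborel S = ennreal \<mu>" "0 < \<mu>"
    and "0 \<le> k" "0 \<le> a" and g: "\<And>x. x \<in> S \<Longrightarrow> ennreal k \<le> g x"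
  shows "ennreal (k * \<mu> powr a) \<le> lp_norm a g"
proof (cases "a = 0")
  case True
  have "ennreal k \<le> c" if "AE x in lebesgue. g x \<le> c" for c
  proof (rule ccontr)
    assume "\<not> ennreal k \<le> c"
    with that g have "AE x in lebesgue. x \<notin> S"
      by (auto elim!: eventually_mono intro: order_trans)
    then have "AE x in lborel. x \<notin> S" by (subst (asm) AE_completion_iff) auto
    then have "emeasure lborel S = 0" by (subst (asm) AE_iff_measurable[of S]) auto
    then show False using S by simp
  qed
  then show ?thesis using True S(2) by (auto simp: lp_norm_def intro!: Inf_greatest)
next
  case False
  have "ennreal (k * \<mu> powr a) = enn_rpow (ennreal (k powr (1 / a) * \<mu>)) a"
    using False S \<open>0 \<le> k\<close> \<open>0 \<le> a\<close> by (simp add: enn_rpow_ennreal powr_mult powr_powr)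
  also have "ennreal (k powr (1 / a) * \<mu>) = (\<integral>\<^sup>+x. ennreal (k powr (1 / a)) * indicator S x \<partial>lborel)"
    using S by (simp add: nn_integral_cmult_indicator ennreal_mult)
  also have "enn_rpow \<dots> a \<le> enn_rpow (\<integral>\<^sup>+x. enn_rpow (g x) (1 / a) \<partial>lborel) a"
  proof (intro enn_rpow_mono nn_integral_mono \<open>0 \<le> a\<close>)
    fix x
    show "ennreal (k powr (1 / a)) * indicator S x \<le> enn_rpow (g x) (1 / a)"
      using enn_rpow_mono[OF g[of x], of "1 / a"] \<open>0 \<le> k\<close> \<open>0 \<le> a\<close>
      by (simp add: indicator_def enn_rpow_ennreal)
  qed
  also have "\<dots> = lp_norm a g" using False by (simp add: lp_norm_pos_exponent)
  finally show ?thesis .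
qed

lemma powr_bounded_imp_nonpos:
  fixes e K :: real
  assumes "\<And>N::nat. 1 \<le> N \<Longrightarrow> real N powr e \<le> K"
  shows "e \<le> 0"
proof (rule ccontr)
  assume "\<not> e \<le> 0"
  then have e: "e > 0" by simp
  define M where "M = \<bar>K\<bar> + 1"
  have M: "M > K" "M \<ge> 1" by (auto simp: M_def)
  obtain N where N: "M powr (1 / e) \<le> real N" using real_arch_simple by blast
  have "1 \<le> M powr (1 / e)" using M e by (intro ge_one_powr_ge_zero) auto
  then have "1 \<le> N" using N by linarith
  have "M = (M powr (1 / e)) powr e" using e M by (simp add: powr_powr)
  also have "\<dots> \<le> real N powr e" using N e by (intro powr_mono2) auto
  also have "\<dots> \<le> K" using \<open>1 \<le> N\<close> by (rule assms)
  finally show False using M by simp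
qed

lemma sph_avg_eq_1:
  fixes x :: "'a::euclidean_space"
  assumes [measurable]: "S \<in> sets borel" and "\<And>y. norm y = 1 \<Longrightarrow> x - t *\<^sub>R y \<in> S"
  shows "sph_avg t (indicator S) x = 1"
proof -
  have "sph_avg t (indicator S) x = (\<integral>y. 1 \<partial>(sphere_measure :: 'a measure))"
    unfolding sph_avg_def
    by (rule integral_cong_AE, measurable, rule AE_mp[OF AE_sphere_measure]) (auto simp: assms(2))
  also have "\<dots> = 1" by (simp add: measure_def)
  finally show ?thesis .
qed

lemma max_sph_ge: "t \<in> E \<Longrightarrow> k \<le> \<bar>sph_avg t f x\<bar> \<Longrightarrow> ennreal k \<le> max_sph E f x"
  unfolding max_sph_def by (rule SUP_upper2) (auto intro: ennreal_leI)

lemma rad_boundedE: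
  assumes "rad_bounded TYPE('a::euclidean_space) E a b"
  obtains C where "C \<ge> 0" and
    "\<And>f::'a \<Rightarrow> real. f \<in> borel_measurable borel \<Longrightarrow> radial f \<Longrightarrow> lp_norm a (\<lambda>x. ennreal \<bar>f x\<bar>) < \<infinity> \<Longrightarrow>
       lp_norm b (max_sph E f) \<le> ennreal C * lp_norm a (\<lambda>x. ennreal \<bar>f x\<bar>)"
  using assms unfolding rad_bounded_def by blast

text \<open>If the spheres of radius \<open>t\<close> about all points of \<open>S'\<close> lie in
  \<open>S\<close>, the maximal function of \<open>indicator S\<close> is at least 1 on
  \<open>S'\<close>. Two large balls, and a small ball with a thin shell, are the instances
  used.\<close>

lemma rad_bounded_indicator:
  assumes "rad_bounded TYPE('a::euclidean_space) E a b" "0 \<le> a" "0 \<le> b"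
  obtains C where "C \<ge> 0" and
    "\<And>(S::'a set) S' \<mu> \<mu>' t. S \<in> sets borel \<Longrightarrow> S' \<in> sets borel \<Longrightarrow> radial (indicator S :: 'a \<Rightarrow> real) \<Longrightarrow> emeasure lborel S = ennreal \<mu> \<Longrightarrow> 0 < \<mu> \<Longrightarrow>
       emeasure lborel S' = ennreal \<mu>' \<Longrightarrow> 0 < \<mu>' \<Longrightarrow> t \<in> E \<Longrightarrow>
       (\<forall>x y. x \<in> S' \<longrightarrow> norm y = 1 \<longrightarrow> x - t *\<^sub>R y \<in> S) \<Longrightarrow> \<mu>' powr b \<le> C * \<mu> powr a"
proof -
  obtain C where C: "C \<ge> 0" and bnd:
    "\<And>f::'a \<Rightarrow> real. f \<in> borel_measurable borel \<Longrightarrow> radial f \<Longrightarrow> lp_norm a (\<lambda>x. ennreal \<bar>f x\<bar>) < \<infinity> \<Longrightarrow>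
       lp_norm b (max_sph E f) \<le> ennreal C * lp_norm a (\<lambda>x. ennreal \<bar>f x\<bar>)"
    using rad_boundedE[OF assms(1)] by blast
  show ?thesis
  proof (rule that[OF C])
    fix S S' :: "'a set" and \<mu> \<mu>' t
    assume [measurable]: "S \<in> sets borel" "S' \<in> sets borel"
      and *: "radial (indicator S :: 'a \<Rightarrow> real)" "emeasure lborel S = ennreal \<mu>" "0 < \<mu>"
       "emeasure lborel S' = ennreal \<mu>'" "0 < \<mu>'" "t \<in> E"
       "\<forall>x y. x \<in> S' \<longrightarrow> norm y = 1 \<longrightarrow> x - t *\<^sub>R y \<in> S"
    let ?f = "indicator S :: 'a \<Rightarrow> real"
    have le: "lp_norm a (\<lambda>x. ennreal \<bar>?f x\<bar>) \<le> ennreal (1 * \<mu> powr a)"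
      by (rule lp_norm_le_indicator[of S]) (use * assms in \<open>auto simp: indicator_def\<close>)
    have "ennreal (1 * \<mu>' powr b) \<le> lp_norm b (max_sph E ?f)"
    proof (rule lp_norm_ge_indicator[of S'])
      fix x assume "x \<in> S'"
      then have "sph_avg t ?f x = 1" using * by (intro sph_avg_eq_1) auto
      then show "ennreal 1 \<le> max_sph E ?f x" using *(6) by (intro max_sph_ge[of t]) auto
    qed (use * assms in auto)
    also have "\<dots> \<le> ennreal C * lp_norm a (\<lambda>x. ennreal \<bar>?f x\<bar>)"
      using le * by (intro bnd) (auto simp: le_less_trans)
    also have "\<dots> \<le> ennreal C * ennreal (1 * \<mu> powr a)" by (intro mult_left_mono le) auto
    finally show "\<mu>' powr b \<le> C * \<mu> powr a" using C by (simp flip: ennreal_mult')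
  qed
qed

text \<open>\<open>S'\<close> is the ball of radius \<open>N\<close> and \<open>S\<close> that of
  radius \<open>2 * N\<close>, which leaves room for \<open>t = 1\<close>. The test bounds
  \<open>N powr (d * (b - a))\<close> uniformly in \<open>N\<close>.\<close>

lemma rad_bounded_imp_le:
  assumes "rad_bounded TYPE('a::euclidean_space) {1..2} a b" "0 \<le> a" "0 \<le> b"
  shows "b \<le> a"
proof -
  let ?d = "DIM('a)" and ?w = "unit_ball_vol DIM('a)"
  obtain C where C: "C \<ge> 0" and bnd: "\<And>(S::'a set) S' \<mu> \<mu>' t. S \<in> sets borel \<Longrightarrow> S' \<in> sets borel \<Longrightarrow> radial (indicator S :: 'a \<Rightarrow> real) \<Longrightarrow> emeasure lborel S = ennreal \<mu> \<Longrightarrow> 0 < \<mu> \<Longrightarrow>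
       emeasure lborel S' = ennreal \<mu>' \<Longrightarrow> 0 < \<mu>' \<Longrightarrow> t \<in> {1..2} \<Longrightarrow>
       (\<forall>x y. x \<in> S' \<longrightarrow> norm y = 1 \<longrightarrow> x - t *\<^sub>R y \<in> S) \<Longrightarrow> \<mu>' powr b \<le> C * \<mu> powr a"
    using rad_bounded_indicator[OF assms] by blast
  have w: "?w > 0" by simp
  have "real N powr (real ?d * (b - a)) \<le> C * (?w * 2 ^ ?d) powr a / ?w powr b" if N: "1 \<le> N" for N :: nat
  proof -
    have "(?w * real N ^ ?d) powr b \<le> C * (?w * (2 * real N) ^ ?d) powr a"
    proof (rule bnd[of "cball 0 (2 * real N)" "cball 0 (real N)" _ _ 1])
      show "radial (indicator (cball 0 (2 * real N)) :: 'a \<Rightarrow> real)" by (simp add: radial_def indicator_def)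
      show "\<forall>x y. x \<in> cball (0::'a) (real N) \<longrightarrow> norm y = 1 \<longrightarrow> x - 1 *\<^sub>R y \<in> cball 0 (2 * real N)"
      proof (intro allI impI)
        fix x y :: 'a assume "x \<in> cball 0 (real N)" "norm y = 1"
        then show "x - 1 *\<^sub>R y \<in> cball 0 (2 * real N)"
          using norm_triangle_ineq4[of x y] N by simp
      qed
    qed (use w N in \<open>auto simp: emeasure_cball\<close>)
    also have "?w * (2 * real N) ^ ?d = (?w * 2 ^ ?d) * real N ^ ?d" by (simp add: power_mult_distrib)
    finally have *: "?w powr b * real N powr (real ?d * b) \<le> C * ((?w * 2 ^ ?d) powr a * real N powr (real ?d * a))"
      using w N by (simp add: powr_mult powr_powr flip: powr_realpow)
    have "real N powr (real ?d * (b - a)) = real N powr (real ?d * b) / real N powr (real ?d * a)"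
      by (simp add: right_diff_distrib powr_diff)
    also have "\<dots> \<le> C * (?w * 2 ^ ?d) powr a / ?w powr b"
      using * w N by (simp add: field_simps)
    finally show ?thesis .
  qed
  then have "real ?d * (b - a) \<le> 0" by (rule powr_bounded_imp_nonpos)
  then show ?thesis by (simp add: mult_le_0_iff)
qed

text \<open>Up to the volume of the unit ball the left side is the volume of a shell, linear in its
  thickness; the crude factor \<open>2 ^ n\<close> comes from
  \<open>1 + \<delta> \<le> 2\<close>.\<close>

lemma power_shell_le:
  fixes \<delta> :: real
  assumes "0 \<le> \<delta>" "\<delta> \<le> 1"
  shows "(1 + \<delta>) ^ n - (1 - \<delta>) ^ n \<le> real n * 2 ^ n * \<delta>"
proof (induction n)
  case (Suc n)
  have nn: "0 \<le> (1 + \<delta>) ^ n - (1 - \<delta>) ^ n" using assms by (simp add: power_mono)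
  have "(1 + \<delta>) ^ Suc n - (1 - \<delta>) ^ Suc n = (1 + \<delta>) * ((1 + \<delta>) ^ n - (1 - \<delta>) ^ n) + 2 * \<delta> * (1 - \<delta>) ^ n"
    by (simp add: algebra_simps)
  also have "\<dots> \<le> 2 * (real n * 2 ^ n * \<delta>) + 2 * \<delta> * 1"
    using assms Suc nn by (intro add_mono mult_mono power_le_one) auto
  also have "\<dots> \<le> real (Suc n) * 2 ^ Suc n * \<delta>"
  proof -
    have "2 * \<delta> * 1 \<le> 2 * \<delta> * 2 ^ n" using assms by (intro mult_left_mono) auto
    then show ?thesis by (simp add: algebra_simps)
  qed
  finally show ?case .
qed simp

text \<open>A unit sphere centred within \<open>\<delta>\<close> of the origin stays in the shell of
  half-width \<open>\<delta>\<close>. Up to constants the ball gives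
  \<open>\<delta> powr (d * b)\<close> and the shell at most \<open>\<delta> powr a\<close>, while
  \<open>\<delta> = 1 / N\<close> tends to 0.\<close>

lemma rad_bounded_imp_ge:
  assumes "rad_bounded TYPE('a::euclidean_space) {1..2} a b" "0 \<le> a" "0 \<le> b"
  shows "a / real DIM('a) \<le> b"
proof -
  let ?d = "DIM('a)" and ?w = "unit_ball_vol DIM('a)"
  obtain C where C: "C \<ge> 0" and bnd: "\<And>(S::'a set) S' \<mu> \<mu>' t. S \<in> sets borel \<Longrightarrow> S' \<in> sets borel \<Longrightarrow> radial (indicator S :: 'a \<Rightarrow> real) \<Longrightarrow> emeasure lborel S = ennreal \<mu> \<Longrightarrow> 0 < \<mu> \<Longrightarrow>
       emeasure lborel S' = ennreal \<mu>' \<Longrightarrow> 0 < \<mu>' \<Longrightarrow> t \<in> {1..2} \<Longrightarrow>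
       (\<forall>x y. x \<in> S' \<longrightarrow> norm y = 1 \<longrightarrow> x - t *\<^sub>R y \<in> S) \<Longrightarrow> \<mu>' powr b \<le> C * \<mu> powr a"
    using rad_bounded_indicator[OF assms] by blast
  have w: "?w > 0" by simp
  define A where "A = ?w * (real ?d * 2 ^ ?d)"
  have A: "A > 0" using w by (simp add: A_def)
  have "real N powr (a - real ?d * b) \<le> C * A powr a / ?w powr b" if N: "1 \<le> N" for N :: nat
  proof -
    define \<delta> where "\<delta> = 1 / real N"
    have \<delta>: "0 < \<delta>" "\<delta> \<le> 1" using N by (auto simp: \<delta>_def)
    let ?S = "cball 0 (1 + \<delta>) - ball 0 (1 - \<delta>) :: 'a set"
    let ?\<mu> = "?w * (1 + \<delta>) ^ ?d - ?w * (1 - \<delta>) ^ ?d"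
    have "(1 - \<delta>) ^ ?d < (1 + \<delta>) ^ ?d" using \<delta> by (intro power_strict_mono) auto
    then have \<mu>: "?\<mu> > 0" using w by simp
    have eS: "emeasure lborel ?S = ennreal ?\<mu>"
      using \<delta> by (subst emeasure_Diff) (auto simp: emeasure_ball emeasure_cball ennreal_minus)
    have "(?w * \<delta> ^ ?d) powr b \<le> C * ?\<mu> powr a"
    proof (rule bnd[of ?S "cball 0 \<delta>" _ _ 1])
      show "radial (indicator ?S :: 'a \<Rightarrow> real)" by (simp add: radial_def indicator_def)
      show "\<forall>x y. x \<in> cball (0::'a) \<delta> \<longrightarrow> norm y = 1 \<longrightarrow> x - 1 *\<^sub>R y \<in> ?S"
      proof (intro allI impI)
        fix x y :: 'a assume "x \<in> cball 0 \<delta>" "norm y = 1"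
        then show "x - 1 *\<^sub>R y \<in> ?S"
          using norm_triangle_ineq4[of x y] norm_triangle_ineq2[of y x] by (simp add: norm_minus_commute)
      qed
    qed (use w \<delta> \<mu> eS in \<open>auto simp: emeasure_cball\<close>)
    also have "?\<mu> powr a \<le> (A * \<delta>) powr a"
      using power_shell_le[of \<delta> ?d] \<delta> w \<mu> assms(2)
      by (intro powr_mono2) (auto simp: A_def mult.assoc simp flip: right_diff_distrib)
    finally have "(?w * \<delta> ^ ?d) powr b \<le> C * (A * \<delta>) powr a" using C by (simp add: mult_left_mono)
    then have *: "?w powr b * \<delta> powr (real ?d * b) \<le> C * (A powr a * \<delta> powr a)"
      using w \<delta> A by (simp add: powr_mult powr_powr flip: powr_realpow)
    have "real N powr (a - real ?d * b) = \<delta> powr (real ?d * b) / \<delta> powr a"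
      using N by (simp add: \<delta>_def powr_diff powr_divide)
    also have "\<dots> \<le> C * A powr a / ?w powr b"
      using * w \<delta> by (simp add: field_simps)
    finally show ?thesis .
  qed
  then have "a - real ?d * b \<le> 0" by (rule powr_bounded_imp_nonpos)
  then show ?thesis by (simp add: field_simps)
qed

section \<open>Logarithmic divergence at the critical exponent\<close>

lemma spherical_distance_near_pole:
  fixes r v \<rho> :: real
  assumes "0 < r" "r \<le> 2" "0 < \<rho>" and v: "v \<le> - 2 / \<rho>"
  shows "sqrt (r\<^sup>2 + r\<^sup>2 + 2 * r * r * (v / sqrt (1 + v\<^sup>2))) \<le> \<rho>"
proof -
  let ?q = "sqrt (1 + v\<^sup>2)"
  have "- 2 / \<rho> < 0" using assms by simp
  then have vneg: "v < 0" using v by linarith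
  have q: "?q > 0" "?q * ?q = 1 + v\<^sup>2" "- v \<le> ?q" by (auto simp: add_pos_nonneg intro: real_le_rsqrt)
  \<comment> \<open>Rationalizing removes the cancellation:
    \<open>1 + v / ?q = 1 / ((?q - v) * ?q)\<close>, which is at most
    \<open>1 / (2 * v\<^sup>2)\<close> because \<open>?q \<ge> - v > 0\<close>. The distance is then
    at most \<open>r / - v\<close>, hence at most \<open>\<rho>\<close>.\<close>
  have "1 + v / ?q = (?q + v) / ?q" using q by (simp add: add_divide_distrib)
  also have "?q + v = 1 / (?q - v)"
    using q vneg by (simp add: field_simps power2_eq_square)
  also have "1 / (?q - v) / ?q \<le> 1 / ((- v + - v) * (- v))"
  proof -
    have "(- v + - v) * (- v) \<le> (?q - v) * ?q" using q vneg by (intro mult_mono) auto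
    then show ?thesis using q vneg by (simp add: divide_left_mono mult_neg_neg)
  qed
  finally have u: "1 + v / ?q \<le> 1 / (2 * v\<^sup>2)" by (simp add: power2_eq_square)
  have "r\<^sup>2 + r\<^sup>2 + 2 * r * r * (v / ?q) = 2 * r\<^sup>2 * (1 + v / ?q)" by (simp add: algebra_simps power2_eq_square)
  also have "\<dots> \<le> 2 * r\<^sup>2 * (1 / (2 * v\<^sup>2))" by (intro mult_left_mono u) auto
  also have "\<dots> = (r / v)\<^sup>2" using vneg by (simp add: power_divide)
  also have "\<dots> \<le> \<rho>\<^sup>2"
  proof -
    have "r \<le> \<rho> * - v" using v assms by (simp add: field_simps)
    then have "r / - v \<le> \<rho>" using vneg by (subst pos_divide_le_eq) auto
    then have "(r / - v)\<^sup>2 \<le> \<rho>\<^sup>2" using assms vneg by (intro power_mono divide_nonneg_nonneg) auto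
    then show ?thesis by (simp add: power_divide)
  qed
  finally show ?thesis using assms by (intro real_le_lsqrt) auto
qed

text \<open>The sphere of radius \<open>norm x\<close> about \<open>x\<close> passes through the
  origin, and the cap is its part within \<open>\<rho>\<close> of it. The range
  \<open>[- 4 / \<rho>, - 2 / \<rho>]\<close> of \<open>v\<close> is enough: its length is
  \<open>2 / \<rho>\<close>, and up to the normalizing constant the density there is at least
  \<open>(\<rho> / 5) ^ d\<close>.\<close>

lemma sphere_measure_cap_ge:
  fixes x :: "'a::euclidean_space"
  assumes d: "DIM('a) \<ge> 2" and x: "x \<noteq> 0" "norm x \<le> 2" and \<rho>: "0 < \<rho>" "\<rho> \<le> 1"
  shows "sphere_inner_const DIM('a) * (2 / 5 ^ DIM('a)) * \<rho> ^ (DIM('a) - 1)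
    \<le> measure sphere_measure {y. norm (x - norm x *\<^sub>R y) \<le> \<rho>}"
proof -
  interpret finite_measure "sphere_measure :: 'a measure" by (rule finite_measure_sphere_measure)
  let ?r = "norm x" and ?d = "DIM('a)"
  let ?S = "{y. norm (x - norm x *\<^sub>R y) \<le> \<rho>}" and ?J = "{- 4 / \<rho>..- 2 / \<rho>}"
  have [measurable]: "?S \<in> sets borel" by measurable
  have "ennreal (measure sphere_measure ?S) = (\<integral>\<^sup>+y. indicator ?S y \<partial>sphere_measure)"
    by (simp add: emeasure_eq_measure)
  also have "\<dots> = (\<integral>\<^sup>+y. indicator {..\<rho>} (norm (x - ?r *\<^sub>R y)) \<partial>sphere_measure)"
    by (intro nn_integral_cong) (auto simp: indicator_def)
  also have "\<dots> = ennreal (sphere_inner_const ?d) *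
      (\<integral>\<^sup>+v. indicator {..\<rho>} (sqrt (?r\<^sup>2 + ?r\<^sup>2 + 2 * ?r * ?r * (v / sqrt (1 + v\<^sup>2)))) * ennreal (1 / sqrt (1 + v\<^sup>2) ^ ?d) \<partial>lborel)"
    by (rule nn_integral_sphere_radial) (use d x in auto)
  finally have eq: "ennreal (measure sphere_measure ?S) = \<dots>" .
  have "ennreal (2 / 5 ^ ?d * \<rho> ^ (?d - 1)) = (\<integral>\<^sup>+v. ennreal ((\<rho> / 5) ^ ?d) * indicator ?J v \<partial>lborel)"
  proof -
    have "(\<integral>\<^sup>+v. ennreal ((\<rho> / 5) ^ ?d) * indicator ?J v \<partial>lborel) = ennreal ((\<rho> / 5) ^ ?d) * ennreal (2 / \<rho>)"
      using \<rho> by (subst nn_integral_cmult_indicator) (auto simp: divide_right_mono diff_divide_distrib[symmetric])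
    also have "\<dots> = ennreal ((\<rho> / 5) ^ ?d * (2 / \<rho>))" using \<rho> by (intro ennreal_mult[symmetric]) auto
    also have "(\<rho> / 5) ^ ?d * (2 / \<rho>) = 2 / 5 ^ ?d * \<rho> ^ (?d - 1)"
      using \<rho> d power_minus_mult[of ?d \<rho>] by (simp add: power_divide field_simps)
    finally show ?thesis by simp
  qed
  also have "\<dots> \<le> (\<integral>\<^sup>+v. indicator {..\<rho>} (sqrt (?r\<^sup>2 + ?r\<^sup>2 + 2 * ?r * ?r * (v / sqrt (1 + v\<^sup>2)))) * ennreal (1 / sqrt (1 + v\<^sup>2) ^ ?d) \<partial>lborel)"
  proof (rule nn_integral_mono)
    fix v :: real
    show "ennreal ((\<rho> / 5) ^ ?d) * indicator ?J v \<le> indicator {..\<rho>} (sqrt (?r\<^sup>2 + ?r\<^sup>2 + 2 * ?r * ?r * (v / sqrt (1 + v\<^sup>2)))) * ennreal (1 / sqrt (1 + v\<^sup>2) ^ ?d)"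
    proof (cases "v \<in> ?J")
      case True
      have in_cap: "sqrt (?r\<^sup>2 + ?r\<^sup>2 + 2 * ?r * ?r * (v / sqrt (1 + v\<^sup>2))) \<le> \<rho>"
        using True x \<rho> by (intro spherical_distance_near_pole) auto
      have "v\<^sup>2 \<le> (4 / \<rho>)\<^sup>2"
        using True \<rho> power_mono[of "- v" "4 / \<rho>" 2] by auto
      moreover have "1 \<le> (1 / \<rho>)\<^sup>2" using \<rho> by (intro one_le_power) auto
      \<comment> \<open>The 5 comes from \<open>1 + 16 \<le> 25\<close>, the 1 being absorbed by
        \<open>\<rho> \<le> 1\<close>.\<close>
      ultimately have "1 + v\<^sup>2 \<le> (5 / \<rho>)\<^sup>2"
        by (simp add: power_divide add_divide_distrib[symmetric] order_trans[of _ "1 / \<rho>\<^sup>2 + 16 / \<rho>\<^sup>2"] add_mono divide_right_mono)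
      then have "sqrt (1 + v\<^sup>2) \<le> 5 / \<rho>" using \<rho> by (intro real_le_lsqrt) auto
      then have "sqrt (1 + v\<^sup>2) ^ ?d \<le> (5 / \<rho>) ^ ?d" by (intro power_mono) auto
      then have "1 / (5 / \<rho>) ^ ?d \<le> 1 / sqrt (1 + v\<^sup>2) ^ ?d"
        by (intro divide_left_mono mult_pos_pos zero_less_power) (auto simp: add_pos_nonneg \<rho>)
      then have "(\<rho> / 5) ^ ?d \<le> 1 / sqrt (1 + v\<^sup>2) ^ ?d" by (simp add: power_divide)
      then show ?thesis using True in_cap by (simp add: ennreal_leI)
    qed simp
  qed
  finally have "ennreal (sphere_inner_const ?d) * ennreal (2 / 5 ^ ?d * \<rho> ^ (?d - 1)) \<le> ennreal (measure sphere_measure ?S)"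
    unfolding eq by (rule mult_left_mono) simp
  then show ?thesis
    using sphere_inner_const_pos[OF d] \<rho> by (simp add: mult.assoc flip: ennreal_mult')
qed

text \<open>For \<open>n = d - 1\<close> this is comparable to \<open>norm x powr (- n)\<close> on the range of scales; every scale contributes
  equally to the average over a sphere through the origin.\<close>
definition nested_balls :: "nat \<Rightarrow> nat \<Rightarrow> 'a::euclidean_space \<Rightarrow> real" where
  "nested_balls n N x = (\<Sum>k=1..N. 2 ^ (k * n) * indicator {x. norm x \<le> (1 / 2) ^ k} x)"

text \<open>A geometric sum of ratio at least 2 is at most twice its largest term, here the term of
  the smallest ball containing \<open>x\<close>. The p-th power of the sum is thus bounded by one
  p-th power, and no power of \<open>N\<close> is lost.\<close>

lemma nested_balls_powr_le:
  fixes x :: "'a::euclidean_space" and p :: real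
  assumes n: "n \<ge> 1" and p: "p > 0"
  shows "nested_balls n N x powr p \<le> 2 powr p * (\<Sum>k=1..N. (2 ^ (k * n)) powr p * indicator (cball 0 ((1 / 2) ^ k)) x)"
proof -
  define J where "J = {k \<in> {1..N}. norm x \<le> (1 / 2) ^ k}"
  have fin: "finite J" by (simp add: J_def)
  have eq: "nested_balls n N x = (\<Sum>k\<in>J. 2 ^ (k * n))"
    unfolding nested_balls_def J_def by (rule sum.mono_neutral_cong_right) (auto simp: indicator_def)
  have geo: "(\<Sum>k\<le>j. 2 ^ (k * n)) \<le> (2 * 2 ^ (j * n) :: real)" for j
  proof (induction j)
    case (Suc j)
    have "(2::real) ^ 1 \<le> 2 ^ n" using n by (intro power_increasing) auto
    then have "2 * 2 ^ (j * n) \<le> (2::real) ^ n * 2 ^ (j * n)" by (intro mult_right_mono) auto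
    moreover have "(2::real) ^ (Suc j * n) = 2 ^ n * 2 ^ (j * n)" by (simp add: power_add)
    ultimately show ?case using Suc unfolding sum.atMost_Suc by linarith
  qed simp
  show ?thesis
  proof (cases "J = {}")
    case True
    then show ?thesis by (auto simp: eq intro!: mult_nonneg_nonneg sum_nonneg)
  next
    case False
    define j where "j = Max J"
    have j: "j \<in> J" using False fin by (simp add: j_def)
    have "(\<Sum>k\<in>J. 2 ^ (k * n)) \<le> (\<Sum>k\<le>j. (2::real) ^ (k * n))"
      using fin by (intro sum_mono2) (auto simp: j_def)
    also have "\<dots> \<le> 2 * 2 ^ (j * n)" by (rule geo)
    finally have "nested_balls n N x powr p \<le> (2 * 2 ^ (j * n)) powr p"
      using p unfolding eq by (intro powr_mono2) (auto intro: sum_nonneg)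
    also have "\<dots> = 2 powr p * (2 ^ (j * n)) powr p" by (intro powr_mult)
    also have "(2 ^ (j * n)) powr p = (2 ^ (j * n)) powr p * indicator (cball 0 ((1 / 2) ^ j)) x"
      using j by (simp add: J_def)
    also have "\<dots> \<le> (\<Sum>k=1..N. (2 ^ (k * n)) powr p * indicator (cball 0 ((1 / 2) ^ k)) x)"
      using j by (intro member_le_sum) (auto simp: J_def)
    finally show ?thesis by simp
  qed
qed

lemma sph_avg_nested_balls_ge:
  fixes x :: "'a::euclidean_space"
  assumes d: "DIM('a) \<ge> 2" and x: "x \<noteq> 0" "norm x \<le> 2"
  shows "sphere_inner_const DIM('a) * (2 / 5 ^ DIM('a)) * real N \<le> sph_avg (norm x) (nested_balls (DIM('a) - 1) N) x"
proof -
  interpret finite_measure "sphere_measure :: 'a measure" by (rule finite_measure_sphere_measure)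
  let ?n = "DIM('a) - 1" and ?c = "sphere_inner_const DIM('a) * (2 / 5 ^ DIM('a))"
  let ?S = "\<lambda>k. {y. norm (x - norm x *\<^sub>R y) \<le> (1 / 2) ^ k}"
  have [measurable]: "?S k \<in> sets borel" for k by measurable
  have "sph_avg (norm x) (nested_balls ?n N) x = (\<integral>y. (\<Sum>k=1..N. 2 ^ (k * ?n) * indicator (?S k) y) \<partial>sphere_measure)"
    unfolding sph_avg_def nested_balls_def by (intro Bochner_Integration.integral_cong sum.cong) (auto simp: indicator_def)
  also have "\<dots> = (\<Sum>k=1..N. 2 ^ (k * ?n) * measure sphere_measure (?S k))"
    by (subst Bochner_Integration.integral_sum) (auto simp: integrable_indicator_iff emeasure_eq_measure)
  finally have eq: "sph_avg (norm x) (nested_balls ?n N) x = \<dots>" .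
  have "?c * real N = (\<Sum>k=1..N. 2 ^ (k * ?n) * (?c * ((1 / 2) ^ k) ^ ?n))"
  proof -
    have one: "(2::real) ^ (k * ?n) * ((1 / 2) ^ k) ^ ?n = 1" for k
    proof -
      have "(2::real) ^ (k * ?n) * ((1 / 2) ^ k) ^ ?n = (2 * (1 / 2)) ^ (k * ?n)"
        unfolding power_mult[symmetric] by (rule power_mult_distrib[symmetric])
      then show ?thesis by simp
    qed
    have "2 ^ (k * ?n) * (?c * ((1 / 2) ^ k) ^ ?n) = ?c" for k
      unfolding mult.left_commute[of "2 ^ (k * ?n)" ?c] one by simp
    then show ?thesis by (simp only: sum_constant) simp
  qed
  also have "\<dots> \<le> (\<Sum>k=1..N. 2 ^ (k * ?n) * measure sphere_measure (?S k))"
    by (intro sum_mono mult_left_mono sphere_measure_cap_ge d x) (auto intro: power_le_one)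
  finally show ?thesis unfolding eq .
qed

text \<open>The k-th ball contributes its coefficient to the power \<open>p\<close>, which is
  \<open>2 powr (k * (d - 1) * p)\<close>, times a volume of order \<open>2 powr (- k * d)\<close>.
  The exponent \<open>(d - 1) * p - d\<close> vanishes at the critical \<open>p\<close>, where the
  sum is \<open>N\<close> and the norm at most of order \<open>N powr (1 / p)\<close>, against
  averages of order \<open>N\<close>.\<close>

lemma nn_integral_nested_balls_le:
  fixes p :: real
  assumes d: "DIM('a::euclidean_space) \<ge> 2" and p: "p > 0"
  shows "(\<integral>\<^sup>+x. ennreal (nested_balls (DIM('a) - 1) N x powr p) \<partial>(lborel :: 'a measure))
    \<le> ennreal (2 powr p * (unit_ball_vol DIM('a) * (\<Sum>k=1..N. 2 powr (real k * (real (DIM('a) - 1) * p - real DIM('a))))))"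
proof -
  let ?n = "DIM('a) - 1" and ?d = "DIM('a)" and ?w = "unit_ball_vol DIM('a)"
  have "(\<integral>\<^sup>+x. ennreal (nested_balls ?n N x powr p) \<partial>(lborel :: 'a measure))
     \<le> (\<integral>\<^sup>+x. (\<Sum>k=1..N. ennreal (2 powr p * (2 ^ (k * ?n)) powr p) * indicator (cball 0 ((1 / 2) ^ k)) x) \<partial>(lborel :: 'a measure))"
  proof (rule nn_integral_mono)
    fix x :: 'a
    have "ennreal (nested_balls ?n N x powr p) \<le> ennreal (2 powr p * (\<Sum>k=1..N. (2 ^ (k * ?n)) powr p * indicator (cball 0 ((1 / 2) ^ k)) x))"
      using d p by (intro ennreal_leI nested_balls_powr_le) auto
    also have "\<dots> = (\<Sum>k=1..N. ennreal (2 powr p * ((2 ^ (k * ?n)) powr p * indicator (cball 0 ((1 / 2) ^ k)) x)))"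
      unfolding sum_distrib_left by (rule sum_ennreal[symmetric]) simp
    also have "\<dots> = (\<Sum>k=1..N. ennreal (2 powr p * (2 ^ (k * ?n)) powr p) * indicator (cball 0 ((1 / 2) ^ k)) x)"
      by (intro sum.cong refl) (auto simp: indicator_def)
    finally show "ennreal (nested_balls ?n N x powr p) \<le> (\<Sum>k=1..N. ennreal (2 powr p * (2 ^ (k * ?n)) powr p) * indicator (cball 0 ((1 / 2) ^ k)) x)" .
  qed
  also have "\<dots> = (\<Sum>k=1..N. ennreal (2 powr p * (2 ^ (k * ?n)) powr p) * ennreal (?w * ((1 / 2) ^ k) ^ ?d))"
  proof -
    have "(\<integral>\<^sup>+x. ennreal A * indicator (cball 0 r) x \<partial>(lborel :: 'a measure)) = ennreal A * ennreal (?w * r ^ ?d)"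
      if "0 \<le> r" for A r
      using that by (subst nn_integral_cmult_indicator) (simp_all add: emeasure_cball)
    then show ?thesis
      by (subst nn_integral_sum)
         (simp_all only: borel_measurable_times_ennreal borel_measurable_const borel_measurable_indicator
           sets_lborel borel_closed closed_cball zero_le_power zero_le_divide_1_iff zero_le_numeral)
  qed
  also have "\<dots> = (\<Sum>k=1..N. ennreal (2 powr p * (?w * 2 powr (real k * (real ?n * p - real ?d)))))"
  proof (intro sum.cong refl)
    fix k
    have "(2::real) ^ (k * ?n) = 2 powr (real k * real ?n)"
      using powr_realpow[of 2 "k * ?n"] by (simp only: of_nat_mult zero_less_numeral)
    then have 1: "((2::real) ^ (k * ?n)) powr p = 2 powr (real k * real ?n * p)" by (simp add: powr_powr)
    have "((1 / 2 :: real) ^ k) ^ ?d = 1 / 2 ^ (k * ?d)" by (simp add: power_mult power_one_over)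
    also have "\<dots> = 2 powr (- (real k * real ?d))"
      using powr_realpow[of 2 "k * ?d"] by (simp only: powr_minus_divide of_nat_mult zero_less_numeral)
    finally have 2: "((1 / 2 :: real) ^ k) ^ ?d = 2 powr (- (real k * real ?d))" .
    have "(2 powr p * (2 ^ (k * ?n)) powr p) * (?w * ((1 / 2) ^ k) ^ ?d)
      = 2 powr p * (?w * (2 powr (real k * real ?n * p) * 2 powr (- (real k * real ?d))))"
      unfolding 1 2 by (simp add: mult_ac)
    also have "2 powr (real k * real ?n * p) * 2 powr (- (real k * real ?d)) = 2 powr (real k * (real ?n * p - real ?d))"
      unfolding powr_add[symmetric] by (simp add: algebra_simps)
    finally show "ennreal (2 powr p * (2 ^ (k * ?n)) powr p) * ennreal (?w * ((1 / 2) ^ k) ^ ?d) = ennreal (2 powr p * (?w * 2 powr (real k * (real ?n * p - real ?d))))"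
      by (simp flip: ennreal_mult')
  qed
  also have "\<dots> = ennreal (2 powr p * (?w * (\<Sum>k=1..N. 2 powr (real k * (real ?n * p - real ?d)))))"
    by (subst sum_ennreal) (auto simp: sum_distrib_left)
  finally show ?thesis .
qed

text \<open>Each term is at most 1, so the sum is at most \<open>N\<close> and \<open>a' = a\<close>
  works for \<open>a < 1\<close>. For \<open>a = 1\<close> this would gain nothing over the averages
  of order \<open>N\<close>, but there \<open>e \<le> - 1\<close> makes the sum at most a geometric
  series of sum 1, and \<open>a' = 0\<close> works.\<close>

lemma sum_powr_half_le:
  fixes e a :: real
  assumes "e \<le> 0" "0 \<le> a" "a \<le> 1" and "a = 1 \<Longrightarrow> e \<le> - 1"
  shows "\<exists>a'<1. \<forall>N\<ge>1. (\<Sum>k=1..N. 2 powr (real k * e)) powr a \<le> real N powr a'"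
proof (cases "a = 1")
  case True
  have "(\<Sum>k=1..N. 2 powr (real k * e)) \<le> 1" for N
  proof -
    have "(\<Sum>k=1..N. 2 powr (real k * e)) \<le> (\<Sum>k=1..N. (1 / 2) ^ k)"
    proof (rule sum_mono)
      fix k
      have "real k * e \<le> - real k" using assms(4)[OF True] mult_left_mono[of e "-1" "real k"] by simp
      then have "2 powr (real k * e) \<le> 2 powr (- real k)" by (intro powr_mono) auto
      also have "\<dots> = (1 / 2) ^ k" by (simp add: powr_minus_divide powr_realpow power_one_over)
      finally show "2 powr (real k * e) \<le> (1 / 2) ^ k" .
    qed
    also have "\<dots> \<le> 1"
    proof -
      have "(\<Sum>k=1..N. (1 / 2 :: real) ^ k) = 1 - (1 / 2) ^ N"
        by (induction N) (auto simp: field_simps)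
      then show ?thesis by simp
    qed
    finally show ?thesis .
  qed
  then show ?thesis using True by (intro exI[of _ 0]) (auto simp: sum_nonneg)
next
  case False
  have "(\<Sum>k=1..N. 2 powr (real k * e)) powr a \<le> real N powr a" for N
  proof (intro powr_mono2 assms(2) sum_nonneg)
    have "2 powr (real k * e) \<le> 2 powr 0" for k
      using assms(1) by (intro powr_mono) (auto simp: mult_nonneg_nonpos)
    then show "(\<Sum>k=1..N. 2 powr (real k * e)) \<le> real N"
      using sum_mono[of "{1..N}" "\<lambda>k. 2 powr (real k * e)" "\<lambda>_. 1"] by simp
  qed simp
  then show ?thesis using False assms(3) by (intro exI[of _ a]) auto
qed

text \<open>The supremum enters through a radius that depends on the point: for \<open>x\<close> in
  the shell between radii 1 and 2 the choice \<open>t = norm x\<close> is admissible, and every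
  sphere so chosen passes through the origin. There the maximal function of
  \<open>nested_balls\<close> is at least \<open>c * N\<close>, while its norm is at most of order
  \<open>N powr a'\<close> with \<open>a' < 1\<close>.\<close>

lemma rad_bounded_imp_less:
  assumes d: "DIM('a::euclidean_space) \<ge> 2" and rb: "rad_bounded TYPE('a) {1..2} a b"
    and a: "0 \<le> a" "a \<le> 1" and b: "0 \<le> b"
  shows "a < (real DIM('a) - 1) / real DIM('a)"
proof (rule ccontr)
  assume "\<not> a < (real DIM('a) - 1) / real DIM('a)"
  then have ad: "a * real DIM('a) \<ge> real DIM('a) - 1" using d by (simp add: field_simps)
  let ?n = "DIM('a) - 1" and ?d = "DIM('a)" and ?w = "unit_ball_vol DIM('a)"
  have n: "real ?n = real ?d - 1" using d by simp
  have a0: "a > 0"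
  proof (rule ccontr)
    assume "\<not> a > 0"
    then show False using a ad d by simp
  qed
  define p where "p = 1 / a"
  define e where "e = real ?n * p - real ?d"
  \<comment> \<open>Here \<open>e = (d - 1) / a - d\<close>, so the negated claim is
    \<open>e \<le> 0\<close>, and \<open>a = 1\<close> gives \<open>e = - 1\<close>.\<close>
  have e: "e \<le> 0" "a = 1 \<Longrightarrow> e \<le> - 1"
    using ad a0 n by (auto simp: e_def p_def field_simps)
  obtain C where C: "C \<ge> 0" and bnd:
    "\<And>f::'a \<Rightarrow> real. f \<in> borel_measurable borel \<Longrightarrow> radial f \<Longrightarrow> lp_norm a (\<lambda>x. ennreal \<bar>f x\<bar>) < \<infinity> \<Longrightarrow>
       lp_norm b (max_sph {1..2} f) \<le> ennreal C * lp_norm a (\<lambda>x. ennreal \<bar>f x\<bar>)"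
    using rad_boundedE[OF rb] by blast
  define c where "c = sphere_inner_const ?d * (2 / 5 ^ ?d)"
  have c: "c > 0" using sphere_inner_const_pos[OF d] by (simp add: c_def)
  let ?S = "cball 0 2 - ball 0 1 :: 'a set"
  define \<mu> where "\<mu> = ?w * 2 ^ ?d - ?w"
  have \<mu>: "\<mu> > 0" unfolding \<mu>_def using d by (simp add: one_less_power)
  have eS: "emeasure lborel ?S = ennreal \<mu>"
    by (subst emeasure_Diff) (auto simp: emeasure_ball emeasure_cball ennreal_minus \<mu>_def)
  define T where "T N = (\<Sum>k=1..N. 2 powr (real k * e))" for N
  have T: "T N \<ge> 0" for N by (simp add: T_def sum_nonneg)
  obtain a' where a': "a' < 1" "\<And>N. N \<ge> 1 \<Longrightarrow> T N powr a \<le> real N powr a'"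
    using sum_powr_half_le[OF e(1) a e(2)] unfolding T_def by blast
  define K where "K = C * (2 powr p * ?w) powr a / (c * \<mu> powr b)"
  have "real N powr (1 - a') \<le> K" if N: "1 \<le> N" for N
  proof -
    let ?f = "nested_balls ?n N :: 'a \<Rightarrow> real"
    have meas: "?f \<in> borel_measurable borel" unfolding nested_balls_def by measurable
    have f0: "?f x \<ge> 0" for x by (auto simp: nested_balls_def intro!: sum_nonneg)
    have rad: "radial ?f" by (auto simp: radial_def nested_balls_def indicator_def)
    have "lp_norm a (\<lambda>x. ennreal \<bar>?f x\<bar>) = enn_rpow (\<integral>\<^sup>+x. ennreal (?f x powr p) \<partial>lborel) a"
      using a0 f0 by (simp add: lp_norm_pos_exponent enn_rpow_ennreal p_def)
    also have "\<dots> \<le> enn_rpow (ennreal (2 powr p * (?w * T N))) a"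
      unfolding T_def e_def using a0 d by (intro enn_rpow_mono nn_integral_nested_balls_le) (auto simp: p_def)
    also have "\<dots> = ennreal ((2 powr p * ?w) powr a * T N powr a)"
      using T[of N] by (simp add: enn_rpow_ennreal powr_mult mult.assoc)
    also have "\<dots> \<le> ennreal ((2 powr p * ?w) powr a * real N powr a')"
      using a'(2)[OF N] by (intro ennreal_leI mult_left_mono) auto
    finally have up: "lp_norm a (\<lambda>x. ennreal \<bar>?f x\<bar>) \<le> ennreal ((2 powr p * ?w) powr a * real N powr a')" .
    have "ennreal (c * real N * \<mu> powr b) \<le> lp_norm b (max_sph {1..2} ?f)"
    proof (rule lp_norm_ge_indicator[of ?S])
      fix x :: 'a assume "x \<in> ?S"
      then have x: "1 \<le> norm x" "norm x \<le> 2" by auto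
      then have "x \<noteq> 0" by auto
      then have "c * real N \<le> sph_avg (norm x) ?f x"
        unfolding c_def using x d by (intro sph_avg_nested_balls_ge)
      then show "ennreal (c * real N) \<le> max_sph {1..2} ?f x"
        using x by (intro max_sph_ge[of "norm x"]) auto
    qed (use eS \<mu> c b in auto)
    also have "\<dots> \<le> ennreal C * lp_norm a (\<lambda>x. ennreal \<bar>?f x\<bar>)"
      using up by (intro bnd rad meas) (auto simp: le_less_trans)
    also have "\<dots> \<le> ennreal C * ennreal ((2 powr p * ?w) powr a * real N powr a')"
      by (intro mult_left_mono up) auto
    finally have *: "c * real N * \<mu> powr b \<le> C * ((2 powr p * ?w) powr a * real N powr a')"
      using C by (simp flip: ennreal_mult')
    have "real N powr (1 - a') = real N / real N powr a'"
      using N by (simp add: powr_diff)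
    also have "\<dots> \<le> K"
      using * N c \<mu> by (simp add: K_def field_simps)
    finally show ?thesis .
  qed
  then have "1 - a' \<le> 0" by (rule powr_bounded_imp_nonpos)
  then show False using a' by simp
qed

section \<open>The triangle in coordinates\<close>

lemma Delta_minus_segment:
  assumes d: "d \<ge> (2::nat)"
  shows "Delta d 1 - closed_segment (Q1 d 1) (Q2 d 1)
    = {(a, b). 0 \<le> a \<and> a < (real d - 1) / real d \<and> a / real d \<le> b \<and> b \<le> a}"
proof -
  define c where "c = (real d - 1) / real d"
  have c: "0 < c" using d by (simp add: c_def)
  have Q1: "Q1 d 1 = (c, c)" by (simp add: Q1_def c_def)
  have Q2: "Q2 d 1 = (c, c / real d)" using d by (simp add: Q2_def c_def power2_eq_square)
  have hull: "Delta d 1 = {(a, b). 0 \<le> a \<and> a \<le> c \<and> a / real d \<le> b \<and> b \<le> a}"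
  proof (rule set_eqI, clarify)
    fix a b :: real
    have "(a, b) \<in> Delta d 1 \<longleftrightarrow> (\<exists>u v w. 0 \<le> u \<and> 0 \<le> v \<and> 0 \<le> w \<and> u + v + w = 1 \<and> a = v * c + w * c \<and> b = v * c + w * (c / real d))"
      unfolding Delta_def convex_hull_3 Q1 Q2 by auto
    also have "\<dots> \<longleftrightarrow> 0 \<le> a \<and> a \<le> c \<and> a / real d \<le> b \<and> b \<le> a"
    proof safe
      fix u v w :: real assume uvw: "0 \<le> u" "0 \<le> v" "0 \<le> w" "u + v + w = 1"
      have "v + w \<le> 1" using uvw by linarith
      then show "v * c + w * c \<le> c" using c by (simp flip: distrib_right)
      show "0 \<le> v * c + w * c" using uvw c by simp
      have cd: "c / real d \<le> c" using c d by (simp add: divide_le_eq)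
      have "v * (c / real d) \<le> v * c" using uvw cd by (intro mult_left_mono)
      then show "(v * c + w * c) / real d \<le> v * c + w * (c / real d)" by (simp add: add_divide_distrib)
      show "v * c + w * (c / real d) \<le> v * c + w * c" using uvw cd by (intro add_left_mono mult_left_mono)
    next
      assume ab: "0 \<le> a" "a \<le> c" "a / real d \<le> b" "b \<le> a"
      \<comment> \<open>\<open>h\<close> is the length of the vertical side between
        \<open>Q2\<close> and \<open>Q1\<close>; \<open>v\<close> and \<open>w\<close> are the
        barycentric coordinates at \<open>Q1\<close> and \<open>Q2\<close>, solved from the two
        linear equations.\<close>
      define h where "h = c * (1 - 1 / real d)"
      have h: "h > 0" using c d by (simp add: h_def)
      define v where "v = (b - a / real d) / h"
      define w where "w = (a - b) / h"
      have vw: "v + w = a / c"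
      proof -
        have "v + w = (a * (1 - 1 / real d)) / h"
          by (simp add: v_def w_def add_divide_distrib[symmetric] right_diff_distrib)
        also have "\<dots> = a / c" using d c by (simp add: h_def)
        finally show ?thesis .
      qed
      have wh: "w * h = a - b" using h by (simp add: w_def)
      have "v * c + w * c = a" using vw c by (simp flip: distrib_right)
      moreover have "v * c + w * (c / real d) = b"
      proof -
        have "v * c + w * (c / real d) = (v + w) * c - w * h" by (simp add: h_def algebra_simps)
        also have "\<dots> = a - (a - b)" using vw c by (simp add: wh)
        finally show ?thesis by simp
      qed
      moreover have "0 \<le> v" "0 \<le> w" using ab h by (auto simp: v_def w_def)
      moreover have "v + w \<le> 1" using vw ab c by simp
      ultimately show "\<exists>u v w. 0 \<le> u \<and> 0 \<le> v \<and> 0 \<le> w \<and> u + v + w = 1 \<and> a = v * c + w * c \<and> b = v * c + w * (c / real d)"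
        by (intro exI[of _ "1 - v - w"] exI[of _ v] exI[of _ w]) auto
    qed
    finally show "((a, b) \<in> Delta d 1) = ((a, b) \<in> {(a, b). 0 \<le> a \<and> a \<le> c \<and> a / real d \<le> b \<and> b \<le> a})" by simp
  qed
  have cd: "c / real d \<le> c" using c d by (simp add: divide_le_eq)
  have seg: "closed_segment (Q1 d 1) (Q2 d 1) = {(a, b). a = c \<and> c / real d \<le> b \<and> b \<le> c}"
  proof -
    have "closed_segment (c, c) (c, c / real d) = {c} \<times> closed_segment c (c / real d)"
    proof -
      have "(1 - u) * c + u * c = c" for u by (simp add: algebra_simps)
      then show ?thesis unfolding closed_segment_def by auto
    qed
    then show ?thesis using cd unfolding Q1 Q2 by (auto simp: closed_segment_eq_real_ivl)
  qed
  show ?thesis unfolding hull seg c_def[symmetric] by (auto simp: less_le)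
qed

theorem theorem1p1:
  assumes "DIM('a::euclidean_space) \<ge> 2"
  shows "rad_type_set TYPE('a) {1..2} = Delta DIM('a) 1 - closed_segment (Q1 DIM('a) 1) (Q2 DIM('a) 1)"
proof (rule set_eqI, clarify)
  fix a b :: real
  let ?R = "0 \<le> a \<and> a < (real DIM('a) - 1) / real DIM('a) \<and> a / real DIM('a) \<le> b \<and> b \<le> a"
  have "(a, b) \<in> rad_type_set TYPE('a) {1..2} \<longleftrightarrow> ?R"
  proof
    assume "(a, b) \<in> rad_type_set TYPE('a) {1..2}"
    then have "0 \<le> a" "a \<le> 1" "0 \<le> b" "rad_bounded TYPE('a) {1..2} a b"
      by (auto simp: rad_type_set_def)
    then show ?R
      using rad_bounded_imp_le[of a b] rad_bounded_imp_ge[of a b] rad_bounded_imp_less[OF assms, of a b] by blast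
  next
    assume R: ?R
    have "(real DIM('a) - 1) / real DIM('a) \<le> 1" by simp
    then have "a \<le> 1" "b \<le> 1" using R by linarith+
    have "0 \<le> a / real DIM('a)" using R by simp
    then have "0 \<le> b" using R by linarith
    have "rad_bounded TYPE('a) {1..2} a b"
    \<comment> \<open>At \<open>a = 0\<close> the constraints leave only \<open>b = 0\<close>, where
      both exponents are infinite and essential suprema replace the integrals.\<close>
    proof (cases "a = 0")
      case True
      then have "b = 0" using R \<open>0 \<le> b\<close> by simp
      then show ?thesis using True rad_bounded_origin[OF assms] by simp
    next
      case False
      then show ?thesis using R by (intro rad_bounded_interior[OF assms]) auto
    qed
    then show "(a, b) \<in> rad_type_set TYPE('a) {1..2}"
      using R \<open>a \<le> 1\<close> \<open>b \<le> 1\<close> \<open>0 \<le> b\<close> by (auto simp: rad_type_set_def)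
  qed
  then show "(a, b) \<in> rad_type_set TYPE('a) {1..2} \<longleftrightarrow> (a, b) \<in> Delta DIM('a) 1 - closed_segment (Q1 DIM('a) 1) (Q2 DIM('a) 1)"
    by (simp add: Delta_minus_segment[OF assms])
qed

end
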